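(* Fix an integer $d\ge 3$ and a constant $c_d\ge \dfrac{4(d-1)}{2d-3}$. Let $(p_n)$ be a sequence with $p_n>0$, $p_n\gtrsim n^{-(d-1)}\log^{c_d}n$ and $\sup_n p_n<1$. Let $k=k(n)\le n$ be a sequence of positive integers with $$k(n)\gg\left(\frac{p_n}{1-p_n}\right)^{\frac1{2(d-1)}}\sqrt n ,$$ and let $(A,S)$ be sampled from $\mathrm{HPC}(n,d,k(n),p_n)$. Let $u$ be a unit eigenvector corresponding to the largest eigenvalue of $A-\mathbb E_0[A]$, and let $\hat S_n\subset[n]$ be the set of indices of the $k(n)$ largest entries of $(|u_i|)_{i=1}^n$ (ties broken arbitrarily). Then $$\lim_{n\to\infty}\mathbb P(\hat S_n=S)=1 .$$
   Context: Write $[n]=\{1,\dots,n\}$; $\binom{[n]}{d}$ is the family of $d$-element subsets of $[n]$. For positive sequences, $a_n\gg b_n$ means $b_n/a_n\to0$, and $a_n\gtrsim b_n$ means $\limsup_{n\to\infty}b_n/a_n<\infty$. $\log^c n=(\log n)^c$. Hypergraph planted clique model $\mathrm{HPC}(n,d,k,p)$, $0\le k\le n$: sample $S\subset[n]$ uniformly among subsets of size $k$; given $S$, sample independent $\{0,1\}$-valued random variables $(H_e)_{e\in\binom{[n]}{d}}$ with $\mathbb P(H_e=1)=1$ if $e\subset S$ and $\mathbb P(H_e=1)=p$ if $e\not\subset S$. The adjacency matrix $A\in\mathbb R^{n\times n}$ is $A_{ij}=\sum_{e:\{i,j\}\subset e}H_e$ for $i\ne j$ and $A_{ii}=0$. We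 write $(A,S)\sim\mathrm{HPC}(n,d,k,p)$. $\mathbb E_0[A]$ is the expectation of $A$ under the null model $k=0$ (with $p=p_n$): the symmetric matrix with zero diagonal and all off-diagonal entries equal to $\binom{n-2}{d-2}p_n$. *)

theory Defs
  imports "HOL-Probability.Probability" "Jordan_Normal_Form.Char_Poly"
begin

text \<open>Vertices are \<open>0, \<dots>, n - 1\<close> rather than \<open>1, \<dots>, n\<close>, to agree with
  the 0-based indices of matrices and vectors.\<close>

definition subsets_of_size :: "nat \<Rightarrow> nat \<Rightarrow> nat set set" where
  "subsets_of_size n d = {e. e \<subseteq> {..<n} \<and> card e = d}"

definition adjacency :: "nat \<Rightarrow> nat \<Rightarrow> (nat set \<Rightarrow> bool) \<Rightarrow> real mat" where
  "adjacency n d H = Matrix.mat n n (\<lambda>(i, j).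
     if i = j then 0
     else (\<Sum>e | e \<in> subsets_of_size n d \<and> {i, j} \<subseteq> e. of_bool (H e)))"

text \<open>The joint law of the pair \<open>(A, S)\<close>. The hyperedge indicators are
  independent given \<open>S\<close>; \<open>Pi_pmf\<close> assigns the irrelevant default \<open>False\<close>
  to sets that are not potential hyperedges.\<close>

definition HPC :: "nat \<Rightarrow> nat \<Rightarrow> nat \<Rightarrow> real \<Rightarrow> (real mat \<times> nat set) pmf" where
  "HPC n d k p =
     bind_pmf (pmf_of_set (subsets_of_size n k)) (\<lambda>S.
     bind_pmf (Pi_pmf (subsets_of_size n d) False
                 (\<lambda>e. if e \<subseteq> S then return_pmf True else bernoulli_pmf p)) (\<lambda>H.
     return_pmf (adjacency n d H, S)))"

definition null_mean :: "nat \<Rightarrow> nat \<Rightarrow> real \<Rightarrow> real mat" where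
  "null_mean n d p = Matrix.mat n n (\<lambda>(i, j).
     measure_pmf.expectation (HPC n d 0 p) (\<lambda>(A, S). A $$ (i, j)))"

definition top_unit_eigenvector :: "real mat \<Rightarrow> real vec \<Rightarrow> bool" where
  "top_unit_eigenvector M u \<longleftrightarrow>
     sqrt (scalar_prod u u) = 1 \<and>
     (\<exists>l. eigenvector M u l \<and> (\<forall>l'. eigenvalue M l' \<longrightarrow> l' \<le> l))"

text \<open>With ties, several sets \<open>T\<close> qualify; each corresponds to one way of
  breaking them.\<close>

definition largest_entries :: "nat \<Rightarrow> nat \<Rightarrow> real vec \<Rightarrow> nat set \<Rightarrow> bool" where
  "largest_entries n k u T \<longleftrightarrow>
     T \<in> subsets_of_size n k \<and>
     (\<forall>i\<in>T. \<forall>j\<in>{..<n} - T. \<bar>vec_index u j\<bar> \<le> \<bar>vec_index u i\<bar>)"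

definition seq_gg :: "(nat \<Rightarrow> real) \<Rightarrow> (nat \<Rightarrow> real) \<Rightarrow> bool" where
  "seq_gg a b \<longleftrightarrow> (\<lambda>n. b n / a n) \<longlonglongrightarrow> 0"

definition seq_gtrsim :: "(nat \<Rightarrow> real) \<Rightarrow> (nat \<Rightarrow> real) \<Rightarrow> bool" where
  "seq_gtrsim a b \<longleftrightarrow> limsup (\<lambda>n. ereal (b n / a n)) < \<infinity>"

end

theory Submission imports Defs "HOL-Real_Asymp.Real_Asymp" begin

text \<open>
  Given the planted set \<open>S\<close>, the centered adjacency matrix is \<open>b\<close> times the off-diagonal part of the
  block on \<open>S\<close>, where \<open>b\<close> is of the order \<open>k ^ (d - 2)\<close>, plus a noise matrix that collects the
  centered hyperedges not contained in \<open>S\<close> (\<open>centered_adjacency_eq\<close>). The block has the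
  eigenvalue \<open>\<gamma> = b * (k - 1)\<close>, with the indicator of \<open>S\<close> as eigenvector. So the claim is that noise
  perturbs every entry of this eigenvector by less than about half of its value on \<open>S\<close>.

  The first ingredient is that the noise has operator norm of the order \<open>sqrt D\<close>, where
  \<open>D = p * n ^ (d - 1)\<close>, without any logarithmic factor (\<open>prob_noise_norm_large\<close>). It suffices to
  bound the quadratic form at integer points of a ball of radius \<open>4 * sqrt n\<close>. There, pairs of
  coordinates with product at most \<open>sqrt D\<close> are handled by an exponential moment and a union
  bound over the integer points, the other pairs by degree and edge-count bounds and a dyadic
  decomposition (\<open>heavy_pairs_bound\<close>). The assumption on \<open>k\<close> says that \<open>\<gamma>\<close> is much larger than
  \<open>sqrt D\<close>. This gives closeness of the top eigenvector to the indicator in the Euclidean norm.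

  The second ingredient turns this into a bound for single entries. By the eigenvalue equation,
  the entry of the eigenvector \<open>u\<close> at \<open>i\<close> is governed by row \<open>i\<close> of the noise applied to \<open>u\<close>. The two
  are dependent; but if all hyperedges through \<open>i\<close> that are not contained in \<open>S\<close> are replaced by their
  means, the new top eigenvector is independent of that row, so Bernstein's inequality applies to
  it (\<open>prob_loo_row_large\<close>). It differs little from \<open>u\<close>: the hyperedges through \<open>i\<close> change row and
  column \<open>i\<close>, and, unlike for graphs, also the other entries, by the adjacency matrix of the link
  of \<open>i\<close>. The operator norm bound applies to the link as well and gives the order
  \<open>sqrt (D / n) + sqrt (ln n)\<close>. Combining these estimates yields a closed inequality for the
  largest entry of \<open>u\<close> (\<open>planted_entries_separate\<close>).

  All error terms are small as soon as \<open>\<gamma> / sqrt k\<close> dominates \<open>ln n\<close> and \<open>sqrt (D * ln n / n)\<close>. The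
  former is what the exponent of the logarithm in the lower bound on \<open>p\<close> provides; the latter
  holds with a power of \<open>n\<close> to spare (\<open>eventually_signal_dominates\<close>).
\<close>

section \<open>Vectors and quadratic forms\<close>

text \<open>The dimension varies with the sequence index, so vectors and matrices are functions on the
  natural numbers of which only the values below \<open>n\<close> matter.\<close>

definition inner_upto :: "nat \<Rightarrow> (nat \<Rightarrow> real) \<Rightarrow> (nat \<Rightarrow> real) \<Rightarrow> real" where
  "inner_upto n x y = (\<Sum>i<n. x i * y i)"

abbreviation norm_upto :: "nat \<Rightarrow> (nat \<Rightarrow> real) \<Rightarrow> real" where
  "norm_upto n x \<equiv> L2_set x {..<n}"

definition mat_apply :: "nat \<Rightarrow> (nat \<Rightarrow> nat \<Rightarrow> real) \<Rightarrow> (nat \<Rightarrow> real) \<Rightarrow> nat \<Rightarrow> real" where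
  "mat_apply n W x i = (\<Sum>j<n. W i j * x j)"

definition bilin :: "nat \<Rightarrow> (nat \<Rightarrow> nat \<Rightarrow> real) \<Rightarrow> (nat \<Rightarrow> real) \<Rightarrow> (nat \<Rightarrow> real) \<Rightarrow> real" where
  "bilin n W x y = (\<Sum>i<n. \<Sum>j<n. x i * W i j * y j)"

definition symmetric_upto :: "nat \<Rightarrow> (nat \<Rightarrow> nat \<Rightarrow> real) \<Rightarrow> bool" where
  "symmetric_upto n W \<longleftrightarrow> (\<forall>i<n. \<forall>j<n. W i j = W j i)"

text \<open>For symmetric \<open>W\<close> this says that the operator norm is at most \<open>c\<close>
  (\<open>form_bounded_mat_apply\<close>); in this form it is stable under sums and can be tested on
  integer points.\<close>

definition form_bounded :: "nat \<Rightarrow> (nat \<Rightarrow> nat \<Rightarrow> real) \<Rightarrow> real \<Rightarrow> bool" where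
  "form_bounded n W c \<longleftrightarrow> (\<forall>x. \<bar>bilin n W x x\<bar> \<le> c * (norm_upto n x)\<^sup>2)"

lemma norm_upto_sq: "(norm_upto n x)\<^sup>2 = (\<Sum>i<n. (x i)\<^sup>2)"
  by (simp add: L2_set_def sum_nonneg)

lemma norm_upto_sq_inner: "(norm_upto n x)\<^sup>2 = inner_upto n x x"
  unfolding norm_upto_sq inner_upto_def by (simp add: power2_eq_square)

lemma inner_upto_commute: "inner_upto n x y = inner_upto n y x"
  by (simp add: inner_upto_def mult.commute)

lemma inner_upto_add_left: "inner_upto n (\<lambda>i. x i + y i) z = inner_upto n x z + inner_upto n y z"
  by (simp add: inner_upto_def algebra_simps sum.distrib)

lemma inner_upto_diff_left: "inner_upto n (\<lambda>i. x i - y i) z = inner_upto n x z - inner_upto n y z"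
  by (simp add: inner_upto_def algebra_simps sum_subtractf)

lemma inner_upto_scale_left: "inner_upto n (\<lambda>i. a * x i) z = a * inner_upto n x z"
  by (simp add: inner_upto_def sum_distrib_left mult.assoc)

lemma inner_upto_add_right: "inner_upto n z (\<lambda>i. x i + y i) = inner_upto n z x + inner_upto n z y"
  by (simp add: inner_upto_def algebra_simps sum.distrib)

lemma inner_upto_diff_right: "inner_upto n z (\<lambda>i. x i - y i) = inner_upto n z x - inner_upto n z y"
  by (simp add: inner_upto_def algebra_simps sum_subtractf)

lemma inner_upto_scale_right: "inner_upto n z (\<lambda>i. a * x i) = a * inner_upto n z x"
  by (simp add: inner_upto_def sum_distrib_left algebra_simps)

lemmas inner_upto_linear = inner_upto_add_left inner_upto_diff_left inner_upto_scale_left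
  inner_upto_add_right inner_upto_diff_right inner_upto_scale_right

lemma inner_upto_cong:
  "(\<And>i. i < n \<Longrightarrow> x i = x' i) \<Longrightarrow> (\<And>i. i < n \<Longrightarrow> y i = y' i) \<Longrightarrow> inner_upto n x y = inner_upto n x' y'"
  by (simp add: inner_upto_def)

lemma inner_upto_le_norm: "\<bar>inner_upto n x y\<bar> \<le> norm_upto n x * norm_upto n y"
proof -
  have "\<bar>inner_upto n x y\<bar> \<le> (\<Sum>i<n. \<bar>x i\<bar> * \<bar>y i\<bar>)"
    unfolding inner_upto_def by (rule order_trans[OF sum_abs]) (simp add: abs_mult)
  also have "\<dots> \<le> norm_upto n x * norm_upto n y" by (rule L2_set_mult_ineq)
  finally show ?thesis .
qed

lemma norm_upto_scale: "norm_upto n (\<lambda>i. a * x i) = \<bar>a\<bar> * norm_upto n x"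
  by (simp add: L2_set_def power_mult_distrib sum_distrib_left[symmetric] real_sqrt_mult)

lemma abs_le_norm_upto: "i < n \<Longrightarrow> \<bar>x i\<bar> \<le> norm_upto n x"
  using member_le_L2_set[of "{..<n}" i "\<lambda>i. \<bar>x i\<bar>"] by (simp add: L2_set_def)

lemma bilin_eq_inner: "bilin n W x y = inner_upto n x (mat_apply n W y)"
  by (simp add: bilin_def inner_upto_def mat_apply_def sum_distrib_left mult.assoc)

lemma mat_apply_add: "mat_apply n W (\<lambda>i. x i + y i) j = mat_apply n W x j + mat_apply n W y j"
  by (simp add: mat_apply_def algebra_simps sum.distrib)

lemma mat_apply_diff: "mat_apply n W (\<lambda>i. x i - y i) j = mat_apply n W x j - mat_apply n W y j"
  by (simp add: mat_apply_def algebra_simps sum_subtractf)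

lemma mat_apply_scale: "mat_apply n W (\<lambda>i. a * x i) j = a * mat_apply n W x j"
  by (simp add: mat_apply_def sum_distrib_left algebra_simps)

lemmas mat_apply_linear = mat_apply_add mat_apply_diff mat_apply_scale

lemma bilin_linear:
  "bilin n W (\<lambda>i. x i + y i) z = bilin n W x z + bilin n W y z"
  "bilin n W (\<lambda>i. x i - y i) z = bilin n W x z - bilin n W y z"
  "bilin n W (\<lambda>i. a * x i) z = a * bilin n W x z"
  "bilin n W z (\<lambda>i. x i + y i) = bilin n W z x + bilin n W z y"
  "bilin n W z (\<lambda>i. x i - y i) = bilin n W z x - bilin n W z y"
  "bilin n W z (\<lambda>i. a * x i) = a * bilin n W z x"
  by (simp_all add: bilin_def algebra_simps sum.distrib sum_subtractf sum_distrib_left)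

lemma bilin_sym: "symmetric_upto n W \<Longrightarrow> bilin n W x y = bilin n W y x"
  unfolding bilin_def symmetric_upto_def
  by (subst sum.swap) (auto intro!: sum.cong simp: algebra_simps)

lemma form_boundedD: "form_bounded n W c \<Longrightarrow> \<bar>bilin n W x x\<bar> \<le> c * (norm_upto n x)\<^sup>2"
  by (simp add: form_bounded_def)

lemma form_bounded_mono: "form_bounded n W c \<Longrightarrow> c \<le> c' \<Longrightarrow> form_bounded n W c'"
  unfolding form_bounded_def by (meson mult_right_mono order_trans zero_le_power2)

lemma form_bounded_nonneg:
  assumes "form_bounded n W c" "0 < n" shows "0 \<le> c"
proof -
  have "0 \<le> c * (norm_upto n (\<lambda>i. 1))\<^sup>2"
    using form_boundedD[OF assms(1), of "\<lambda>i. 1"] by linarith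
  moreover have "(norm_upto n (\<lambda>i. 1))\<^sup>2 > 0" using assms(2) by (simp add: norm_upto_sq)
  ultimately show ?thesis by (simp add: zero_le_mult_iff)
qed

text \<open>A symmetric bilinear form is controlled by its diagonal, by polarization.\<close>

lemma form_bounded_bilin:
  assumes W: "symmetric_upto n W" and c: "form_bounded n W c"
  shows "\<bar>bilin n W x y\<bar> \<le> c * norm_upto n x * norm_upto n y"
proof -
  have unit: "\<bar>bilin n W u v\<bar> \<le> c" if "norm_upto n u = 1" "norm_upto n v = 1" for u v
  proof -
    have "bilin n W (\<lambda>i. u i + v i) (\<lambda>i. u i + v i) - bilin n W (\<lambda>i. u i - v i) (\<lambda>i. u i - v i) = 4 * bilin n W u v"
      using bilin_sym[OF W, of v u] by (simp add: bilin_linear)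
    moreover have "(norm_upto n (\<lambda>i. u i + v i))\<^sup>2 + (norm_upto n (\<lambda>i. u i - v i))\<^sup>2 = 4"
      using that by (simp add: norm_upto_sq_inner inner_upto_linear norm_upto_sq_inner[symmetric])
    then have "c * (norm_upto n (\<lambda>i. u i + v i))\<^sup>2 + c * (norm_upto n (\<lambda>i. u i - v i))\<^sup>2 = 4 * c"
      by (simp add: distrib_left[symmetric])
    ultimately show ?thesis
      using form_boundedD[OF c, of "\<lambda>i. u i + v i"] form_boundedD[OF c, of "\<lambda>i. u i - v i"]
      by linarith
  qed
  show ?thesis
  proof (cases "norm_upto n x = 0 \<or> norm_upto n y = 0")
    case True
    then have "(\<forall>i<n. x i = 0) \<or> (\<forall>i<n. y i = 0)"
      by (auto simp: L2_set_eq_0_iff)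
    then have "bilin n W x y = 0" by (auto simp: bilin_def)
    then show ?thesis using True by auto
  next
    case False
    define u where "u = (\<lambda>i. (1 / norm_upto n x) * x i)"
    define v where "v = (\<lambda>i. (1 / norm_upto n y) * y i)"
    have pos: "norm_upto n x > 0" "norm_upto n y > 0"
      using False L2_set_nonneg[of x "{..<n}"] L2_set_nonneg[of y "{..<n}"] by linarith+
    have "norm_upto n u = 1" "norm_upto n v = 1"
      unfolding u_def v_def by (subst norm_upto_scale, use pos in simp)+
    then have "\<bar>bilin n W u v\<bar> \<le> c" by (rule unit)
    moreover have "bilin n W u v = bilin n W x y / (norm_upto n x * norm_upto n y)"
      unfolding u_def v_def bilin_linear by simp
    ultimately show ?thesis
      using pos by (simp add: abs_mult divide_le_eq mult.assoc)
  qed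
qed

lemma form_bounded_mat_apply:
  assumes W: "symmetric_upto n W" and c: "form_bounded n W c"
  shows "norm_upto n (mat_apply n W x) \<le> c * norm_upto n x"
proof (cases "norm_upto n (mat_apply n W x) = 0")
  case True
  have "0 \<le> c * norm_upto n x"
  proof (cases n)
    case (Suc m)
    then show ?thesis using form_bounded_nonneg[OF c] by (simp add: L2_set_nonneg)
  qed auto
  then show ?thesis using True by linarith
next
  case False
  let ?y = "mat_apply n W x"
  have pos: "norm_upto n ?y > 0" using False L2_set_nonneg[of ?y "{..<n}"] by linarith
  have "(norm_upto n ?y)\<^sup>2 = bilin n W ?y x" by (simp add: bilin_eq_inner norm_upto_sq_inner)
  also have "\<dots> \<le> c * norm_upto n ?y * norm_upto n x"
    using form_bounded_bilin[OF W c, of ?y x] by linarith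
  finally have "norm_upto n ?y * norm_upto n ?y \<le> norm_upto n ?y * (c * norm_upto n x)"
    by (simp add: power2_eq_square algebra_simps)
  then show ?thesis using pos by simp
qed

text \<open>Rounding towards zero moves a point of the ball of radius \<open>4 * sqrt n\<close> to an integer point
  of the same ball at distance at most \<open>sqrt n\<close>, a quarter of the radius; so integer points
  already see half of the operator norm.\<close>

lemma form_bounded_if_integer_points:
  assumes W: "symmetric_upto n W" and n: "0 < n"
    and B: "\<And>z :: nat \<Rightarrow> int. (\<Sum>i<n. (z i)\<^sup>2) \<le> 16 * int n
      \<Longrightarrow> \<bar>bilin n W (\<lambda>i. of_int (z i)) (\<lambda>i. of_int (z i))\<bar> \<le> B"
  shows "form_bounded n W (B / (8 * real n))"
proof -
  define U where "U = {x. norm_upto n x = 1}"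
  define \<rho> where "\<rho> = (SUP x\<in>U. \<bar>bilin n W x x\<bar>)"
  have bdd: "bdd_above ((\<lambda>x. \<bar>bilin n W x x\<bar>) ` U)"
  proof (rule bdd_aboveI2)
    fix x assume "x \<in> U"
    then have le1: "\<bar>x i\<bar> \<le> 1" if "i < n" for i
      using abs_le_norm_upto[OF that, of x] by (simp add: U_def)
    have "\<bar>bilin n W x x\<bar> \<le> (\<Sum>i<n. \<Sum>j<n. \<bar>x i * W i j * x j\<bar>)"
      unfolding bilin_def by (rule order_trans[OF sum_abs]) (intro sum_mono sum_abs)
    also have "\<dots> \<le> (\<Sum>i<n. \<Sum>j<n. \<bar>W i j\<bar>)"
    proof (intro sum_mono)
      fix i j assume "i \<in> {..<n}" "j \<in> {..<n}"
      then have "\<bar>x i\<bar> * \<bar>W i j\<bar> * \<bar>x j\<bar> \<le> 1 * \<bar>W i j\<bar> * 1"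
        by (intro mult_mono) (auto intro: le1 mult_nonneg_nonneg)
      then show "\<bar>x i * W i j * x j\<bar> \<le> \<bar>W i j\<bar>" by (simp add: abs_mult)
    qed
    finally show "\<bar>bilin n W x x\<bar> \<le> (\<Sum>i<n. \<Sum>j<n. \<bar>W i j\<bar>)" .
  qed
  have Une: "U \<noteq> {}"
  proof -
    have "(\<lambda>i. if i = 0 then 1 else 0) \<in> U"
      using n by (simp add: U_def L2_set_def if_distrib[of "\<lambda>x. x\<^sup>2"] cong: if_cong)
    then show ?thesis by blast
  qed
  have fb: "form_bounded n W \<rho>"
    unfolding form_bounded_def
  proof
    fix x
    show "\<bar>bilin n W x x\<bar> \<le> \<rho> * (norm_upto n x)\<^sup>2"
    proof (cases "norm_upto n x = 0")
      case True
      then have "\<forall>i<n. x i = 0" by (auto simp: L2_set_eq_0_iff)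
      then show ?thesis using True by (simp add: bilin_def)
    next
      case False
      then have pos: "norm_upto n x > 0" using L2_set_nonneg[of x "{..<n}"] by linarith
      let ?u = "\<lambda>i. (1 / norm_upto n x) * x i"
      have "?u \<in> U" unfolding U_def mem_Collect_eq by (subst norm_upto_scale) (use pos in simp)
      then have "\<bar>bilin n W ?u ?u\<bar> \<le> \<rho>" unfolding \<rho>_def by (rule cSUP_upper[OF _ bdd])
      moreover have "bilin n W ?u ?u = bilin n W x x / (norm_upto n x)\<^sup>2"
        unfolding bilin_linear power2_eq_square by simp
      ultimately show ?thesis using pos by (simp add: abs_mult divide_le_eq)
    qed
  qed
  have \<rho>0: "0 \<le> \<rho>" using form_bounded_nonneg[OF fb n] .
  have "\<bar>bilin n W x x\<bar> \<le> B / (16 * real n) + \<rho> / 2" if "x \<in> U" for x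
  proof -
    define X where "X = (\<lambda>i. (4 * sqrt (real n)) * x i)"
    define z where "z = (\<lambda>i. if X i \<ge> 0 then \<lfloor>X i\<rfloor> else \<lceil>X i\<rceil>)"
    define Z where "Z = (\<lambda>i. real_of_int (z i))"
    have near: "\<bar>X i - Z i\<bar> \<le> 1" and small: "\<bar>Z i\<bar> \<le> \<bar>X i\<bar>" for i
      unfolding Z_def z_def by (auto; linarith)+
    have nX: "norm_upto n X = 4 * sqrt (real n)"
      using that unfolding X_def U_def by (simp add: norm_upto_scale)
    have nZ: "norm_upto n Z \<le> 4 * sqrt (real n)"
    proof -
      have "norm_upto n (\<lambda>i. \<bar>Z i\<bar>) \<le> norm_upto n (\<lambda>i. \<bar>X i\<bar>)"
        by (rule L2_set_mono) (use small in auto)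
      moreover have "norm_upto n (\<lambda>i. \<bar>Z i\<bar>) = norm_upto n Z" "norm_upto n (\<lambda>i. \<bar>X i\<bar>) = norm_upto n X"
        by (simp_all add: L2_set_def)
      ultimately show ?thesis using nX by linarith
    qed
    have nD: "norm_upto n (\<lambda>i. X i - Z i) \<le> sqrt (real n)"
    proof -
      have "(\<Sum>i<n. (X i - Z i)\<^sup>2) \<le> (\<Sum>i<n. 1)"
        by (intro sum_mono) (use near in \<open>simp add: abs_square_le_1\<close>)
      then show ?thesis by (simp add: L2_set_def)
    qed
    have nS: "norm_upto n (\<lambda>i. X i + Z i) \<le> 8 * sqrt (real n)"
      using L2_set_triangle_ineq[of X Z "{..<n}"] nX nZ by linarith
    have "(norm_upto n Z)\<^sup>2 \<le> (4 * sqrt (real n))\<^sup>2"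
      using nZ by (intro power_mono) (auto simp: L2_set_nonneg)
    then have "(\<Sum>i<n. (real_of_int (z i))\<^sup>2) \<le> 16 * real n"
      by (simp add: norm_upto_sq Z_def power_mult_distrib)
    then have "real_of_int (\<Sum>i<n. (z i)\<^sup>2) \<le> real_of_int (16 * int n)" by simp
    then have "(\<Sum>i<n. (z i)\<^sup>2) \<le> 16 * int n" by linarith
    then have bZ: "\<bar>bilin n W Z Z\<bar> \<le> B" unfolding Z_def by (rule B)
    have "bilin n W X X - bilin n W Z Z = bilin n W (\<lambda>i. X i - Z i) (\<lambda>i. X i + Z i)"
      using bilin_sym[OF W, of X Z] by (simp add: bilin_linear)
    moreover have "\<bar>bilin n W (\<lambda>i. X i - Z i) (\<lambda>i. X i + Z i)\<bar> \<le> \<rho> * sqrt (real n) * (8 * sqrt (real n))"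
      by (rule order_trans[OF form_bounded_bilin[OF W fb]])
         (intro mult_mono nD nS \<rho>0 mult_nonneg_nonneg L2_set_nonneg; simp)
    moreover have "\<rho> * sqrt (real n) * (8 * sqrt (real n)) = 8 * \<rho> * real n" by simp
    ultimately have "\<bar>bilin n W X X\<bar> \<le> B + 8 * \<rho> * real n"
      using bZ by linarith
    moreover have "bilin n W X X = 16 * real n * bilin n W x x"
      unfolding X_def by (simp add: bilin_linear power2_eq_square[symmetric])
    ultimately have "16 * real n * \<bar>bilin n W x x\<bar> \<le> B + 8 * \<rho> * real n"
      by (simp add: abs_mult)
    then show ?thesis using n by (simp add: field_simps)
  qed
  then have "\<rho> \<le> B / (16 * real n) + \<rho> / 2"
    unfolding \<rho>_def[symmetric] by (subst \<rho>_def) (rule cSUP_least[OF Une])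
  then have le: "\<rho> \<le> B / (8 * real n)" by (simp add: field_simps)
  show ?thesis
    unfolding form_bounded_def
  proof
    fix x
    have "\<bar>bilin n W x x\<bar> \<le> \<rho> * (norm_upto n x)\<^sup>2" using fb by (rule form_boundedD)
    also have "\<dots> \<le> B / (8 * real n) * (norm_upto n x)\<^sup>2" by (intro mult_right_mono le) simp
    finally show "\<bar>bilin n W x x\<bar> \<le> B / (8 * real n) * (norm_upto n x)\<^sup>2" .
  qed
qed

section \<open>Maximizers of the Rayleigh quotient\<close>

text \<open>The Rayleigh quotient attains its maximum on the compact unit sphere, and its
  maximizers are eigenvectors.\<close>

lemma top_eigenvector_exists:
  assumes W: "symmetric_upto n W" and n: "0 < n"
  obtains x \<mu> where "norm_upto n x = 1" "\<And>i. i < n \<Longrightarrow> mat_apply n W x i = \<mu> * x i"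
    "\<And>y. bilin n W y y \<le> \<mu> * (norm_upto n y)\<^sup>2"
proof -
  define K where "K = (Pi\<^sub>E UNIV (\<lambda>i. if i < n then {-1..1::real} else {0})) \<inter> {x. norm_upto n x = 1}"
  have cK: "compact K"
    unfolding K_def
  proof (rule compact_Int_closed)
    have "compactin (product_topology (\<lambda>i::nat. euclidean :: real topology) UNIV)
        (Pi\<^sub>E UNIV (\<lambda>i. if i < n then {-1..1::real} else {0}))"
      unfolding compactin_PiE by (auto simp: compactin_euclidean_iff)
    then show "compact (Pi\<^sub>E UNIV (\<lambda>i. if i < n then {-1..1::real} else {0}))"
      by (simp add: euclidean_product_topology compactin_euclidean_iff)
    show "closed {x. norm_upto n x = 1}"
      unfolding L2_set_def
      by (intro closed_Collect_eq continuous_intros continuous_on_product_coordinates)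
  qed
  define e0 :: "nat \<Rightarrow> real" where "e0 = (\<lambda>i. if i = 0 then 1 else 0)"
  have "e0 \<in> K"
    using n by (auto simp: K_def e0_def L2_set_def if_distrib[of "\<lambda>x. x\<^sup>2"] PiE_def Pi_def cong: if_cong)
  then have Kne: "K \<noteq> {}" by blast
  have cont: "continuous_on K (\<lambda>x. bilin n W x x)"
    unfolding bilin_def
    by (intro continuous_intros continuous_on_subset[OF continuous_on_product_coordinates]) auto
  obtain x where xK: "x \<in> K" and xmax: "\<And>y. y \<in> K \<Longrightarrow> bilin n W y y \<le> bilin n W x x"
    using continuous_attains_sup[OF cK Kne cont] by blast
  define \<mu> where "\<mu> = bilin n W x x"
  have nx: "norm_upto n x = 1" using xK by (simp add: K_def)
  have ray: "bilin n W y y \<le> \<mu> * (norm_upto n y)\<^sup>2" for y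
  proof (cases "norm_upto n y = 0")
    case True
    then have "\<forall>i<n. y i = 0" by (auto simp: L2_set_eq_0_iff)
    then show ?thesis using True by (simp add: bilin_def)
  next
    case False
    then have pos: "norm_upto n y > 0" using L2_set_nonneg[of y "{..<n}"] by linarith
    define u where "u = (\<lambda>i. if i < n then (1 / norm_upto n y) * y i else 0)"
    have nu: "norm_upto n u = 1"
    proof -
      have "norm_upto n u = norm_upto n (\<lambda>i. (1 / norm_upto n y) * y i)"
        by (simp add: L2_set_def u_def)
      also have "\<dots> = 1" by (subst norm_upto_scale) (use pos in simp)
      finally show ?thesis .
    qed
    have "u i = 0" if "\<not> i < n" for i using that by (simp add: u_def)
    then have "u \<in> K"
      using nu abs_le_norm_upto[of _ n u] by (auto simp: K_def PiE_def Pi_def abs_le_iff)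
    then have "bilin n W u u \<le> \<mu>" unfolding \<mu>_def by (rule xmax)
    moreover have "bilin n W u u = bilin n W (\<lambda>i. (1 / norm_upto n y) * y i) (\<lambda>i. (1 / norm_upto n y) * y i)"
      by (simp add: bilin_def u_def)
    moreover have "\<dots> = bilin n W y y / (norm_upto n y)\<^sup>2"
      unfolding bilin_linear power2_eq_square by simp
    ultimately show ?thesis using pos by (simp add: divide_le_eq)
  qed
  define y where "y = (\<lambda>i. mat_apply n W x i - \<mu> * x i)"
  have xx: "inner_upto n x x = 1" using nx norm_upto_sq_inner[of x n] by simp
  \<comment> \<open>the quotient cannot increase to first order in the direction of the residual\<close>
  have quad: "2 * t * (norm_upto n y)\<^sup>2 \<le> t\<^sup>2 * (\<mu> * (norm_upto n y)\<^sup>2 - bilin n W y y)" for t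
  proof -
    have "bilin n W (\<lambda>i. x i + t * y i) (\<lambda>i. x i + t * y i) = \<mu> + 2 * t * bilin n W y x + t\<^sup>2 * bilin n W y y"
      using bilin_sym[OF W, of x y] by (simp add: bilin_linear \<mu>_def power2_eq_square algebra_simps)
    moreover have "(norm_upto n (\<lambda>i. x i + t * y i))\<^sup>2 = 1 + 2 * t * inner_upto n y x + t\<^sup>2 * (norm_upto n y)\<^sup>2"
      using xx inner_upto_commute[of n x y]
      unfolding norm_upto_sq_inner inner_upto_linear
      by (simp add: power2_eq_square algebra_simps)
    moreover note ray[of "\<lambda>i. x i + t * y i"]
    ultimately have "2 * t * (bilin n W y x - \<mu> * inner_upto n y x) \<le> t\<^sup>2 * (\<mu> * (norm_upto n y)\<^sup>2 - bilin n W y y)"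
      by (simp add: algebra_simps)
    moreover have "bilin n W y x - \<mu> * inner_upto n y x = inner_upto n y y"
      using inner_upto_commute[of n x "mat_apply n W x"]
      unfolding bilin_eq_inner y_def inner_upto_linear by (simp add: algebra_simps)
    ultimately show ?thesis by (simp only: norm_upto_sq_inner)
  qed
  have "(norm_upto n y)\<^sup>2 = 0"
  proof (rule ccontr)
    assume "(norm_upto n y)\<^sup>2 \<noteq> 0"
    then have pos: "(norm_upto n y)\<^sup>2 > 0" by simp
    define a where "a = \<mu> * (norm_upto n y)\<^sup>2 - bilin n W y y"
    define t where "t = (norm_upto n y)\<^sup>2 / (\<bar>a\<bar> + 1)"
    have t: "t > 0" using pos by (simp add: t_def)
    have "2 * t * (norm_upto n y)\<^sup>2 \<le> t * (t * a)" using quad[of t] by (simp add: a_def power2_eq_square)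
    then have "t * (2 * (norm_upto n y)\<^sup>2) \<le> t * (t * a)" by (simp add: algebra_simps)
    then have "2 * (norm_upto n y)\<^sup>2 \<le> t * a" using t by simp
    also have "\<dots> \<le> t * (\<bar>a\<bar> + 1)" using t by (intro mult_left_mono) auto
    also have "\<dots> = (norm_upto n y)\<^sup>2" by (simp add: t_def)
    finally show False using pos by linarith
  qed
  then have "\<forall>i<n. y i = 0" by (auto simp: L2_set_eq_0_iff)
  then have "\<And>i. i < n \<Longrightarrow> mat_apply n W x i = \<mu> * x i" by (simp add: y_def)
  then show ?thesis using that nx ray by blast
qed



section \<open>Concentration for independent hyperedges\<close>

lemma prob_bind_pmf_le:
  assumes "\<And>x. x \<in> set_pmf M \<Longrightarrow> measure_pmf.prob (f x) X \<le> c"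
  shows "measure_pmf.prob (bind_pmf M f) X \<le> c"
proof -
  have "emeasure (bind_pmf M f) X = (\<integral>\<^sup>+ x. emeasure (f x) X \<partial>M)"
    by (rule emeasure_bind_pmf)
  also have "\<dots> \<le> (\<integral>\<^sup>+ x. ennreal c \<partial>M)"
    by (intro nn_integral_mono_AE AE_pmfI)
       (use assms in \<open>simp add: measure_pmf.emeasure_eq_measure ennreal_leI\<close>)
  also have "\<dots> = ennreal c" by (simp add: measure_pmf.emeasure_space_1)
  finally have "ennreal (measure_pmf.prob (bind_pmf M f) X) \<le> ennreal c"
    by (simp add: measure_pmf.emeasure_eq_measure)
  moreover obtain x where "x \<in> set_pmf M" using set_pmf_not_empty[of M] by blast
  then have "0 \<le> c" using assms[of x] measure_nonneg order_trans by blast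
  ultimately show ?thesis by simp
qed

lemma prob_exp_Markov:
  fixes X :: "'a \<Rightarrow> real"
  assumes "integrable (measure_pmf M) (\<lambda>x. exp (X x))"
  shows "measure_pmf.prob M {x. t \<le> X x} \<le> exp (- t) * measure_pmf.expectation M (\<lambda>x. exp (X x))"
proof -
  have "measure_pmf.prob M {x. t \<le> X x} = measure_pmf.expectation M (indicator {x. t \<le> X x})"
    by simp
  also have "\<dots> \<le> measure_pmf.expectation M (\<lambda>x. exp (- t) * exp (X x))"
  proof (rule integral_mono)
    show "indicator {x. t \<le> X x} x \<le> exp (- t) * exp (X x)" for x
      by (auto simp: indicator_def exp_add[symmetric])
  qed (use assms in \<open>auto intro!: integrable_real_indicator simp: measure_pmf.emeasure_eq_measure\<close>)
  finally show ?thesis by simp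
qed

lemma exp_le_quadratic:
  fixes x :: real
  assumes "\<bar>x\<bar> \<le> 1" shows "exp x \<le> 1 + x + x\<^sup>2"
proof (cases "0 \<le> x")
  case True
  then show ?thesis using assms exp_bound[of x] by simp
next
  case False
  have "exp x = 1 / exp (- x)" by (simp add: exp_minus field_simps)
  also have "\<dots> \<le> 1 / (1 - x)"
    using exp_ge_add_one_self[of "- x"] False by (intro divide_left_mono) auto
  also have "\<dots> \<le> 1 + x + x\<^sup>2"
  proof -
    have "(1 + x + x\<^sup>2) * (1 - x) = 1 + x\<^sup>2 * (- x)" by (simp add: algebra_simps power2_eq_square)
    moreover have "0 \<le> x\<^sup>2 * (- x)" using False by (intro mult_nonneg_nonneg) auto
    ultimately have "1 \<le> (1 + x + x\<^sup>2) * (1 - x)" by linarith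
    then show ?thesis using False by (simp add: divide_le_eq)
  qed
  finally show ?thesis .
qed

lemma exp_scaled_le_chord:
  fixes x y :: real
  assumes "0 \<le> x" "x \<le> 1"
  shows "exp (x * y) \<le> 1 + x * (exp y - 1)"
  using convex_onD[OF exp_convex, of x 0 y] assms by (simp add: algebra_simps)

text \<open>The law is a product over all of \<open>A\<close>, but only the coordinates in \<open>F\<close> are known to be Bernoulli
  and enter the statistics below. In the planted model the remaining coordinates are the
  hyperedges inside the planted set, which are present with certainty.\<close>

locale bernoulli_hyperedges =
  fixes A F :: "'e set" and P :: "'e \<Rightarrow> bool pmf" and p :: real
  assumes finite_A: "finite A" and F_subset: "F \<subseteq> A"
    and P_F: "\<And>e. e \<in> F \<Longrightarrow> P e = bernoulli_pmf p"
    and p_bounds: "0 \<le> p" "p \<le> 1"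
begin

abbreviation law :: "('e \<Rightarrow> bool) pmf" where "law \<equiv> Pi_pmf A False P"

lemma finite_F: "finite F"
  using finite_A F_subset finite_subset by blast

lemma sub_family: "G \<subseteq> F \<Longrightarrow> bernoulli_hyperedges A G P p"
  using finite_A F_subset P_F p_bounds by unfold_locales auto

text \<open>Independence factorizes the exponential moment, and \<open>1 + x \<le> exp x\<close> merges the factors again into
  a single exponential; both tail bounds below are Markov's inequality for it.\<close>

lemma exp_moment:
  shows "integrable law (\<lambda>H. exp (\<Sum>e\<in>F. a e * of_bool (H e)))"
    and "measure_pmf.expectation law (\<lambda>H. exp (\<Sum>e\<in>F. a e * of_bool (H e)))
      \<le> exp (p * (\<Sum>e\<in>F. exp (a e) - 1))"
proof -
  define f :: "'e \<Rightarrow> bool \<Rightarrow> real" where "f = (\<lambda>e h. if e \<in> F then exp (a e * of_bool h) else 1)"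
  have split: "exp (\<Sum>e\<in>F. a e * of_bool (H e)) = (\<Prod>e\<in>A. f e (H e))" for H
  proof -
    have "(\<Prod>e\<in>A. f e (H e)) = (\<Prod>e\<in>F. f e (H e))"
      using finite_A F_subset by (intro prod.mono_neutral_right) (auto simp: f_def)
    also have "\<dots> = (\<Prod>e\<in>F. exp (a e * of_bool (H e)))" by (simp add: f_def)
    finally show ?thesis by (simp only: exp_sum[OF finite_F])
  qed
  have int: "integrable (measure_pmf (P e)) (f e)" for e
    by (rule integrable_measure_pmf_finite) simp
  show "integrable law (\<lambda>H. exp (\<Sum>e\<in>F. a e * of_bool (H e)))"
    unfolding split by (rule integrable_prod_Pi_pmf[OF finite_A int])
  have "measure_pmf.expectation law (\<lambda>H. exp (\<Sum>e\<in>F. a e * of_bool (H e)))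
      = (\<Prod>e\<in>A. measure_pmf.expectation (P e) (f e))"
    unfolding split by (rule expectation_prod_Pi_pmf[OF finite_A int]) (auto simp: f_def)
  also have "\<dots> = (\<Prod>e\<in>F. measure_pmf.expectation (P e) (f e))"
    using finite_A F_subset by (intro prod.mono_neutral_right) (auto simp: f_def)
  also have "\<dots> = (\<Prod>e\<in>F. 1 + p * (exp (a e) - 1))"
    using p_bounds by (intro prod.cong) (auto simp: P_F f_def algebra_simps)
  also have "\<dots> \<le> (\<Prod>e\<in>F. exp (p * (exp (a e) - 1)))"
  proof (intro prod_mono conjI)
    fix e
    have "p * (exp (a e) - 1) \<ge> p * (-1)" using p_bounds by (intro mult_left_mono) auto
    then show "0 \<le> 1 + p * (exp (a e) - 1)" using p_bounds by linarith
    show "1 + p * (exp (a e) - 1) \<le> exp (p * (exp (a e) - 1))"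
      by (rule exp_ge_add_one_self)
  qed
  also have "\<dots> = exp (p * (\<Sum>e\<in>F. exp (a e) - 1))"
    using finite_F by (simp add: exp_sum sum_distrib_left)
  finally show "measure_pmf.expectation law (\<lambda>H. exp (\<Sum>e\<in>F. a e * of_bool (H e)))
      \<le> exp (p * (\<Sum>e\<in>F. exp (a e) - 1))" .
qed

text \<open>The free parameter of the exponential moment is absorbed into the coefficients: to bound the
  tail of a sum, apply this to a multiple of it.\<close>

lemma prob_centered_sum_ge:
  assumes a: "\<And>e. e \<in> F \<Longrightarrow> \<bar>a e\<bar> \<le> 1"
  shows "measure_pmf.prob law {H. t \<le> (\<Sum>e\<in>F. a e * (of_bool (H e) - p))}
    \<le> exp (p * (\<Sum>e\<in>F. (a e)\<^sup>2) - t)"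
proof -
  have "{H. t \<le> (\<Sum>e\<in>F. a e * (of_bool (H e) - p))}
      = {H. t + p * (\<Sum>e\<in>F. a e) \<le> (\<Sum>e\<in>F. a e * of_bool (H e))}"
    by (auto simp: right_diff_distrib sum_subtractf sum_distrib_left mult.commute)
  then have "measure_pmf.prob law {H. t \<le> (\<Sum>e\<in>F. a e * (of_bool (H e) - p))}
      \<le> exp (- (t + p * (\<Sum>e\<in>F. a e))) * measure_pmf.expectation law (\<lambda>H. exp (\<Sum>e\<in>F. a e * of_bool (H e)))"
    by (simp only: prob_exp_Markov[OF exp_moment(1)])
  also have "\<dots> \<le> exp (- (t + p * (\<Sum>e\<in>F. a e))) * exp (p * (\<Sum>e\<in>F. exp (a e) - 1))"
    by (intro mult_left_mono exp_moment(2)) auto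
  also have "\<dots> \<le> exp (- (t + p * (\<Sum>e\<in>F. a e))) * exp (p * (\<Sum>e\<in>F. a e + (a e)\<^sup>2))"
  proof -
    have "(\<Sum>e\<in>F. exp (a e) - 1) \<le> (\<Sum>e\<in>F. a e + (a e)\<^sup>2)"
      using exp_le_quadratic[OF a] by (intro sum_mono) (auto simp: algebra_simps)
    then show ?thesis using p_bounds by (intro mult_left_mono) (auto intro!: mult_left_mono)
  qed
  also have "\<dots> = exp (p * (\<Sum>e\<in>F. (a e)\<^sup>2) - t)"
    by (simp add: exp_add[symmetric] sum.distrib algebra_simps)
  finally show ?thesis .
qed

lemma prob_abs_centered_sum_ge:
  assumes a: "\<And>e. e \<in> F \<Longrightarrow> \<bar>a e\<bar> \<le> 1"
  shows "measure_pmf.prob law {H. t \<le> \<bar>\<Sum>e\<in>F. a e * (of_bool (H e) - p)\<bar>}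
    \<le> 2 * exp (p * (\<Sum>e\<in>F. (a e)\<^sup>2) - t)"
proof -
  let ?X = "\<lambda>a H. \<Sum>e\<in>F. a e * (of_bool (H e) - p)"
  have "{H. t \<le> \<bar>?X a H\<bar>} \<subseteq> {H. t \<le> ?X a H} \<union> {H. t \<le> ?X (\<lambda>e. - a e) H}"
    by (auto simp: sum_negf abs_if)
  then have "measure_pmf.prob law {H. t \<le> \<bar>?X a H\<bar>}
      \<le> measure_pmf.prob law {H. t \<le> ?X a H} + measure_pmf.prob law {H. t \<le> ?X (\<lambda>e. - a e) H}"
    by (intro order_trans[OF measure_pmf.finite_measure_mono measure_Un_le]) auto
  moreover have "measure_pmf.prob law {H. t \<le> ?X (\<lambda>e. - a e) H} \<le> exp (p * (\<Sum>e\<in>F. (a e)\<^sup>2) - t)"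
    using prob_centered_sum_ge[of "\<lambda>e. - a e" t] a by simp
  moreover have "measure_pmf.prob law {H. t \<le> ?X a H} \<le> exp (p * (\<Sum>e\<in>F. (a e)\<^sup>2) - t)"
    using a by (rule prob_centered_sum_ge)
  ultimately show ?thesis by linarith
qed

text \<open>The two terms in the threshold are the Gaussian and the Poisson regime. The scaling factor is
  the largest one that keeps the coefficients below \<open>1\<close> and the variance term below \<open>L\<close>; in
  either regime the threshold then contributes \<open>4 * L\<close> to the exponent.\<close>

lemma bernstein:
  assumes a: "\<And>e. e \<in> F \<Longrightarrow> \<bar>a e\<bar> \<le> m" and v: "p * (\<Sum>e\<in>F. (a e)\<^sup>2) \<le> v"
    and pos: "0 < m" "0 < v" "0 < L" and t: "4 * (sqrt (v * L) + m * L) \<le> t"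
  shows "measure_pmf.prob law {H. t \<le> \<bar>\<Sum>e\<in>F. a e * (of_bool (H e) - p)\<bar>} \<le> 2 * exp (- 3 * L)"
proof -
  define \<theta> where "\<theta> = min (1 / m) (sqrt (L / v))"
  have \<theta>0: "0 < \<theta>" using pos by (simp add: \<theta>_def)
  have \<theta>v: "\<theta>\<^sup>2 * v \<le> L"
  proof -
    have "\<theta>\<^sup>2 \<le> (sqrt (L / v))\<^sup>2" using \<theta>0 by (intro power_mono) (auto simp: \<theta>_def)
    then show ?thesis using pos by (simp add: field_simps)
  qed
  have \<theta>t: "4 * L \<le> \<theta> * t"
  proof (cases "1 / m \<le> sqrt (L / v)")
    case True
    have "4 * (m * L) \<le> t" 
    proof -
      have "4 * (m * L) \<le> 4 * (sqrt (v * L) + m * L)" using pos by simp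
      then show ?thesis using t by (rule order_trans)
    qed
    then show ?thesis using True pos by (simp add: \<theta>_def field_simps)
  next
    case False
    have "4 * L = sqrt (L / v) * (4 * sqrt (v * L))"
      using pos by (simp add: real_sqrt_mult[symmetric])
    also have "\<dots> \<le> sqrt (L / v) * t"
      using t pos by (intro mult_left_mono) (auto intro: order_trans[rotated])
    finally show ?thesis using False by (simp add: \<theta>_def)
  qed
  have "{H. t \<le> \<bar>\<Sum>e\<in>F. a e * (of_bool (H e) - p)\<bar>}
      = {H. \<theta> * t \<le> \<bar>\<Sum>e\<in>F. (\<theta> * a e) * (of_bool (H e) - p)\<bar>}"
    using \<theta>0 by (simp add: sum_distrib_left[symmetric] mult.assoc abs_mult)
  moreover have "measure_pmf.prob law {H. \<theta> * t \<le> \<bar>\<Sum>e\<in>F. (\<theta> * a e) * (of_bool (H e) - p)\<bar>}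
      \<le> 2 * exp (p * (\<Sum>e\<in>F. (\<theta> * a e)\<^sup>2) - \<theta> * t)"
  proof (rule prob_abs_centered_sum_ge)
    fix e assume "e \<in> F"
    then have "\<theta> * \<bar>a e\<bar> \<le> 1 / m * m"
      using a[of e] \<theta>0 pos by (intro mult_mono) (auto simp: \<theta>_def)
    then show "\<bar>\<theta> * a e\<bar> \<le> 1" using \<theta>0 pos by (simp add: abs_mult)
  qed
  moreover have "p * (\<Sum>e\<in>F. (\<theta> * a e)\<^sup>2) - \<theta> * t \<le> - 3 * L"
  proof -
    have "p * (\<Sum>e\<in>F. (\<theta> * a e)\<^sup>2) = \<theta>\<^sup>2 * (p * (\<Sum>e\<in>F. (a e)\<^sup>2))"
      by (simp add: power_mult_distrib sum_distrib_left algebra_simps)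
    also have "\<dots> \<le> \<theta>\<^sup>2 * v" by (intro mult_left_mono v) auto
    finally show ?thesis using \<theta>v \<theta>t by linarith
  qed
  ultimately show ?thesis
    by (simp only:) (erule order_trans, simp)
qed

text \<open>For thresholds far above the mean the Bernstein exponent is too small by the factor \<open>ln r\<close>,
  where \<open>r\<close> is the ratio of the threshold to the mean. By convexity of the exponential, weights
  below \<open>m\<close> behave no worse than weights equal to \<open>m\<close>.\<close>

lemma chernoff:
  assumes w: "\<And>e. e \<in> F \<Longrightarrow> 0 \<le> w e" "\<And>e. e \<in> F \<Longrightarrow> w e \<le> m" and m: "0 < m"
    and \<mu>: "p * (\<Sum>e\<in>F. w e) \<le> \<mu>" and r: "1 \<le> r"
  shows "measure_pmf.prob law {H. y \<le> (\<Sum>e\<in>F. w e * of_bool (H e))}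
    \<le> exp (\<mu> / m * (r - 1) - y / m * ln r)"
proof -
  define a where "a = (\<lambda>e. ln r / m * w e)"
  have l0: "0 \<le> ln r" using r by simp
  have "{H. y \<le> (\<Sum>e\<in>F. w e * of_bool (H e))}
      \<subseteq> {H. y / m * ln r \<le> (\<Sum>e\<in>F. a e * of_bool (H e))}"
  proof safe
    fix H :: "'e \<Rightarrow> bool"
    assume "y \<le> (\<Sum>e\<in>F. w e * of_bool (H e))"
    then have "ln r / m * y \<le> ln r / m * (\<Sum>e\<in>F. w e * of_bool (H e))"
      using l0 m by (intro mult_left_mono) auto
    also have "\<dots> = (\<Sum>e\<in>F. a e * of_bool (H e))"
      by (simp add: a_def sum_distrib_left mult.assoc)
    finally show "y / m * ln r \<le> (\<Sum>e\<in>F. a e * of_bool (H e))" by (simp add: mult.commute)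
  qed
  then have "measure_pmf.prob law {H. y \<le> (\<Sum>e\<in>F. w e * of_bool (H e))}
      \<le> measure_pmf.prob law {H. y / m * ln r \<le> (\<Sum>e\<in>F. a e * of_bool (H e))}"
    by (intro measure_pmf.finite_measure_mono) auto
  also have "\<dots> \<le> exp (- (y / m * ln r)) * measure_pmf.expectation law (\<lambda>H. exp (\<Sum>e\<in>F. a e * of_bool (H e)))"
    by (rule prob_exp_Markov[OF exp_moment(1)])
  also have "\<dots> \<le> exp (- (y / m * ln r)) * exp (p * (\<Sum>e\<in>F. exp (a e) - 1))"
    by (intro mult_left_mono exp_moment(2)) auto
  also have "\<dots> \<le> exp (- (y / m * ln r)) * exp (\<mu> / m * (r - 1))"
  proof -
    have "(\<Sum>e\<in>F. exp (a e) - 1) \<le> (\<Sum>e\<in>F. w e / m * (r - 1))"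
    proof (rule sum_mono)
      fix e assume "e \<in> F"
      then have "exp (w e / m * ln r) \<le> 1 + w e / m * (exp (ln r) - 1)"
        using w m by (intro exp_scaled_le_chord) auto
      then show "exp (a e) - 1 \<le> w e / m * (r - 1)" using r by (simp add: a_def mult.commute)
    qed
    then have "p * (\<Sum>e\<in>F. exp (a e) - 1) \<le> p * (\<Sum>e\<in>F. w e / m * (r - 1))"
      using p_bounds by (intro mult_left_mono) auto
    also have "\<dots> = p * (\<Sum>e\<in>F. w e) * ((r - 1) / m)"
      by (simp add: sum_distrib_left sum_distrib_right algebra_simps)
    also have "\<dots> \<le> \<mu> * ((r - 1) / m)" using \<mu> r m by (intro mult_right_mono) auto
    finally have "p * (\<Sum>e\<in>F. exp (a e) - 1) \<le> \<mu> / m * (r - 1)" by (simp add: mult.commute)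
    then show ?thesis by (intro mult_left_mono) auto
  qed
  also have "\<dots> = exp (\<mu> / m * (r - 1) - y / m * ln r)"
    by (simp add: exp_add[symmetric])
  finally show ?thesis .
qed

end

text \<open>Resampling principle: a bound valid for every fixed value of a parameter \<open>h\<close> stays valid when
  \<open>h\<close> is the part of the configuration that the event does not otherwise look at.\<close>

lemma prob_Pi_pmf_condition:
  assumes A: "finite A" and B: "B \<subseteq> A"
    and local: "\<And>h H H'. (\<And>e. e \<in> B \<Longrightarrow> H e = H' e) \<Longrightarrow> R h H \<Longrightarrow> R h H'"
    and bound: "\<And>h. measure_pmf.prob (Pi_pmf A False P) {H. R h H} \<le> c"
  shows "measure_pmf.prob (Pi_pmf A False P) {H. R (\<lambda>e. if e \<in> B then False else H e) H} \<le> c"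
proof -
  have fB: "finite B" using A B finite_subset by blast
  have inner: "measure_pmf.prob (Pi_pmf B False P) {f. R h f} \<le> c" for h
  proof -
    have "Pi_pmf B False P = map_pmf (\<lambda>H x. if x \<in> B then H x else False) (Pi_pmf A False P)"
      by (rule Pi_pmf_subset[OF A B])
    then have "measure_pmf.prob (Pi_pmf B False P) {f. R h f}
        = measure_pmf.prob (Pi_pmf A False P) {H. R h (\<lambda>x. if x \<in> B then H x else False)}"
      by (simp add: measure_map_pmf vimage_def)
    also have "\<dots> = measure_pmf.prob (Pi_pmf A False P) {H. R h H}"
      by (intro arg_cong[where f = "measure_pmf.prob _"] Collect_cong iffI; erule local[rotated]; simp)
    finally show ?thesis using bound by simp
  qed
  have "Pi_pmf A False P = Pi_pmf (B \<union> (A - B)) False P" using B by (simp add: Un_absorb1)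
  also have "\<dots> = map_pmf (\<lambda>(f, g) x. if x \<in> B then f x else g x)
      (pair_pmf (Pi_pmf B False P) (Pi_pmf (A - B) False P))"
    using A fB by (intro Pi_pmf_union) auto
  also have "\<dots> = bind_pmf (Pi_pmf (A - B) False P) (\<lambda>g. bind_pmf (Pi_pmf B False P)
      (\<lambda>f. return_pmf (\<lambda>x. if x \<in> B then f x else g x)))"
    unfolding pair_pmf_def map_bind_pmf by (subst bind_commute_pmf) (simp add: map_return_pmf)
  finally have "measure_pmf.prob (Pi_pmf A False P) {H. R (\<lambda>e. if e \<in> B then False else H e) H}
      = measure_pmf.prob (bind_pmf (Pi_pmf (A - B) False P) (\<lambda>g. bind_pmf (Pi_pmf B False P)
        (\<lambda>f. return_pmf (\<lambda>x. if x \<in> B then f x else g x))))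
        {H. R (\<lambda>e. if e \<in> B then False else H e) H}"
    by simp
  also have "\<dots> \<le> c"
  proof (rule prob_bind_pmf_le)
    fix g
    let ?h = "\<lambda>e. if e \<in> B then False else g e"
    have "bind_pmf (Pi_pmf B False P) (\<lambda>f. return_pmf (\<lambda>x. if x \<in> B then f x else g x))
        = map_pmf (\<lambda>f x. if x \<in> B then f x else g x) (Pi_pmf B False P)"
      by (simp add: map_pmf_def)
    then have "measure_pmf.prob (bind_pmf (Pi_pmf B False P) (\<lambda>f. return_pmf (\<lambda>x. if x \<in> B then f x else g x)))
        {H. R (\<lambda>e. if e \<in> B then False else H e) H}
      = measure_pmf.prob (Pi_pmf B False P) {f. R ?h (\<lambda>x. if x \<in> B then f x else g x)}"
      by (simp add: measure_map_pmf vimage_def if_distrib cong: if_cong)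
    also have "\<dots> \<le> measure_pmf.prob (Pi_pmf B False P) {f. R ?h f}"
      by (intro measure_pmf.finite_measure_mono) (auto elim!: local[rotated])
    also have "\<dots> \<le> c" by (rule inner)
    finally show "measure_pmf.prob (bind_pmf (Pi_pmf B False P) (\<lambda>f. return_pmf (\<lambda>x. if x \<in> B then f x else g x)))
        {H. R (\<lambda>e. if e \<in> B then False else H e) H} \<le> c" .
  qed
  finally show ?thesis .
qed



section \<open>Heavy pairs\<close>

lemma sum_powers_below:
  fixes x Y :: real
  assumes x: "1 < x" and Y: "0 \<le> Y"
  shows "(\<Sum>s<T. if x ^ s \<le> Y then x ^ s else 0) \<le> x * Y / (x - 1)"
proof -
  have "(\<Sum>s<T. if x ^ s \<le> Y then x ^ s else 0) \<le> min (x ^ T) (x * Y) / (x - 1)"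
  proof (induction T)
    case 0
    then show ?case using x Y by simp
  next
    case (Suc T)
    show ?case
    proof (cases "x ^ T \<le> Y")
      case True
      then have "(\<Sum>s<Suc T. if x ^ s \<le> Y then x ^ s else 0) \<le> x ^ T / (x - 1) + x ^ T"
        using Suc.IH divide_right_mono[OF min.cobounded1[of "x ^ T" "x * Y"], of "x - 1"] x
        unfolding sum.lessThan_Suc if_P[OF True] by linarith
      also have "\<dots> = x ^ Suc T / (x - 1)" using x by (simp add: field_simps)
      also have "\<dots> \<le> min (x ^ Suc T) (x * Y) / (x - 1)"
        using True x by (intro divide_right_mono) (auto simp: min_def)
      finally show ?thesis .
    next
      case False
      then have "(\<Sum>s<Suc T. if x ^ s \<le> Y then x ^ s else 0) \<le> min (x ^ T) (x * Y) / (x - 1)"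
        using Suc.IH by simp
      also have "\<dots> \<le> min (x ^ Suc T) (x * Y) / (x - 1)"
        using x power_increasing[of T "Suc T" x]
        by (intro divide_right_mono min.mono) linarith+
      finally show ?thesis .
    qed
  qed
  also have "\<dots> \<le> x * Y / (x - 1)" using x by (intro divide_right_mono) auto
  finally show ?thesis .
qed

lemma sum_sqrt_powers_below:
  fixes Y :: real
  assumes Y: "0 < Y"
  shows "(\<Sum>s<T. if 2 ^ s \<le> Y then sqrt (2 ^ s / Y) else 0) \<le> 4"
proof -
  have iff: "(2 :: real) ^ s \<le> Y \<longleftrightarrow> sqrt 2 ^ s \<le> sqrt Y" for s
    by (simp add: real_sqrt_power[symmetric])
  have "(\<Sum>s<T. if 2 ^ s \<le> Y then sqrt (2 ^ s / Y) else 0)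
      = (\<Sum>s<T. if sqrt 2 ^ s \<le> sqrt Y then sqrt 2 ^ s else 0) / sqrt Y"
    unfolding iff sum_divide_distrib
    by (intro sum.cong refl) (simp add: real_sqrt_divide real_sqrt_power)
  also have "\<dots> \<le> (sqrt 2 * sqrt Y / (sqrt 2 - 1)) / sqrt Y"
    using Y by (intro divide_right_mono sum_powers_below) auto
  also have "\<dots> = sqrt 2 / (sqrt 2 - 1)" using Y by simp
  also have "\<dots> \<le> 4"
  proof -
    have "4 / 3 \<le> sqrt (2::real)" by (rule real_le_rsqrt) (simp add: power2_eq_square)
    then show ?thesis by (simp add: divide_le_eq)
  qed
  finally show ?thesis .
qed

lemma sum_halves: "(\<Sum>t<T. (1 / 2 :: real) ^ t) \<le> 2"
  by (simp add: sum_gp_strict) 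

text \<open>Here \<open>q\<close> is the ratio of two dyadic levels in units of \<open>sqrt D\<close>. If \<open>q\<close> is at least \<open>2\<close> to the power
  \<open>- t\<close>, the logarithm is at least of the order \<open>1 + t\<close>; otherwise it is still at least \<open>2\<close>, and the
  missing factor is paid by one square root of the tiny \<open>q\<close>. The other square root remains for a
  geometric summation over the levels.\<close>

lemma dyadic_log_gain:
  fixes q :: real
  assumes q: "0 < q" "q \<le> 1" and r: "1 \<le> 4 * (2 ^ t)\<^sup>2 * q"
  shows "q / ln (exp 2 * (4 * (2 ^ t)\<^sup>2 * q)) \<le> 2 * sqrt q / (1 + real t)"
proof -
  have lnr: "ln (exp 2 * (4 * (2 ^ t)\<^sup>2 * q)) = 2 + ln (4 * (2 ^ t)\<^sup>2 * q)"
    using q by (simp add: ln_mult_pos)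
  have ge2: "2 \<le> ln (exp 2 * (4 * (2 ^ t)\<^sup>2 * q))" unfolding lnr using r by simp
  have q_le: "q \<le> sqrt q" using q by (simp add: real_le_rsqrt power2_eq_square mult_left_le)
  show ?thesis
  proof (cases "1 / 2 ^ t \<le> q")
    case True
    have "1 \<le> 2 ^ t * q" using True by (simp add: field_simps)
    then have "2 ^ t * 1 \<le> 2 ^ t * (2 ^ t * q)" by (intro mult_left_mono) auto
    then have "(2::real) ^ t \<le> 4 * (2 ^ t)\<^sup>2 * q"
      using q by (simp add: power2_eq_square mult.assoc)
    then have "ln ((2::real) ^ t) \<le> ln (4 * (2 ^ t)\<^sup>2 * q)" using q by simp
    then have "real t * ln 2 \<le> ln (4 * (2 ^ t)\<^sup>2 * q)" by (simp add: ln_realpow)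
    moreover have "real t * (1/2) \<le> real t * ln 2"
      using ln2_ge_two_thirds by (intro mult_left_mono) auto
    ultimately have "(1 + real t) / 2 \<le> ln (exp 2 * (4 * (2 ^ t)\<^sup>2 * q))" unfolding lnr by simp
    moreover have "0 < (1 + real t) / 2" by simp
    ultimately have "q / ln (exp 2 * (4 * (2 ^ t)\<^sup>2 * q)) \<le> q / ((1 + real t) / 2)"
      using q ge2 by (intro divide_left_mono mult_pos_pos) linarith+
    also have "\<dots> = 2 * q / (1 + real t)" by simp
    also have "\<dots> \<le> 2 * sqrt q / (1 + real t)" using q_le by (intro divide_right_mono) auto
    finally show ?thesis .
  next
    case False
    have pow: "(1 + real t)\<^sup>2 \<le> 16 * 2 ^ t"
    proof -
      have "1 + real t * (2 / 5) \<le> (1 + 2 / 5) ^ t" by (rule Bernoulli_inequality) simp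
      then have "(1 + real t * (2 / 5))\<^sup>2 \<le> ((1 + 2 / 5) ^ t)\<^sup>2" by (intro power_mono) auto
      also have "\<dots> = (49 / 25) ^ t" by (simp add: power2_eq_square power_mult_distrib[symmetric])
      also have "\<dots> \<le> (2::real) ^ t" by (intro power_mono) auto
      finally have "(1 + real t * (2 / 5))\<^sup>2 \<le> 2 ^ t" .
      moreover have "(1 + real t)\<^sup>2 \<le> (4 * (1 + real t * (2 / 5)))\<^sup>2" by (intro power_mono) auto
      moreover have "(4 * (1 + real t * (2 / 5)))\<^sup>2 = 16 * (1 + real t * (2 / 5))\<^sup>2"
        unfolding power_mult_distrib by simp
      ultimately show ?thesis by linarith
    qed
    have "sqrt q * (1 + real t) \<le> 4"
    proof (rule power2_le_imp_le)
      have "(sqrt q * (1 + real t))\<^sup>2 = q * (1 + real t)\<^sup>2" using q by (simp add: power_mult_distrib)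
      also have "\<dots> \<le> (1 / 2 ^ t) * (16 * 2 ^ t)" using False q pow by (intro mult_mono) auto
      finally show "(sqrt q * (1 + real t))\<^sup>2 \<le> 4\<^sup>2" by simp
    qed simp
    then have "sqrt q * (sqrt q * (1 + real t)) \<le> sqrt q * 4" using q by (intro mult_left_mono) auto
    then have "q * (1 + real t) \<le> 4 * sqrt q" using q by (simp add: mult.assoc[symmetric])
    then have "q / 2 \<le> 2 * sqrt q / (1 + real t)" by (simp add: field_simps)
    moreover have "q / ln (exp 2 * (4 * (2 ^ t)\<^sup>2 * q)) \<le> q / 2"
      using q ge2 by (intro divide_left_mono mult_pos_pos) linarith+
    ultimately show ?thesis by linarith
  qed
qed

text \<open>A set of \<open>a / 4 ^ t\<close> points among \<open>N\<close> has logarithmic entropy of the order \<open>1 + t + ln (N / a)\<close> per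
  point. The part \<open>ln (N / a)\<close> exceeds \<open>1 + t\<close> only when \<open>a\<close> is exponentially small compared to \<open>N\<close>,
  and is then covered by the second summand. The factor \<open>1 + t\<close> is cancelled by
  \<open>dyadic_log_gain\<close>.\<close>

lemma level_entropy:
  fixes a N :: real
  assumes a: "0 < a" and N: "0 < N"
  shows "a * (1 + ln N - ln (a / (2 ^ t)\<^sup>2)) \<le> (1 + real t) * (3 * a + N * (1 / 2) ^ t)"
proof -
  have "ln (a / (2 ^ t)\<^sup>2) = ln a - 2 * real t * ln 2"
    using a by (simp add: ln_div ln_realpow)
  moreover have "2 * real t * ln 2 \<le> 2 * real t * 1"
    using ln_2_less_1 by (intro mult_left_mono) auto
  moreover have "ln N - ln a \<le> N / a * exp (- (1 + real t)) + (1 + real t)"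
  proof -
    have "ln (N / a * exp (- (1 + real t))) \<le> N / a * exp (- (1 + real t))"
      using ln_le_minus_one[of "N / a * exp (- (1 + real t))"] a N by simp
    moreover have "ln (N / a * exp (- (1 + real t))) = ln N - ln a - (1 + real t)"
      using a N by (simp add: ln_mult_pos ln_div)
    ultimately show ?thesis by linarith
  qed
  ultimately have "1 + ln N - ln (a / (2 ^ t)\<^sup>2) \<le> 2 + 3 * real t + N / a * exp (- (1 + real t))"
    by linarith
  then have "a * (1 + ln N - ln (a / (2 ^ t)\<^sup>2)) \<le> a * (2 + 3 * real t + N / a * exp (- (1 + real t)))"
    using a by (intro mult_left_mono) auto
  also have "\<dots> = (2 + 3 * real t) * a + N * exp (- (1 + real t))"
    using a by (simp add: algebra_simps)
  also have "\<dots> \<le> (1 + real t) * (3 * a) + (1 + real t) * (N * (1 / 2) ^ t)"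
  proof (rule add_mono)
    show "(2 + 3 * real t) * a \<le> (1 + real t) * (3 * a)" using a by (simp add: algebra_simps)
    have e2: "(2::real) ^ t \<le> exp (real t)"
    proof -
      have "(2::real) \<le> exp 1" using exp_ge_add_one_self[of 1] by simp
      then have "(2::real) ^ t \<le> exp 1 ^ t" by (intro power_mono) auto
      then show ?thesis by (simp add: exp_of_nat_mult[symmetric])
    qed
    have "exp (- (1 + real t)) \<le> exp (- real t)" by simp
    also have "\<dots> = 1 / exp (real t)" by (simp add: exp_minus inverse_eq_divide)
    also have "\<dots> \<le> 1 / 2 ^ t" using e2 by (intro divide_left_mono) auto
    also have "\<dots> = (1 / 2) ^ t" by (simp add: power_one_over)
    finally have "N * exp (- (1 + real t)) \<le> 1 * (N * (1 / 2) ^ t)" using N by simp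
    also have "\<dots> \<le> (1 + real t) * (N * (1 / 2) ^ t)" using N by (intro mult_right_mono) auto
    finally show "N * exp (- (1 + real t)) \<le> (1 + real t) * (N * (1 / 2) ^ t)" .
  qed
  finally show ?thesis by (simp add: algebra_simps)
qed

definition heavy_pairs_const :: "real \<Rightarrow> real" where
  "heavy_pairs_const K = 8 * (9216 + 432 * K)"

text \<open>Products \<open>\<bar>z i * z j\<bar>\<close> above \<open>sqrt D\<close> are too large for a tail bound that survives a union bound over
  all integer points \<open>z\<close>; they are controlled by edge counts between level sets of \<open>z\<close> instead. By symmetry the level
  set at \<open>2 ^ t\<close> may be taken to be the larger one. If \<open>2 ^ s\<close> exceeds \<open>2 ^ t * sqrt D\<close>, the degree
  bound suffices. Otherwise the discrepancy hypothesis is used with a ratio that grows with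
  \<open>m = 2 ^ (s + t)\<close>; this choice makes its first summand proportional to the product of the
  squared norms \<open>b s * b t\<close> of the two levels, while the second summand is summable by
  \<open>dyadic_log_gain\<close> and \<open>level_entropy\<close>. The argument goes back to Kahn and Szemeredi, and to
  Feige and Ofek for sparse graphs.\<close>

lemma heavy_pairs_bound:
  fixes a :: "nat \<Rightarrow> nat \<Rightarrow> real" and z :: "nat \<Rightarrow> int"
  assumes n: "0 < n" and D: "0 < D" and K: "0 \<le> K"
    and a0: "\<And>i j. 0 \<le> a i j" and sym: "\<And>i j. a i j = a j i"
    and deg: "\<And>i. i < n \<Longrightarrow> (\<Sum>j<n. a i j) \<le> K * D"
    and disc: "\<And>I J m. I \<subseteq> {..<n} \<Longrightarrow> J \<subseteq> {..<n} \<Longrightarrow> I \<noteq> {} \<Longrightarrow> card I \<le> card J \<Longrightarrow> m \<le> 16 * n \<Longrightarrow> sqrt D \<le> 4 * real m \<Longrightarrow>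
      (\<Sum>i\<in>I. \<Sum>j\<in>J. a i j) \<le> exp 2 * (4 * real m / sqrt D) * (real (card I) * real (card J) * D / real n)
        + K * real (card J) * (1 + ln (real n) - ln (real (card J))) / ln (exp 2 * (4 * real m / sqrt D))"
    and z: "(\<Sum>i<n. (z i)\<^sup>2) \<le> 16 * int n"
  shows "(\<Sum>i<n. \<Sum>j<n. if sqrt D < \<bar>of_int (z i) * of_int (z j)\<bar>
        then \<bar>of_int (z i) * of_int (z j)\<bar> * a i j else 0)
    \<le> heavy_pairs_const K * real n * sqrt D"
proof -
  define S where "S = {i. i < n \<and> z i \<noteq> 0}"
  have finS: "finite S" by (simp add: S_def)
  have z_le: "(z i)\<^sup>2 \<le> 16 * int n" if "i < n" for i
  proof -
    have "(z i)\<^sup>2 \<le> (\<Sum>i<n. (z i)\<^sup>2)" using that by (intro member_le_sum) auto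
    then show ?thesis using z by linarith
  qed
  have "\<exists>s. (2::nat) ^ s \<le> nat \<bar>z i\<bar> \<and> nat \<bar>z i\<bar> < 2 ^ (s + 1)" if "i \<in> S" for i
    using that by (intro ex_power_ivl1) (auto simp: S_def)
  then obtain lev where lev: "\<And>i. i \<in> S \<Longrightarrow> (2::nat) ^ lev i \<le> nat \<bar>z i\<bar> \<and> nat \<bar>z i\<bar> < 2 ^ (lev i + 1)"
    by metis
  have lev_le: "(2::real) ^ lev i \<le> \<bar>of_int (z i)\<bar>" and lev_gt: "\<bar>of_int (z i)\<bar> \<le> 2 * (2::real) ^ lev i" if "i \<in> S" for i
  proof -
    have "(2::int) ^ lev i \<le> \<bar>z i\<bar>" "\<bar>z i\<bar> \<le> 2 * (2::int) ^ lev i"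
      using lev[OF that] by (simp_all add: nat_le_iff nat_less_iff le_nat_iff)
    then have "real_of_int ((2::int) ^ lev i) \<le> of_int \<bar>z i\<bar>" "of_int \<bar>z i\<bar> \<le> real_of_int (2 * (2::int) ^ lev i)"
      by (simp_all only: of_int_le_iff)
    then show "(2::real) ^ lev i \<le> \<bar>of_int (z i)\<bar>" "\<bar>of_int (z i)\<bar> \<le> 2 * (2::real) ^ lev i" by simp_all
  qed
  have lev_sq: "((2::real) ^ lev i)\<^sup>2 \<le> 16 * real n" if "i \<in> S" for i
  proof -
    have "((2::real) ^ lev i)\<^sup>2 \<le> \<bar>of_int (z i)\<bar>\<^sup>2" using lev_le[OF that] by (intro power_mono) auto
    also have "\<dots> = of_int ((z i)\<^sup>2)" by simp
    also have "\<dots> \<le> of_int (16 * int n)" using z_le that by (simp only: of_int_le_iff S_def mem_Collect_eq)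
    finally show ?thesis by simp
  qed
  define T where "T = 16 * n + 1"
  have levT: "lev i < T" if "i \<in> S" for i
  proof -
    have "real (lev i) \<le> 2 ^ lev i" using less_exp[of "lev i"] by (metis of_nat_less_two_power less_imp_le)
    also have "\<dots> \<le> ((2::real) ^ lev i)\<^sup>2" by (simp add: power2_eq_square)
    also have "\<dots> \<le> 16 * real n" using that by (rule lev_sq)
    finally show ?thesis by (simp add: T_def)
  qed
  define I where "I s = {i \<in> S. lev i = s}" for s
  define w where "w s = (2::real) ^ s" for s
  define c where "c s = card (I s)" for s
  define b where "b s = (w s)\<^sup>2 * real (c s)" for s
  define E where "E s t = (\<Sum>i\<in>I s. \<Sum>j\<in>I t. a i j)" for s t
  have w0: "0 < w s" for s by (simp add: w_def)
  have b0: "0 \<le> b s" for s by (simp add: b_def)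
  have E0: "0 \<le> E s t" for s t by (simp add: E_def sum_nonneg a0)
  have I_sub: "I s \<subseteq> {..<n}" for s by (auto simp: I_def S_def)
  have finI: "finite (I s)" for s by (simp add: I_def finS)
  have E_sym: "E s t = E t s" for s t
    unfolding E_def by (subst sum.swap) (simp add: sym)
  have group: "(\<Sum>s<T. \<Sum>i\<in>I s. f i) = (\<Sum>i\<in>S. f i)" for f :: "nat \<Rightarrow> real"
    unfolding I_def using finS levT by (intro sum.group) auto
  have sum_b: "(\<Sum>s<T. b s) \<le> 16 * real n"
  proof -
    have "b s \<le> (\<Sum>i\<in>I s. (of_int (z i))\<^sup>2)" for s
    proof -
      have "b s = (\<Sum>i\<in>I s. (w s)\<^sup>2)" by (simp add: b_def c_def)
      also have "\<dots> \<le> (\<Sum>i\<in>I s. \<bar>of_int (z i)\<bar>\<^sup>2)"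
        by (intro sum_mono power_mono) (auto simp: I_def w_def lev_le)
      finally show ?thesis by simp
    qed
    then have "(\<Sum>s<T. b s) \<le> (\<Sum>s<T. \<Sum>i\<in>I s. (of_int (z i))\<^sup>2)" by (intro sum_mono)
    also have "\<dots> = (\<Sum>i\<in>S. (of_int (z i))\<^sup>2)" by (rule group)
    also have "\<dots> \<le> (\<Sum>i<n. (of_int (z i))\<^sup>2)" by (intro sum_mono2) (auto simp: S_def)
    also have "\<dots> = of_int (\<Sum>i<n. (z i)\<^sup>2)" by simp
    also have "\<dots> \<le> of_int (16 * int n)" using z by (simp only: of_int_le_iff)
    finally show ?thesis by simp
  qed
  define g where "g s t = (if sqrt D \<le> 4 * (w s * w t) then w s * w t else 0)" for s t
  have g0: "0 \<le> g s t" for s t using w0[of s] w0[of t] by (simp add: g_def)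
  have g_sym: "g s t = g t s" for s t by (simp add: g_def mult.commute)
  define h where "h i j = (if sqrt D < \<bar>of_int (z i) * of_int (z j)\<bar>
        then \<bar>of_int (z i) * of_int (z j)\<bar> * a i j else 0)" for i j
  have h0: "h i j = 0" if "z i = 0 \<or> z j = 0" for i j using that D by (auto simp: h_def)
  have h_le: "h i j \<le> 4 * g (lev i) (lev j) * a i j" if "i \<in> S" "j \<in> S" for i j
  proof (cases "sqrt D < \<bar>of_int (z i) * of_int (z j)\<bar>")
    case True
    have "\<bar>of_int (z i)\<bar> * \<bar>of_int (z j)\<bar> \<le> (2 * w (lev i)) * (2 * w (lev j))"
      using lev_gt that by (intro mult_mono) (auto simp: w_def)
    then have le: "\<bar>of_int (z i) * of_int (z j)\<bar> \<le> 4 * (w (lev i) * w (lev j))"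
      by (simp add: abs_mult)
    then have "g (lev i) (lev j) = w (lev i) * w (lev j)" using True by (simp add: g_def)
    then show ?thesis using True mult_right_mono[OF le a0[of i j]] by (simp add: h_def)
  next
    case False
    then show ?thesis using g0 a0 by (simp add: h_def)
  qed
  have "(\<Sum>i<n. \<Sum>j<n. h i j) = (\<Sum>i\<in>S. \<Sum>j\<in>S. h i j)"
  proof -
    have "(\<Sum>i<n. \<Sum>j<n. h i j) = (\<Sum>i\<in>S. \<Sum>j<n. h i j)"
      by (intro sum.mono_neutral_right) (auto simp: S_def h0)
    also have "\<dots> = (\<Sum>i\<in>S. \<Sum>j\<in>S. h i j)"
      by (intro sum.cong sum.mono_neutral_right refl) (auto simp: S_def h0)
    finally show ?thesis .
  qed
  also have "\<dots> \<le> (\<Sum>i\<in>S. \<Sum>j\<in>S. 4 * g (lev i) (lev j) * a i j)"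
    by (intro sum_mono h_le)
  also have "\<dots> = (\<Sum>s<T. \<Sum>t<T. 4 * g s t * E s t)"
  proof -
    have "(\<Sum>i\<in>S. \<Sum>j\<in>S. 4 * g (lev i) (lev j) * a i j)
        = (\<Sum>s<T. \<Sum>i\<in>I s. \<Sum>t<T. \<Sum>j\<in>I t. 4 * g (lev i) (lev j) * a i j)"
      by (simp add: group)
    also have "\<dots> = (\<Sum>s<T. \<Sum>t<T. \<Sum>i\<in>I s. \<Sum>j\<in>I t. 4 * g (lev i) (lev j) * a i j)"
      by (intro sum.cong refl sum.swap)
    also have "\<dots> = (\<Sum>s<T. \<Sum>t<T. 4 * g s t * E s t)"
      unfolding E_def sum_distrib_left by (intro sum.cong refl) (auto simp: I_def)
    finally show ?thesis .
  qed
  also have "\<dots> \<le> 8 * (\<Sum>s<T. \<Sum>t<T. if c s \<le> c t then g s t * E s t else 0)"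
  proof -
    let ?f = "\<lambda>s t. if c s \<le> c t then g s t * E s t else 0"
    have "(\<Sum>s<T. \<Sum>t<T. 4 * g s t * E s t) \<le> (\<Sum>s<T. \<Sum>t<T. 4 * ?f s t + 4 * ?f t s)"
    proof (intro sum_mono)
      fix s t
      have "0 \<le> g s t * E s t" using g0 E0 by (rule mult_nonneg_nonneg)
      then show "4 * g s t * E s t \<le> 4 * ?f s t + 4 * ?f t s"
        using g_sym[of s t] E_sym[of s t] by auto
    qed
    also have "\<dots> = 4 * (\<Sum>s<T. \<Sum>t<T. ?f s t) + 4 * (\<Sum>s<T. \<Sum>t<T. ?f t s)"
      by (simp only: sum.distrib sum_distrib_left)
    also have "(\<Sum>s<T. \<Sum>t<T. ?f t s) = (\<Sum>s<T. \<Sum>t<T. ?f s t)" by (rule sum.swap)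
    finally show ?thesis by simp
  qed
  also have "(\<Sum>s<T. \<Sum>t<T. if c s \<le> c t then g s t * E s t else 0)
    \<le> (\<Sum>s<T. \<Sum>t<T. 36 * sqrt D * b s * b t / real n
        + K * sqrt D * b s * ((if w t \<le> w s / sqrt D then w t else 0) * (sqrt D / w s))
        + 2 * K * sqrt D * (if w s \<le> w t * sqrt D then sqrt (w s / (w t * sqrt D)) else 0) * (3 * b t + real n * (1 / 2) ^ t))"
    (is "_ \<le> (\<Sum>s<T. \<Sum>t<T. ?X1 s t + ?X2 s t + ?X3 s t)")
  proof (intro sum_mono)
    fix s t
    have X1: "0 \<le> ?X1 s t" using b0 D by simp
    have X2: "0 \<le> ?X2 s t" using b0[of s] D K w0[of t] w0[of s] by simp
    have X3: "0 \<le> ?X3 s t" using b0[of t] D K w0[of t] w0[of s] by simp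
    show "(if c s \<le> c t then g s t * E s t else 0) \<le> ?X1 s t + ?X2 s t + ?X3 s t"
    proof (cases "c s \<le> c t \<and> I s \<noteq> {} \<and> sqrt D \<le> 4 * (w s * w t)")
      case False
      then have "(if c s \<le> c t then g s t * E s t else 0) = 0" by (auto simp: g_def E_def)
      then show ?thesis using X1 X2 X3 by linarith
    next
      case True
      then have cst: "c s \<le> c t" and Is: "I s \<noteq> {}" and heavy: "sqrt D \<le> 4 * (w s * w t)" by auto
      have cs1: "1 \<le> c s" using Is finI[of s] by (simp add: c_def Suc_le_eq card_gt_0_iff)
      then have ct1: "1 \<le> c t" using cst by simp
      then have It: "I t \<noteq> {}" by (auto simp: c_def)
      show ?thesis
      proof (cases "w t * sqrt D \<le> w s")
        \<comment> \<open>very unequal levels: every vertex of the smaller set has at most \<open>K * D\<close> neighbours\<close>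
        case True
        have "E s t \<le> (\<Sum>i\<in>I s. \<Sum>j<n. a i j)"
          unfolding E_def using I_sub by (intro sum_mono sum_mono2) (auto simp: a0)
        also have "\<dots> \<le> (\<Sum>i\<in>I s. K * D)" using I_sub by (intro sum_mono deg) auto
        finally have "E s t \<le> real (c s) * (K * D)" by (simp add: c_def)
        then have "w s * w t * E s t \<le> w s * w t * (real (c s) * (K * D))"
          using w0[of s] w0[of t] by (intro mult_left_mono) auto
        also have "\<dots> = ?X2 s t"
        proof -
          have "D = sqrt D * sqrt D" using D by simp
          then show ?thesis using True D w0[of s] 
            by (simp add: b_def field_simps power2_eq_square)
        qed
        finally have "g s t * E s t \<le> ?X2 s t" using heavy by (simp only: g_def if_True)
        then show ?thesis unfolding if_P[OF cst] using X1 X3 by linarith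
      next
        \<comment> \<open>comparable levels: the discrepancy bound\<close>
        case False
        define q where "q = w s / (w t * sqrt D)"
        have q: "0 < q" "q \<le> 1" using False w0[of s] w0[of t] D by (simp_all add: q_def)
        define m where "m = (2::nat) ^ (s + t)"
        have m_w: "real m = w s * w t" by (simp add: m_def w_def power_add)
        have mn: "m \<le> 16 * n"
        proof -
          obtain i j where ij: "i \<in> S" "lev i = s" "j \<in> S" "lev j = t" using Is It by (auto simp: I_def)
          have "(real m)\<^sup>2 = (w s)\<^sup>2 * (w t)\<^sup>2" by (simp add: m_w power_mult_distrib)
          also have "\<dots> \<le> (16 * real n) * (16 * real n)"
            using lev_sq ij by (intro mult_mono) (auto simp: w_def)
          finally have "(real m)\<^sup>2 \<le> (16 * real n)\<^sup>2" by (simp add: power2_eq_square)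
          then have "real m \<le> 16 * real n" by (rule power2_le_imp_le) simp
          then show ?thesis by linarith
        qed
        have rq: "4 * real m / sqrt D = 4 * (2 ^ t)\<^sup>2 * q"
          using w0[of t] D by (simp add: m_w q_def w_def field_simps power2_eq_square)
        have r1: "1 \<le> 4 * (2 ^ t)\<^sup>2 * q"
          using heavy D unfolding rq[symmetric] m_w by (simp add: field_simps)
        let ?r = "exp 2 * (4 * real m / sqrt D)"
        have lnr: "0 < ln ?r" 
        proof -
          have "ln ?r = 2 + ln (4 * (2 ^ t)\<^sup>2 * q)" unfolding rq using q by (simp add: ln_mult_pos)
          then show ?thesis using r1 ln_ge_zero[OF r1] by linarith
        qed
        have "E s t \<le> ?r * (real (c s) * real (c t) * D / real n)
          + K * real (c t) * (1 + ln (real n) - ln (real (c t))) / ln ?r"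
          unfolding E_def c_def
          using I_sub Is cst mn heavy by (intro disc) (auto simp: c_def m_w)
        then have "w s * w t * E s t \<le> w s * w t * (?r * (real (c s) * real (c t) * D / real n)
          + K * real (c t) * (1 + ln (real n) - ln (real (c t))) / ln ?r)"
          using w0[of s] w0[of t] by (intro mult_left_mono) auto
        also have "\<dots> = w s * w t * (?r * (real (c s) * real (c t) * D / real n))
          + w s * w t * (K * real (c t) * (1 + ln (real n) - ln (real (c t))) / ln ?r)"
          by (rule distrib_left)
        also have "\<dots> \<le> ?X1 s t + ?X3 s t"
        proof (rule add_mono)
          have "exp (2::real) \<le> 9"
          proof -
            have "exp (2::real) = exp 1 * exp 1" by (simp add: exp_add[symmetric])
            also have "\<dots> \<le> 3 * 3" using exp_le by (intro mult_mono) auto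
            finally show ?thesis by simp
          qed
          moreover have "w s * w t * (?r * (real (c s) * real (c t) * D / real n))
            = exp 2 * (4 * sqrt D * b s * b t / real n)"
          proof -
            have "D / sqrt D = sqrt D" using D by (simp add: real_div_sqrt)
            moreover have "w s * w t * (?r * (real (c s) * real (c t) * D / real n))
               = exp 2 * (4 * (D / sqrt D) * b s * b t / real n)"
              by (simp add: m_w b_def power2_eq_square algebra_simps)
            ultimately show ?thesis by simp
          qed
          ultimately show "w s * w t * (?r * (real (c s) * real (c t) * D / real n)) \<le> ?X1 s t"
            using mult_right_mono[of "exp 2" 9 "4 * sqrt D * b s * b t / real n"] b0[of s] b0[of t] D
            by simp
        next
          have bt: "0 < b t" using ct1 w0[of t] by (simp add: b_def)
          have ct_b: "real (c t) = b t / (2 ^ t)\<^sup>2" using w0[of t] by (simp add: b_def w_def)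
          have "w s * w t * (K * real (c t) * (1 + ln (real n) - ln (real (c t))) / ln ?r)
            = K * sqrt D * (q / ln ?r) * (b t * (1 + ln (real n) - ln (b t / (2 ^ t)\<^sup>2)))"
          proof -
            have "w s * w t * real (c t) = q * sqrt D * b t"
              using D w0[of t] by (simp add: q_def b_def power2_eq_square)
            then have "w s * w t * (K * real (c t) * x / y) = K * sqrt D * (q / y) * (b t * x)" for x y
              by (metis (no_types, opaque_lifting) mult.assoc mult.commute mult.left_commute times_divide_eq_left times_divide_eq_right)
            then show ?thesis by (simp only: ct_b[symmetric])
          qed
          also have "\<dots> \<le> K * sqrt D * (q / ln ?r) * ((1 + real t) * (3 * b t + real n * (1 / 2) ^ t))"
            using n bt K D q lnr by (intro mult_left_mono level_entropy) auto
          also have "\<dots> \<le> K * sqrt D * (2 * sqrt q / (1 + real t)) * ((1 + real t) * (3 * b t + real n * (1 / 2) ^ t))"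
            using dyadic_log_gain[OF q r1] K D b0[of t] unfolding rq
            by (intro mult_right_mono mult_left_mono) auto
          also have "\<dots> = 2 * K * sqrt D * sqrt q * (3 * b t + real n * (1 / 2) ^ t)"
            by simp
          also have "\<dots> = ?X3 s t" using False by (simp add: q_def)
          finally show "w s * w t * (K * real (c t) * (1 + ln (real n) - ln (real (c t))) / ln ?r) \<le> ?X3 s t" .
        qed
        finally have "g s t * E s t \<le> ?X1 s t + ?X3 s t" using heavy by (simp only: g_def if_True)
        then show ?thesis unfolding if_P[OF cst] using X2 by linarith
      qed
    qed
  qed
  also have "\<dots> = (\<Sum>s<T. \<Sum>t<T. ?X1 s t) + (\<Sum>s<T. \<Sum>t<T. ?X2 s t) + (\<Sum>s<T. \<Sum>t<T. ?X3 s t)"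
    by (simp only: sum.distrib)
  also have "\<dots> \<le> 9216 * real n * sqrt D + 32 * K * real n * sqrt D + 400 * K * real n * sqrt D"
  proof (intro add_mono)
    have "(\<Sum>s<T. \<Sum>t<T. ?X1 s t) = 36 * sqrt D / real n * ((\<Sum>s<T. b s) * (\<Sum>t<T. b t))"
      unfolding sum_product unfolding sum_distrib_left by (intro sum.cong refl) simp
    also have "\<dots> \<le> 36 * sqrt D / real n * ((16 * real n) * (16 * real n))"
      using sum_b b0 D by (intro mult_left_mono mult_mono) (auto intro: sum_nonneg)
    finally show "(\<Sum>s<T. \<Sum>t<T. ?X1 s t) \<le> 9216 * real n * sqrt D" using n by (simp add: mult.commute)
  next
    have inner: "(\<Sum>t<T. ?X2 s t) \<le> 2 * K * sqrt D * b s" for s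
    proof -
      have "(\<Sum>t<T. ?X2 s t) = K * sqrt D * b s * ((\<Sum>t<T. if w t \<le> w s / sqrt D then w t else 0) * (sqrt D / w s))"
        by (simp only: sum_distrib_left sum_distrib_right)
      also have "\<dots> \<le> K * sqrt D * b s * ((2 * (w s / sqrt D) / (2 - 1)) * (sqrt D / w s))"
        unfolding w_def using b0[of s] D K
        by (intro mult_left_mono mult_right_mono sum_powers_below) auto
      also have "\<dots> = 2 * K * sqrt D * b s" using D w0[of s] by simp
      finally show ?thesis .
    qed
    have "(\<Sum>s<T. \<Sum>t<T. ?X2 s t) \<le> (\<Sum>s<T. 2 * K * sqrt D * b s)" by (intro sum_mono inner)
    also have "\<dots> = 2 * K * sqrt D * (\<Sum>s<T. b s)" by (simp add: sum_distrib_left)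
    also have "\<dots> \<le> 2 * K * sqrt D * (16 * real n)" using K D sum_b by (intro mult_left_mono) auto
    finally show "(\<Sum>s<T. \<Sum>t<T. ?X2 s t) \<le> 32 * K * real n * sqrt D" by (simp add: mult_ac)
  next
    have "(\<Sum>s<T. \<Sum>t<T. ?X3 s t) = (\<Sum>t<T. \<Sum>s<T. ?X3 s t)" by (rule sum.swap)
    also have "\<dots> \<le> (\<Sum>t<T. 2 * K * sqrt D * 4 * (3 * b t + real n * (1 / 2) ^ t))"
    proof (intro sum_mono)
      fix t
      have "(\<Sum>s<T. ?X3 s t) = 2 * K * sqrt D * (\<Sum>s<T. if w s \<le> w t * sqrt D then sqrt (w s / (w t * sqrt D)) else 0) * (3 * b t + real n * (1 / 2) ^ t)"
        by (simp only: sum_distrib_left sum_distrib_right)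
      also have "\<dots> \<le> 2 * K * sqrt D * 4 * (3 * b t + real n * (1 / 2) ^ t)"
        using b0[of t] D K w0[of t] unfolding w_def
        by (intro mult_left_mono mult_right_mono sum_sqrt_powers_below) auto
      finally show "(\<Sum>s<T. ?X3 s t) \<le> 2 * K * sqrt D * 4 * (3 * b t + real n * (1 / 2) ^ t)" .
    qed
    also have "\<dots> = 8 * K * sqrt D * (3 * (\<Sum>t<T. b t) + real n * (\<Sum>t<T. (1 / 2) ^ t))"
      by (simp add: sum_distrib_left sum.distrib algebra_simps)
    also have "\<dots> \<le> 8 * K * sqrt D * (3 * (16 * real n) + real n * 2)"
      using K D sum_b sum_halves[of T] by (intro mult_left_mono add_mono) auto
    finally show "(\<Sum>s<T. \<Sum>t<T. ?X3 s t) \<le> 400 * K * real n * sqrt D" by (simp add: mult_ac)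
  qed
  also have "\<dots> = (9216 + 432 * K) * real n * sqrt D" by (simp add: algebra_simps)
  finally show ?thesis by (simp only: h_def heavy_pairs_const_def mult.assoc)
qed



section \<open>Weighted adjacency matrices\<close>

text \<open>Hyperedges are indices with a vertex set attached, so that the same hyperedges can also be
  used with a vertex deleted from their vertex sets.\<close>

definition weighted_adjacency :: "('e \<Rightarrow> nat set) \<Rightarrow> 'e set \<Rightarrow> ('e \<Rightarrow> real) \<Rightarrow> nat \<Rightarrow> nat \<Rightarrow> real" where
  "weighted_adjacency V F h i j = (if i = j then 0 else \<Sum>e | e \<in> F \<and> i \<in> V e \<and> j \<in> V e. h e)"

definition pair_weight :: "(nat \<Rightarrow> nat \<Rightarrow> real) \<Rightarrow> nat set \<Rightarrow> real" where
  "pair_weight c E = (\<Sum>i\<in>E. \<Sum>j\<in>E - {i}. c i j)"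

lemma weighted_adjacency_sym: "weighted_adjacency V F h i j = weighted_adjacency V F h j i"
  by (simp add: weighted_adjacency_def conj_commute)

lemma weighted_adjacency_nonneg: "(\<And>e. e \<in> F \<Longrightarrow> 0 \<le> h e) \<Longrightarrow> 0 \<le> weighted_adjacency V F h i j"
  by (auto simp: weighted_adjacency_def intro!: sum_nonneg)

lemma weighted_adjacency_diff:
  "weighted_adjacency V F (\<lambda>e. g e - h e) i j = weighted_adjacency V F g i j - weighted_adjacency V F h i j"
  by (simp add: weighted_adjacency_def sum_subtractf)

lemma weighted_adjacency_const: "weighted_adjacency V F (\<lambda>e. a) i j = a * weighted_adjacency V F (\<lambda>e. 1) i j"
  by (simp add: weighted_adjacency_def)

text \<open>Exchanging the order of summation turns a linear statistic of the matrix, whose entries are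
  dependent, into a sum over independent hyperedges. Every probabilistic estimate for the matrix
  enters through this identity.\<close>

lemma sum_weighted_adjacency:
  assumes F: "finite F" and V: "\<And>e. e \<in> F \<Longrightarrow> V e \<subseteq> {..<n}"
  shows "(\<Sum>i<n. \<Sum>j<n. c i j * weighted_adjacency V F h i j) = (\<Sum>e\<in>F. h e * pair_weight c (V e))"
proof -
  have "c i j * weighted_adjacency V F h i j
      = (\<Sum>e\<in>F. if i \<noteq> j \<and> i \<in> V e \<and> j \<in> V e then h e * c i j else 0)" for i j
    using F by (auto simp: weighted_adjacency_def sum_distrib_left mult.commute sum.inter_filter[symmetric] intro!: sum.cong)
  then have "(\<Sum>i<n. \<Sum>j<n. c i j * weighted_adjacency V F h i j)
      = (\<Sum>i<n. \<Sum>e\<in>F. \<Sum>j<n. if i \<noteq> j \<and> i \<in> V e \<and> j \<in> V e then h e * c i j else 0)"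
    by (simp add: sum.swap[of _ F])
  also have "\<dots> = (\<Sum>e\<in>F. \<Sum>i<n. \<Sum>j<n. if i \<noteq> j \<and> i \<in> V e \<and> j \<in> V e then h e * c i j else 0)"
    by (rule sum.swap)
  also have "\<dots> = (\<Sum>e\<in>F. h e * pair_weight c (V e))"
  proof (intro sum.cong refl)
    fix e assume e: "e \<in> F"
    have inner: "(\<Sum>j<n. if i \<noteq> j \<and> i \<in> V e \<and> j \<in> V e then h e * c i j else 0)
        = (if i \<in> V e then h e * (\<Sum>j\<in>V e - {i}. c i j) else 0)" for i
    proof (cases "i \<in> V e")
      case True
      have "(\<Sum>j<n. if i \<noteq> j \<and> i \<in> V e \<and> j \<in> V e then h e * c i j else 0)
          = (\<Sum>j\<in>{j \<in> {..<n}. j \<in> V e - {i}}. h e * c i j)"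
        using True by (subst sum.inter_filter) (auto intro!: sum.cong)
      also have "{j \<in> {..<n}. j \<in> V e - {i}} = V e - {i}" using V[OF e] by auto
      finally show ?thesis using True by (simp add: sum_distrib_left)
    qed simp
    have "(\<Sum>i<n. if i \<in> V e then h e * (\<Sum>j\<in>V e - {i}. c i j) else 0)
        = (\<Sum>i\<in>{i \<in> {..<n}. i \<in> V e}. h e * (\<Sum>j\<in>V e - {i}. c i j))"
      by (subst sum.inter_filter) auto
    also have "{i \<in> {..<n}. i \<in> V e} = V e" using V[OF e] by auto
    finally show "(\<Sum>i<n. \<Sum>j<n. if i \<noteq> j \<and> i \<in> V e \<and> j \<in> V e then h e * c i j else 0) = h e * pair_weight c (V e)"
      unfolding inner pair_weight_def sum_distrib_left[symmetric] .
  qed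
  finally show ?thesis .
qed

lemma pair_weight_nonneg: "(\<And>i j. 0 \<le> c i j) \<Longrightarrow> 0 \<le> pair_weight c E"
  by (simp add: pair_weight_def sum_nonneg)

lemma abs_pair_weight_le:
  assumes "\<And>i j. \<bar>c i j\<bar> \<le> m" "card E \<le> d" "0 \<le> m"
  shows "\<bar>pair_weight c E\<bar> \<le> (real d)\<^sup>2 * m"
proof -
  have "\<bar>pair_weight c E\<bar> \<le> (\<Sum>i\<in>E. \<Sum>j\<in>E - {i}. \<bar>c i j\<bar>)"
    unfolding pair_weight_def by (rule order_trans[OF sum_abs]) (intro sum_mono sum_abs)
  also have "\<dots> \<le> (\<Sum>i\<in>E. \<Sum>j\<in>E - {i}. m)" by (intro sum_mono assms)
  also have "\<dots> \<le> (\<Sum>i\<in>E. real d * m)"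
  proof (intro sum_mono)
    fix i
    have "card (E - {i}) \<le> d" using assms(2) card_Diff1_le[of E i] by linarith
    then show "(\<Sum>j\<in>E - {i}. m) \<le> real d * m" using assms(3) by (simp add: mult_right_mono)
  qed
  also have "\<dots> = real (card E) * (real d * m)" by simp
  also have "\<dots> \<le> real d * (real d * m)" using assms by (intro mult_right_mono) auto
  finally show ?thesis by (simp add: power2_eq_square mult.assoc)
qed

lemma pair_weight_sq_le:
  assumes "finite E" "card E \<le> d"
  shows "(pair_weight c E)\<^sup>2 \<le> (real d)\<^sup>2 * pair_weight (\<lambda>i j. (c i j)\<^sup>2) E"
proof -
  let ?Q = "Sigma E (\<lambda>i. E - {i})"
  have sig: "pair_weight c E = (\<Sum>q\<in>?Q. c (fst q) (snd q))" for c
    using assms(1) by (simp add: pair_weight_def sum.Sigma case_prod_unfold)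
  have "(pair_weight c E)\<^sup>2 = (\<Sum>q\<in>?Q. 1 * c (fst q) (snd q))\<^sup>2" unfolding sig by simp
  also have "\<dots> \<le> (\<Sum>q\<in>?Q. 1\<^sup>2) * (\<Sum>q\<in>?Q. (c (fst q) (snd q))\<^sup>2)"
    by (rule Cauchy_Schwarz_ineq_sum)
  also have "\<dots> = real (card ?Q) * pair_weight (\<lambda>i j. (c i j)\<^sup>2) E" unfolding sig by simp
  also have "\<dots> \<le> (real d)\<^sup>2 * pair_weight (\<lambda>i j. (c i j)\<^sup>2) E"
  proof (rule mult_right_mono)
    have "card ?Q \<le> card (E \<times> E)" using assms(1) by (intro card_mono) auto
    also have "\<dots> \<le> d * d" using assms by (simp add: card_cartesian_product mult_le_mono)
    finally show "real (card ?Q) \<le> (real d)\<^sup>2"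
      by (simp only: power2_eq_square of_nat_mult[symmetric] of_nat_le_iff)
  qed (simp add: pair_weight_nonneg)
  finally show ?thesis .
qed

section \<open>Counting integer points and subsets\<close>

lemma sum_geometric_int:
  "(\<Sum>x\<in>{- int B..int B}. (1 / 2 :: real) ^ nat \<bar>x\<bar>) \<le> 3"
proof -
  have "(\<Sum>x\<in>{- int B..int B}. (1 / 2 :: real) ^ nat \<bar>x\<bar>) = 3 - 2 * (1 / 2) ^ B"
  proof (induction B)
    case (Suc B)
    have eq: "{- int (Suc B)..int (Suc B)} = insert (- int (Suc B)) (insert (int (Suc B)) {- int B..int B})"
      by auto
    show ?case unfolding eq by (subst sum.insert; simp add: Suc.IH nat_add_distrib)+
  qed simp
  then show ?thesis by simp
qed

lemma int_abs_le_square: "\<bar>x\<bar> \<le> x\<^sup>2" for x :: int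
proof (cases "x = 0")
  case False
  then have "\<bar>x\<bar> * 1 \<le> \<bar>x\<bar> * \<bar>x\<bar>" by (intro mult_left_mono) auto
  then show ?thesis by (simp add: power2_eq_square)
qed simp

text \<open>Counting integer points by the exponential Markov trick: each point of the ball gets weight
  at least one, and the total weight factorizes over the coordinates.\<close>

lemma card_integer_ball_le:
  fixes n B :: nat
  defines "Z \<equiv> {z \<in> {..<n} \<rightarrow>\<^sub>E {- int B..int B}. (\<Sum>i<n. (z i)\<^sup>2) \<le> 16 * int n}"
  shows "real (card Z) \<le> exp (18 * real n)"
proof -
  let ?Q = "{..<n} \<rightarrow>\<^sub>E {- int B..int B}"
  have finQ: "finite ?Q" by (intro finite_PiE) auto
  have wt: "exp (- real_of_int (x\<^sup>2)) \<le> (1 / 2) ^ nat \<bar>x\<bar>" for x :: int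
  proof -
    have "\<bar>x\<bar> \<le> x\<^sup>2" by (rule int_abs_le_square)
    then have "real_of_int \<bar>x\<bar> \<le> of_int (x\<^sup>2)" by (simp only: of_int_le_iff)
    then have "exp (- real_of_int (x\<^sup>2)) \<le> exp (- real (nat \<bar>x\<bar>))" by simp
    also have "\<dots> = exp (- 1) ^ nat \<bar>x\<bar>" by (simp add: exp_of_nat_mult[symmetric])
    also have "\<dots> \<le> (1 / 2) ^ nat \<bar>x\<bar>"
    proof (rule power_mono)
      have "(2::real) \<le> exp 1" using exp_ge_add_one_self[of 1] by simp
      then show "exp (- 1) \<le> (1 / 2 :: real)" by (simp add: exp_minus field_simps)
    qed simp
    finally show ?thesis .
  qed
  have "real (card Z) = (\<Sum>z\<in>Z. 1)" by simp
  also have "\<dots> \<le> (\<Sum>z\<in>Z. exp (16 * real n) * (\<Prod>i<n. exp (- real_of_int ((z i)\<^sup>2))))"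
  proof (rule sum_mono)
    fix z assume "z \<in> Z"
    then have "real_of_int (\<Sum>i<n. (z i)\<^sup>2) \<le> of_int (16 * int n)" unfolding Z_def by (simp only: of_int_le_iff mem_Collect_eq)
    then have "1 \<le> exp (16 * real n + (\<Sum>i<n. - real_of_int ((z i)\<^sup>2)))" by (simp add: sum_negf)
    also have "\<dots> = exp (16 * real n) * (\<Prod>i<n. exp (- real_of_int ((z i)\<^sup>2)))"
      by (simp only: exp_add exp_sum[OF finite_lessThan])
    finally show "1 \<le> exp (16 * real n) * (\<Prod>i<n. exp (- real_of_int ((z i)\<^sup>2)))" .
  qed
  also have "\<dots> \<le> (\<Sum>z\<in>?Q. exp (16 * real n) * (\<Prod>i<n. exp (- real_of_int ((z i)\<^sup>2))))"
  proof (rule sum_mono2[OF finQ])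
    show "Z \<subseteq> ?Q" by (auto simp: Z_def)
    show "0 \<le> exp (16 * real n) * (\<Prod>i<n. exp (- real_of_int ((z i)\<^sup>2)))" for z :: "nat \<Rightarrow> int"
      by (intro mult_nonneg_nonneg prod_nonneg exp_ge_zero)
  qed
  also have "\<dots> = exp (16 * real n) * (\<Sum>z\<in>?Q. \<Prod>i<n. exp (- real_of_int ((z i)\<^sup>2)))"
    by (rule sum_distrib_left[symmetric])
  also have "(\<Sum>z\<in>?Q. \<Prod>i<n. exp (- real_of_int ((z i)\<^sup>2))) = (\<Prod>i<n. \<Sum>x\<in>{- int B..int B}. exp (- real_of_int (x\<^sup>2)))"
    by (rule prod_sum_PiE[symmetric]) auto
  also have "exp (16 * real n) * (\<Prod>i<n. \<Sum>x\<in>{- int B..int B}. exp (- real_of_int (x\<^sup>2)))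
      \<le> exp (16 * real n) * (\<Prod>i<n. exp 2)"
  proof (intro mult_left_mono prod_mono conjI)
    have "(\<Sum>x\<in>{- int B..int B}. exp (- real_of_int (x\<^sup>2))) \<le> (\<Sum>x\<in>{- int B..int B}. (1 / 2 :: real) ^ nat \<bar>x\<bar>)"
      by (intro sum_mono wt)
    also have "\<dots> \<le> 3" by (rule sum_geometric_int)
    also have "\<dots> \<le> exp 2" using exp_ge_add_one_self[of 2] by simp
    finally show "(\<Sum>x\<in>{- int B..int B}. exp (- real_of_int (x\<^sup>2))) \<le> exp 2" .
  qed (auto intro: sum_nonneg)
  also have "\<dots> = exp (18 * real n)"
    by (simp add: exp_of_nat_mult[symmetric] exp_add[symmetric])
  finally show ?thesis .
qed

text \<open>The number of subsets of size \<open>b\<close> is at most \<open>(exp 1 * n / b) ^ b\<close>; this is the logarithm of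
  that bound.\<close>

definition subset_entropy :: "nat \<Rightarrow> nat \<Rightarrow> real" where
  "subset_entropy n b = real b * (1 + ln (real n) - ln (real b))"

lemma subset_entropy_mono:
  assumes "1 \<le> a" "a \<le> b" "b \<le> n"
  shows "subset_entropy n a \<le> subset_entropy n b"
proof -
  have pos: "0 < real a" "0 < real b" "0 < real n" using assms by auto
  have "real a * ln (real b / real a) \<le> real a * (real b / real a - 1)"
    using pos by (intro mult_left_mono ln_le_minus_one) auto
  also have "\<dots> = real b - real a" using pos by (simp add: field_simps)
  finally have "real a * (ln (real b) - ln (real a)) \<le> real b - real a" using pos by (simp add: ln_div)
  moreover have "0 \<le> (real b - real a) * (ln (real n) - ln (real b))"
    using assms pos by (intro mult_nonneg_nonneg) auto
  ultimately show ?thesis by (simp add: subset_entropy_def algebra_simps)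
qed

lemma binomial_le_exp_entropy:
  assumes "1 \<le> b" "b \<le> n"
  shows "real (n choose b) \<le> exp (subset_entropy n b)"
proof -
  define x where "x = real b / real n"
  have x: "0 < x" using assms by (simp add: x_def)
  have "real (n choose b) * x ^ b = (\<Sum>k\<in>{b}. real (n choose k) * x ^ k * 1 ^ (n - k))" by simp
  also have "\<dots> \<le> (\<Sum>k\<le>n. real (n choose k) * x ^ k * 1 ^ (n - k))"
    using assms x by (intro sum_mono2) auto
  also have "\<dots> = (x + 1) ^ n" by (rule binomial_ring[symmetric])
  also have "\<dots> \<le> exp x ^ n"
    using x exp_ge_add_one_self[of x] by (intro power_mono) (auto simp: add.commute)
  also have "\<dots> = exp (real b)" using assms by (simp add: exp_of_nat_mult[symmetric] x_def)
  finally have "real (n choose b) \<le> exp (real b) / x ^ b" using x by (simp add: field_simps)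
  also have "\<dots> = exp (real b) * exp (- real b * ln x)"
    using x by (simp add: exp_minus exp_of_nat_mult divide_inverse)
  also have "\<dots> = exp (subset_entropy n b)"
    using assms by (simp add: exp_add[symmetric] subset_entropy_def x_def ln_div algebra_simps)
  finally show ?thesis .
qed

text \<open>One of the five copies of the entropy pays for the number of subsets of a given size. The
  entropy is smallest for singletons, so each of the \<open>n\<close> sizes contributes at most the fourth
  power of \<open>1 / n\<close>.\<close>

lemma sum_subsets_entropy:
  assumes n: "0 < n"
  shows "(\<Sum>I\<in>Pow {..<n} - {{}}. exp (- 5 * subset_entropy n (card I))) \<le> 1 / (real n) ^ 3"
proof -
  let ?f = "\<lambda>b. exp (- 5 * subset_entropy n b)"
  have card_le: "card I \<le> n" if "I \<subseteq> {..<n}" for I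
    using card_mono[OF _ that] by simp
  have "(\<Sum>I\<in>Pow {..<n} - {{}}. ?f (card I)) = (\<Sum>b\<in>{1..n}. \<Sum>I | I \<in> Pow {..<n} - {{}} \<and> card I = b. ?f (card I))"
    using card_le finite_subset[OF _ finite_lessThan, of _ n]
    by (intro sum.group[symmetric]) (auto simp: Suc_le_eq card_gt_0_iff)
  also have "\<dots> \<le> (\<Sum>b\<in>{1..n}. exp (- 4 * subset_entropy n 1))"
  proof (rule sum_mono)
    fix b assume b: "b \<in> {1..n}"
    have "(\<Sum>I | I \<in> Pow {..<n} - {{}} \<and> card I = b. ?f (card I)) \<le> (\<Sum>I | I \<subseteq> {..<n} \<and> card I = b. ?f b)"
    proof -
      have "(\<Sum>I | I \<in> Pow {..<n} - {{}} \<and> card I = b. ?f (card I)) = (\<Sum>I | I \<in> Pow {..<n} - {{}} \<and> card I = b. ?f b)"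
        by (intro sum.cong) auto
      also have "\<dots> \<le> (\<Sum>I | I \<subseteq> {..<n} \<and> card I = b. ?f b)" by (rule sum_mono2) auto
      finally show ?thesis .
    qed
    also have "\<dots> = real (n choose b) * ?f b" by (simp add: n_subsets)
    also have "\<dots> \<le> exp (subset_entropy n b) * ?f b"
      using b by (intro mult_right_mono binomial_le_exp_entropy) auto
    also have "\<dots> = exp (- 4 * subset_entropy n b)" by (simp add: exp_add[symmetric])
    also have "\<dots> \<le> exp (- 4 * subset_entropy n 1)" using b subset_entropy_mono[of 1 b n] by simp
    finally show "(\<Sum>I | I \<in> Pow {..<n} - {{}} \<and> card I = b. ?f (card I)) \<le> exp (- 4 * subset_entropy n 1)" .
  qed
  also have "\<dots> = real n * exp (- 4 * (1 + ln (real n)))" by (simp add: subset_entropy_def)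
  also have "\<dots> \<le> real n * exp (- 4 * ln (real n))" by (intro mult_left_mono) auto
  also have "exp (- 4 * ln (real n)) = 1 / (real n) ^ 4"
  proof -
    have "exp (- 4 * ln (real n)) = inverse (exp (real 4 * ln (real n)))" by (simp add: exp_minus[symmetric])
    also have "exp (real 4 * ln (real n)) = real n ^ 4" using n by (subst exp_of_nat_mult) simp
    finally show ?thesis by (simp add: inverse_eq_divide)
  qed
  also have "real n * (1 / (real n) ^ 4) = 1 / (real n) ^ 3" using n by (simp add: eval_nat_numeral)
  finally show ?thesis by simp
qed

lemma exp_minus_3ln: "3 \<le> n \<Longrightarrow> exp (- 3 * ln (real n)) = 1 / real n ^ 3"
proof -
  assume n: "3 \<le> n"
  have "exp (- 3 * ln (real n)) = inverse (exp (real 3 * ln (real n)))" by (simp add: exp_minus[symmetric])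
  also have "exp (real 3 * ln (real n)) = real n ^ 3" using n by (subst exp_of_nat_mult) simp
  finally show ?thesis by (simp add: inverse_eq_divide)
qed

section \<open>Random hypergraphs with bounded codegrees\<close>

definition discrepancy_const :: "nat \<Rightarrow> real" where
  "discrepancy_const d = 10 * (real d)\<^sup>2 + 2"

definition noise_norm_const :: "nat \<Rightarrow> real" where
  "noise_norm_const d = (276 * (real d)\<^sup>2 + 256 + heavy_pairs_const (discrepancy_const d)) / 8"

lemma noise_norm_const_nonneg: "0 \<le> noise_norm_const d"
  by (simp add: noise_norm_const_def heavy_pairs_const_def discrepancy_const_def)

text \<open>The parameter \<open>D\<close> bounds the expected degrees from above and must be at least logarithmic;
  sparser families are treated by enlarging \<open>D\<close>.\<close>

locale random_hypergraph = bernoulli_hyperedges A F P p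
  for A F :: "'e set" and P :: "'e \<Rightarrow> bool pmf" and p :: real +
  fixes V :: "'e \<Rightarrow> nat set" and n d :: nat and D \<Lambda> :: real
  assumes V_sub: "\<And>e. e \<in> F \<Longrightarrow> V e \<subseteq> {..<n}"
    and V_card: "\<And>e. e \<in> F \<Longrightarrow> card (V e) \<le> d"
    and codegree: "\<And>i j. i < n \<Longrightarrow> j < n \<Longrightarrow> i \<noteq> j \<Longrightarrow> real (card {e \<in> F. i \<in> V e \<and> j \<in> V e}) \<le> \<Lambda>"
    and mean_degree: "p * \<Lambda> * real n \<le> D"
    and D_ge: "ln (real n) \<le> D" and n3: "3 \<le> n" and d1: "1 \<le> d" and \<Lambda>0: "0 \<le> \<Lambda>"
begin

definition adj :: "('e \<Rightarrow> bool) \<Rightarrow> nat \<Rightarrow> nat \<Rightarrow> real" where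
  "adj H = weighted_adjacency V F (\<lambda>e. of_bool (H e))"

definition noise :: "('e \<Rightarrow> bool) \<Rightarrow> nat \<Rightarrow> nat \<Rightarrow> real" where
  "noise H = weighted_adjacency V F (\<lambda>e. of_bool (H e) - p)"

lemma D_pos: "1 \<le> D"
proof -
  have "exp 1 \<le> real n" using exp_le n3 by linarith
  then have "1 \<le> ln (real n)" using n3 by (simp add: ln_ge_iff)
  then show ?thesis using D_ge by linarith
qed

lemma noise_eq: "noise H i j = adj H i j - p * weighted_adjacency V F (\<lambda>e. 1) i j"
  unfolding noise_def adj_def weighted_adjacency_diff by (subst weighted_adjacency_const) simp

text \<open>In expectation, each pair of vertices is covered at most \<open>D / n\<close> times. The codegrees enter the
  probabilistic estimates in this form.\<close>

lemma expected_pair_weight_le: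
  assumes c: "\<And>i j. 0 \<le> c i j"
  shows "p * (\<Sum>e\<in>F. pair_weight c (V e)) \<le> D / real n * (\<Sum>i<n. \<Sum>j<n. c i j)"
proof -
  have le: "weighted_adjacency V F (\<lambda>e. 1) i j \<le> \<Lambda>" if "i < n" "j < n" for i j
    using codegree[OF that] \<Lambda>0 by (auto simp: weighted_adjacency_def conj_assoc)
  have "(\<Sum>e\<in>F. pair_weight c (V e)) = (\<Sum>i<n. \<Sum>j<n. c i j * weighted_adjacency V F (\<lambda>e. 1) i j)"
    by (subst sum_weighted_adjacency) (auto simp: finite_F V_sub)
  also have "\<dots> \<le> (\<Sum>i<n. \<Sum>j<n. c i j * \<Lambda>)"
    by (intro sum_mono mult_left_mono le c) auto
  also have "\<dots> = \<Lambda> * (\<Sum>i<n. \<Sum>j<n. c i j)" by (simp add: sum_distrib_left mult.commute)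
  finally have "p * (\<Sum>e\<in>F. pair_weight c (V e)) \<le> p * (\<Lambda> * (\<Sum>i<n. \<Sum>j<n. c i j))"
    using p_bounds by (intro mult_left_mono) auto
  also have "\<dots> = p * \<Lambda> * (\<Sum>i<n. \<Sum>j<n. c i j)" by simp
  also have "\<dots> \<le> D / real n * (\<Sum>i<n. \<Sum>j<n. c i j)"
    using mean_degree n3 by (intro mult_right_mono sum_nonneg c) (simp add: field_simps)
  finally show ?thesis .
qed

lemma finite_V: "e \<in> F \<Longrightarrow> finite (V e)"
  using V_sub finite_subset by blast

section \<open>Light pairs\<close>

definition light :: "(nat \<Rightarrow> int) \<Rightarrow> nat \<Rightarrow> nat \<Rightarrow> real" where
  "light z i j = (if \<bar>of_int (z i) * of_int (z j)\<bar> \<le> sqrt D then of_int (z i) * of_int (z j) else 0)"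

text \<open>Truncation at \<open>sqrt D\<close> makes the variance term and the threshold of the same order \<open>n\<close> once the
  coefficients are scaled to at most \<open>1\<close>. The threshold is chosen so that the failure probability
  beats the \<open>exp (18 * n)\<close> integer points of the ball.\<close>

lemma prob_light_large:
  assumes z: "(\<Sum>i<n. (z i)\<^sup>2) \<le> 16 * int n"
  shows "measure_pmf.prob law {H. 276 * (real d)\<^sup>2 * real n * sqrt D \<le> \<bar>\<Sum>i<n. \<Sum>j<n. light z i j * noise H i j\<bar>}
    \<le> 2 * exp (- 20 * real n)"
proof -
  define s where "s = (real d)\<^sup>2 * sqrt D"
  have s0: "0 < s" using D_pos d1 by (simp add: s_def)
  define a where "a e = pair_weight (light z) (V e) / s" for e
  have a1: "\<bar>a e\<bar> \<le> 1" if "e \<in> F" for e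
  proof -
    have "\<bar>pair_weight (light z) (V e)\<bar> \<le> (real d)\<^sup>2 * sqrt D"
      using D_pos by (intro abs_pair_weight_le V_card that) (auto simp: light_def)
    then show ?thesis using s0 by (simp add: a_def s_def)
  qed
  have "(\<Sum>i<n. \<Sum>j<n. (light z i j)\<^sup>2) \<le> (\<Sum>i<n. \<Sum>j<n. (of_int (z i))\<^sup>2 * (of_int (z j))\<^sup>2)"
    by (intro sum_mono) (auto simp: light_def power_mult_distrib)
  also have "\<dots> = (\<Sum>i<n. (of_int (z i))\<^sup>2) * (\<Sum>j<n. (of_int (z j))\<^sup>2)" by (simp only: sum_product)
  also have "\<dots> = (of_int (\<Sum>i<n. (z i)\<^sup>2))\<^sup>2" by (simp add: power2_eq_square)
  also have "\<dots> \<le> (of_int (16 * int n))\<^sup>2"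
    using z by (intro power_mono) (auto simp del: of_int_sum simp: sum_nonneg)
  finally have light_sq: "(\<Sum>i<n. \<Sum>j<n. (light z i j)\<^sup>2) \<le> (16 * real n)\<^sup>2" by simp
  have "p * (\<Sum>e\<in>F. (a e)\<^sup>2) \<le> p * (\<Sum>e\<in>F. (real d)\<^sup>2 / s\<^sup>2 * pair_weight (\<lambda>i j. (light z i j)\<^sup>2) (V e))"
    using p_bounds pair_weight_sq_le[OF finite_V V_card, of _ "light z"]
    by (intro mult_left_mono sum_mono) (auto simp: a_def power_divide divide_right_mono)
  also have "\<dots> = (real d)\<^sup>2 / s\<^sup>2 * (p * (\<Sum>e\<in>F. pair_weight (\<lambda>i j. (light z i j)\<^sup>2) (V e)))"
    by (simp add: sum_distrib_left mult.left_commute)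
  also have "\<dots> \<le> (real d)\<^sup>2 / s\<^sup>2 * (D / real n * (16 * real n)\<^sup>2)"
  proof (rule mult_left_mono)
    have "p * (\<Sum>e\<in>F. pair_weight (\<lambda>i j. (light z i j)\<^sup>2) (V e)) \<le> D / real n * (\<Sum>i<n. \<Sum>j<n. (light z i j)\<^sup>2)"
      by (rule expected_pair_weight_le) simp
    also have "\<dots> \<le> D / real n * (16 * real n)\<^sup>2" using D_pos by (intro mult_left_mono light_sq) auto
    finally show "p * (\<Sum>e\<in>F. pair_weight (\<lambda>i j. (light z i j)\<^sup>2) (V e)) \<le> D / real n * (16 * real n)\<^sup>2" .
  qed simp
  also have "\<dots> = 256 * real n / (real d)\<^sup>2"
  proof -
    have gen: "x / (x * (x * D)) * (D / y * (16 * y)\<^sup>2) = 256 * y / x" if "0 < x" "0 < y" for x y :: real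
      using that D_pos by (simp add: field_simps power2_eq_square)
    have "s\<^sup>2 = (real d)\<^sup>2 * ((real d)\<^sup>2 * D)"
      using D_pos unfolding s_def power_mult_distrib by (simp add: power2_eq_square)
    then show ?thesis by (simp only:) (rule gen; use d1 n3 in simp)
  qed
  also have "\<dots> \<le> 256 * real n / 1"
    using d1 by (intro divide_left_mono) auto
  finally have var: "p * (\<Sum>e\<in>F. (a e)\<^sup>2) \<le> 256 * real n" by simp
  have eq: "(\<Sum>e\<in>F. a e * (of_bool (H e) - p)) = (\<Sum>i<n. \<Sum>j<n. light z i j * noise H i j) / s" for H
    unfolding noise_def a_def by (subst sum_weighted_adjacency)
      (auto simp: finite_F V_sub sum_divide_distrib mult.commute)
  have seteq: "{H. 276 * (real d)\<^sup>2 * real n * sqrt D \<le> \<bar>\<Sum>i<n. \<Sum>j<n. light z i j * noise H i j\<bar>}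
      = {H. 276 * real n \<le> \<bar>\<Sum>e\<in>F. a e * (of_bool (H e) - p)\<bar>}"
  proof -
    have "\<bar>x / s\<bar> = \<bar>x\<bar> / s" for x using s0 by simp
    moreover have "276 * (real d)\<^sup>2 * real n * sqrt D = 276 * real n * s" by (simp add: s_def)
    ultimately show ?thesis unfolding eq by (simp only: pos_le_divide_eq[OF s0])
  qed
  have "measure_pmf.prob law {H. 276 * real n \<le> \<bar>\<Sum>e\<in>F. a e * (of_bool (H e) - p)\<bar>}
      \<le> 2 * exp (p * (\<Sum>e\<in>F. (a e)\<^sup>2) - 276 * real n)"
    by (rule prob_abs_centered_sum_ge[OF a1])
  moreover have "exp (p * (\<Sum>e\<in>F. (a e)\<^sup>2) - 276 * real n) \<le> exp (- 20 * real n)" using var by simp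
  ultimately show ?thesis unfolding seteq by linarith
qed

definition light_good :: "('e \<Rightarrow> bool) \<Rightarrow> bool" where
  "light_good H \<longleftrightarrow> (\<forall>z. (\<Sum>i<n. (z i)\<^sup>2) \<le> 16 * int n \<longrightarrow>
     \<bar>\<Sum>i<n. \<Sum>j<n. light z i j * noise H i j\<bar> \<le> 276 * (real d)\<^sup>2 * real n * sqrt D)"

lemma exp_minus_2n: "exp (- 2 * real n) \<le> 1 / (real n)\<^sup>2"
proof -
  have "real n \<le> exp (real n)" using exp_ge_add_one_self[of "real n"] by linarith
  then have "(real n)\<^sup>2 \<le> (exp (real n))\<^sup>2" by (intro power_mono) auto
  also have "\<dots> = exp (2 * real n)" by (simp add: power2_eq_square exp_add[symmetric])
  finally have "1 / exp (2 * real n) \<le> 1 / (real n)\<^sup>2" using n3 by (intro divide_left_mono) auto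
  then show ?thesis by (simp add: exp_minus inverse_eq_divide)
qed

lemma prob_not_light_good: "measure_pmf.prob law {H. \<not> light_good H} \<le> 2 / (real n)\<^sup>2"
proof -
  define Z where "Z = {z \<in> {..<n} \<rightarrow>\<^sub>E {- int (16 * n)..int (16 * n)}. (\<Sum>i<n. (z i)\<^sup>2) \<le> 16 * int n}"
  let ?B = "\<lambda>z. {H. 276 * (real d)\<^sup>2 * real n * sqrt D \<le> \<bar>\<Sum>i<n. \<Sum>j<n. light z i j * noise H i j\<bar>}"
  have finZ: "finite Z" unfolding Z_def by (rule finite_subset[of _ "{..<n} \<rightarrow>\<^sub>E {- int (16 * n)..int (16 * n)}"]) (auto intro: finite_PiE)
  have "{H. \<not> light_good H} \<subseteq> (\<Union>z\<in>Z. ?B z)"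
  proof
    fix H assume "H \<in> {H. \<not> light_good H}"
    then obtain z where z: "(\<Sum>i<n. (z i)\<^sup>2) \<le> 16 * int n"
      and large: "276 * (real d)\<^sup>2 * real n * sqrt D < \<bar>\<Sum>i<n. \<Sum>j<n. light z i j * noise H i j\<bar>"
      by (auto simp: light_good_def not_le)
    \<comment> \<open>only the coordinates below \<open>n\<close> count, which makes the union bound finite\<close>
    define z' where "z' = restrict z {..<n}"
    have z'_eq: "z' i = z i" if "i < n" for i using that by (simp add: z'_def)
    have "z i \<in> {- int (16 * n)..int (16 * n)}" if "i < n" for i
    proof -
      have "(z i)\<^sup>2 \<le> (\<Sum>i<n. (z i)\<^sup>2)" using that by (intro member_le_sum) auto
      then have "(z i)\<^sup>2 \<le> 16 * int n" using z by linarith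
      moreover have "\<bar>z i\<bar> \<le> (z i)\<^sup>2" by (rule int_abs_le_square)
      ultimately show ?thesis by auto
    qed
    then have "z' \<in> Z" using z by (auto simp: Z_def z'_def)
    moreover have "(\<Sum>i<n. \<Sum>j<n. light z' i j * noise H i j) = (\<Sum>i<n. \<Sum>j<n. light z i j * noise H i j)"
      by (intro sum.cong refl) (simp add: light_def z'_eq)
    ultimately show "H \<in> (\<Union>z\<in>Z. ?B z)" using large by force
  qed
  then have "measure_pmf.prob law {H. \<not> light_good H} \<le> measure_pmf.prob law (\<Union>z\<in>Z. ?B z)"
    by (intro measure_pmf.finite_measure_mono) auto
  also have "\<dots> \<le> (\<Sum>z\<in>Z. measure_pmf.prob law (?B z))"
    using finZ by (intro measure_UNION_le) auto
  also have "\<dots> \<le> (\<Sum>z\<in>Z. 2 * exp (- 20 * real n))"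
    by (intro sum_mono prob_light_large) (simp add: Z_def)
  also have "\<dots> = real (card Z) * (2 * exp (- 20 * real n))" by simp
  also have "\<dots> \<le> exp (18 * real n) * (2 * exp (- 20 * real n))"
    unfolding Z_def by (intro mult_right_mono card_integer_ball_le) auto
  also have "\<dots> = 2 * exp (- 2 * real n)" by (simp add: exp_add[symmetric])
  also have "\<dots> \<le> 2 * (1 / (real n)\<^sup>2)" using exp_minus_2n by (intro mult_left_mono) auto
  finally show ?thesis by simp
qed

section \<open>Degrees and discrepancy\<close>

definition degree_good :: "('e \<Rightarrow> bool) \<Rightarrow> bool" where
  "degree_good H \<longleftrightarrow> (\<forall>i<n. (\<Sum>j<n. adj H i j) \<le> discrepancy_const d * D)"

lemma prob_indicator_sum_ge:
  assumes c: "\<And>i j. 0 \<le> c i j" "\<And>i j. c i j \<le> 1" and r: "1 \<le> r"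
    and \<mu>: "D / real n * (\<Sum>i<n. \<Sum>j<n. c i j) \<le> \<mu>"
  shows "measure_pmf.prob law {H. y \<le> (\<Sum>i<n. \<Sum>j<n. c i j * adj H i j)}
    \<le> exp (\<mu> / (real d)\<^sup>2 * (r - 1) - y / (real d)\<^sup>2 * ln r)"
proof -
  have eq: "(\<Sum>i<n. \<Sum>j<n. c i j * adj H i j) = (\<Sum>e\<in>F. pair_weight c (V e) * of_bool (H e))" for H
    unfolding adj_def by (subst sum_weighted_adjacency) (auto simp: finite_F V_sub mult.commute)
  have mean: "p * (\<Sum>e\<in>F. pair_weight c (V e)) \<le> \<mu>"
    using expected_pair_weight_le[of c, OF c(1)] \<mu> by (rule order_trans)
  have abs_c: "\<bar>c i j\<bar> \<le> 1" for i j using c(1)[of i j] c(2)[of i j] by linarith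
  have upper: "pair_weight c (V e) \<le> (real d)\<^sup>2" if "e \<in> F" for e
  proof -
    have "\<bar>pair_weight c (V e)\<bar> \<le> (real d)\<^sup>2 * 1"
      by (rule abs_pair_weight_le[OF abs_c V_card[OF that]]) simp
    then show ?thesis by linarith
  qed
  show ?thesis unfolding eq
  proof (rule chernoff[OF _ upper _ mean r])
    show "0 \<le> pair_weight c (V e)" for e using c(1) by (rule pair_weight_nonneg)
    show "0 < (real d)\<^sup>2" using d1 by simp
  qed
qed

lemma prob_not_degree_good: "measure_pmf.prob law {H. \<not> degree_good H} \<le> 1 / (real n)\<^sup>2"
proof -
  let ?c = "\<lambda>i a b. of_bool (a = i) :: real"
  let ?B = "\<lambda>i. {H. discrepancy_const d * D \<le> (\<Sum>a<n. \<Sum>b<n. ?c i a b * adj H a b)}"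
  have row: "(\<Sum>a<n. \<Sum>b<n. ?c i a b * f a b) = (\<Sum>b<n. f i b)" if "i < n" for i and f :: "nat \<Rightarrow> nat \<Rightarrow> real"
  proof -
    have "(\<Sum>a<n. \<Sum>b<n. ?c i a b * f a b) = (\<Sum>a<n. if a = i then (\<Sum>b<n. f a b) else 0)"
      by (intro sum.cong) auto
    then show ?thesis using that by simp
  qed
  have "{H. \<not> degree_good H} \<subseteq> (\<Union>i\<in>{..<n}. ?B i)"
  proof
    fix H assume "H \<in> {H. \<not> degree_good H}"
    then obtain i where "i < n" "discrepancy_const d * D < (\<Sum>j<n. adj H i j)"
      by (auto simp: degree_good_def not_le)
    then have "i \<in> {..<n}" "discrepancy_const d * D \<le> (\<Sum>a<n. \<Sum>b<n. ?c i a b * adj H a b)"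
      unfolding row[OF \<open>i < n\<close>] by auto
    then show "H \<in> (\<Union>i\<in>{..<n}. ?B i)" by blast
  qed
  then have "measure_pmf.prob law {H. \<not> degree_good H} \<le> measure_pmf.prob law (\<Union>i\<in>{..<n}. ?B i)"
    by (intro measure_pmf.finite_measure_mono) auto
  also have "\<dots> \<le> (\<Sum>i\<in>{..<n}. measure_pmf.prob law (?B i))"
    by (intro measure_UNION_le) auto
  also have "\<dots> \<le> (\<Sum>i\<in>{..<n}. exp (- 3 * ln (real n)))"
  proof (rule sum_mono)
    fix i assume i: "i \<in> {..<n}"
    have "measure_pmf.prob law (?B i) \<le> exp (D / (real d)\<^sup>2 * (exp 1 - 1) - discrepancy_const d * D / (real d)\<^sup>2 * ln (exp 1))"
    proof (rule prob_indicator_sum_ge)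
      show "D / real n * (\<Sum>a<n. \<Sum>b<n. ?c i a b) \<le> D"
        using i n3 row[of i "\<lambda>_ _. 1"] by simp
      show "1 \<le> exp (1::real)" by simp
    qed auto
    also have "D / (real d)\<^sup>2 * (exp 1 - 1) - discrepancy_const d * D / (real d)\<^sup>2 * ln (exp 1) \<le> - 3 * ln (real n)"
    proof -
      have "D * (exp 1 - 1) \<le> D * 2" using exp_le D_pos by (intro mult_left_mono) auto
      then have "(D * (exp 1 - 1) - discrepancy_const d * D) / (real d)\<^sup>2 \<le> (- 10 * (real d)\<^sup>2 * D) / (real d)\<^sup>2"
        by (intro divide_right_mono) (auto simp: discrepancy_const_def algebra_simps)
      also have "\<dots> = - 10 * D" using d1 by simp
      also have "\<dots> \<le> - 3 * ln (real n)" using D_ge D_pos by linarith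
      finally show ?thesis by (simp add: diff_divide_distrib)
    qed
    finally show "measure_pmf.prob law (?B i) \<le> exp (- 3 * ln (real n))" by simp
  qed
  also have "\<dots> = 1 / (real n)\<^sup>2"
    unfolding exp_minus_3ln[OF n3] using n3 by (simp add: eval_nat_numeral)
  finally show ?thesis .
qed

text \<open>The common expression \<open>exp 2 * (4 * m / sqrt D)\<close> is the ratio to the mean at which Chernoff's
  inequality is applied. The first summand is that ratio times the mean number of edges
  between \<open>I\<close> and \<open>J\<close>; the second is what a union bound over all \<open>I\<close> and \<open>J\<close> costs at that ratio.\<close>

definition discrepancy_bound :: "nat \<Rightarrow> nat set \<Rightarrow> nat set \<Rightarrow> real" where
  "discrepancy_bound m I J = exp 2 * (4 * real m / sqrt D) * (real (card I) * real (card J) * D / real n)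
     + discrepancy_const d * real (card J) * (1 + ln (real n) - ln (real (card J))) / ln (exp 2 * (4 * real m / sqrt D))"

definition discrepancy_good :: "('e \<Rightarrow> bool) \<Rightarrow> bool" where
  "discrepancy_good H \<longleftrightarrow> (\<forall>I J m. I \<subseteq> {..<n} \<longrightarrow> J \<subseteq> {..<n} \<longrightarrow> I \<noteq> {} \<longrightarrow> card I \<le> card J \<longrightarrow>
     m \<le> 16 * n \<longrightarrow> sqrt D \<le> 4 * real m \<longrightarrow> (\<Sum>i\<in>I. \<Sum>j\<in>J. adj H i j) \<le> discrepancy_bound m I J)"

text \<open>The ratio is at least \<open>exp 2\<close>, so the term \<open>y * ln r\<close> dominates the compensating term of
  Chernoff's inequality and leaves ten copies of the entropy of the larger set, five for each of
  the two sets.\<close>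

lemma prob_discrepancy_large:
  assumes I: "I \<subseteq> {..<n}" "I \<noteq> {}" and J: "J \<subseteq> {..<n}" "card I \<le> card J" and m: "sqrt D \<le> 4 * real m"
  shows "measure_pmf.prob law {H. discrepancy_bound m I J \<le> (\<Sum>i\<in>I. \<Sum>j\<in>J. adj H i j)}
    \<le> exp (- 5 * subset_entropy n (card I)) * exp (- 5 * subset_entropy n (card J))"
proof -
  define r where "r = exp 2 * (4 * real m / sqrt D)"
  define \<mu> where "\<mu> = real (card I) * real (card J) * D / real n"
  have \<mu>0: "0 \<le> \<mu>" using D_pos by (simp add: \<mu>_def)
  have quot: "1 \<le> 4 * real m / sqrt D" using m D_pos by simp
  have lnr: "2 \<le> ln r"
  proof -
    have "ln r = 2 + ln (4 * real m / sqrt D)" unfolding r_def using quot by (subst ln_mult_pos) auto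
    then show ?thesis using ln_ge_zero[OF quot] by linarith
  qed
  have r1: "1 \<le> r"
  proof -
    have "1 * 1 \<le> exp 2 * (4 * real m / sqrt D)" using quot by (intro mult_mono) auto
    then show ?thesis by (simp add: r_def)
  qed
  have finIJ: "finite I" "finite J" using I J finite_subset by blast+
  have cI: "1 \<le> card I" using finIJ I by (simp add: Suc_le_eq card_gt_0_iff)
  have cJ: "card J \<le> n" using card_mono[OF _ J(1)] by simp
  let ?c = "\<lambda>i j. of_bool (i \<in> I \<and> j \<in> J) :: real"
  have ind: "(\<Sum>i<n. \<Sum>j<n. ?c i j * f i j) = (\<Sum>i\<in>I. \<Sum>j\<in>J. f i j)" for f :: "nat \<Rightarrow> nat \<Rightarrow> real"
  proof -
    have "(\<Sum>i<n. \<Sum>j<n. ?c i j * f i j) = (\<Sum>i\<in>I. \<Sum>j<n. ?c i j * f i j)"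
      using I by (intro sum.mono_neutral_right) auto
    also have "\<dots> = (\<Sum>i\<in>I. \<Sum>j\<in>J. ?c i j * f i j)"
      using J by (intro sum.cong sum.mono_neutral_right refl) auto
    finally show ?thesis by simp
  qed
  let ?y = "discrepancy_bound m I J"
  have "measure_pmf.prob law {H. ?y \<le> (\<Sum>i<n. \<Sum>j<n. ?c i j * adj H i j)}
      \<le> exp (\<mu> / (real d)\<^sup>2 * (r - 1) - ?y / (real d)\<^sup>2 * ln r)"
  proof (rule prob_indicator_sum_ge[OF _ _ r1])
    have "(\<Sum>i<n. \<Sum>j<n. ?c i j) = real (card I) * real (card J)"
      using ind[of "\<lambda>_ _. 1"] by (simp only: mult_1_right sum_constant of_nat_mult)
    then show "D / real n * (\<Sum>i<n. \<Sum>j<n. ?c i j) \<le> \<mu>" by (simp only: \<mu>_def) (simp add: mult_ac)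
  qed auto
  moreover have "\<mu> / (real d)\<^sup>2 * (r - 1) - ?y / (real d)\<^sup>2 * ln r \<le> - 10 * subset_entropy n (card J)"
  proof -
    have ent0: "0 \<le> subset_entropy n (card J)"
    proof -
      have "ln (real (card J)) \<le> ln (real n)" using cI cJ J(2) by simp
      then show ?thesis unfolding subset_entropy_def by (intro mult_nonneg_nonneg) auto
    qed
    have "?y * ln r = r * \<mu> * ln r + discrepancy_const d * subset_entropy n (card J)"
      using lnr unfolding discrepancy_bound_def r_def[symmetric] \<mu>_def[symmetric]
      by (simp add: distrib_right subset_entropy_def)
    moreover have "r * \<mu> * 1 \<le> r * \<mu> * ln r" using r1 \<mu>0 lnr by (intro mult_left_mono) auto
    moreover have "\<mu> * (r - 1) \<le> r * \<mu>" using \<mu>0 by (simp add: algebra_simps)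
    moreover have "10 * (real d)\<^sup>2 * subset_entropy n (card J) \<le> discrepancy_const d * subset_entropy n (card J)"
      using ent0 by (intro mult_right_mono) (auto simp: discrepancy_const_def)
    ultimately have "\<mu> * (r - 1) - ?y * ln r \<le> - (10 * (real d)\<^sup>2 * subset_entropy n (card J))" by linarith
    then have "(\<mu> * (r - 1) - ?y * ln r) / (real d)\<^sup>2 \<le> - (10 * (real d)\<^sup>2 * subset_entropy n (card J)) / (real d)\<^sup>2"
      by (intro divide_right_mono) auto
    then show ?thesis using d1 by (simp add: diff_divide_distrib)
  qed
  moreover have "- 10 * subset_entropy n (card J) \<le> - 5 * subset_entropy n (card I) + - 5 * subset_entropy n (card J)"
    using subset_entropy_mono[OF cI J(2) cJ] by simp
  ultimately have "measure_pmf.prob law {H. ?y \<le> (\<Sum>i<n. \<Sum>j<n. ?c i j * adj H i j)}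
      \<le> exp (- 5 * subset_entropy n (card I) + - 5 * subset_entropy n (card J))"
    by (meson exp_le_cancel_iff order_trans)
  then show ?thesis unfolding ind exp_add .
qed

lemma prob_not_discrepancy_good: "measure_pmf.prob law {H. \<not> discrepancy_good H} \<le> 1 / (real n)\<^sup>2"
proof -
  define Q where "Q = Pow {..<n} - {{}}"
  define T where "T = {(I, J). I \<in> Q \<and> J \<in> Q \<and> card I \<le> card J}"
  define M where "M = {m. m \<le> 16 * n \<and> sqrt D \<le> 4 * real m}"
  let ?B = "\<lambda>(m, I, J). {H. discrepancy_bound m I J \<le> (\<Sum>i\<in>I. \<Sum>j\<in>J. adj H i j)}"
  have finQ: "finite Q" by (simp add: Q_def)
  have finT: "finite T" by (rule finite_subset[of _ "Q \<times> Q"]) (auto simp: T_def finQ)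
  have finM: "finite M" by (rule finite_subset[of _ "{..16 * n}"]) (auto simp: M_def)
  have "{H. \<not> discrepancy_good H} \<subseteq> (\<Union>x\<in>M \<times> T. ?B x)"
  proof
    fix H assume "H \<in> {H. \<not> discrepancy_good H}"
    then obtain I J m where *: "I \<subseteq> {..<n}" "J \<subseteq> {..<n}" "I \<noteq> {}" "card I \<le> card J"
      "m \<le> 16 * n" "sqrt D \<le> 4 * real m" "discrepancy_bound m I J < (\<Sum>i\<in>I. \<Sum>j\<in>J. adj H i j)"
      by (auto simp: discrepancy_good_def not_le)
    have "J \<noteq> {}" using * finite_subset[OF *(1)] by auto
    then have "(m, I, J) \<in> M \<times> T" using * by (auto simp: M_def T_def Q_def)
    then show "H \<in> (\<Union>x\<in>M \<times> T. ?B x)" using *(7) by (intro UN_I) auto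
  qed
  then have "measure_pmf.prob law {H. \<not> discrepancy_good H} \<le> measure_pmf.prob law (\<Union>x\<in>M \<times> T. ?B x)"
    by (intro measure_pmf.finite_measure_mono) auto
  also have "\<dots> \<le> (\<Sum>x\<in>M \<times> T. measure_pmf.prob law (?B x))"
    using finM finT by (intro measure_UNION_le) auto
  also have "\<dots> \<le> (\<Sum>x\<in>M \<times> T. exp (- 5 * subset_entropy n (card (fst (snd x)))) * exp (- 5 * subset_entropy n (card (snd (snd x)))))"
  proof (rule sum_mono)
    fix x assume "x \<in> M \<times> T"
    then obtain m I J where x: "x = (m, I, J)" and "sqrt D \<le> 4 * real m" "I \<subseteq> {..<n}" "I \<noteq> {}" "J \<subseteq> {..<n}" "card I \<le> card J"
      by (auto simp: M_def T_def Q_def)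
    then show "measure_pmf.prob law (?B x) \<le> exp (- 5 * subset_entropy n (card (fst (snd x)))) * exp (- 5 * subset_entropy n (card (snd (snd x))))"
      using prob_discrepancy_large[of I J m] by simp
  qed
  also have "\<dots> = real (card M) * (\<Sum>(I, J)\<in>T. exp (- 5 * subset_entropy n (card I)) * exp (- 5 * subset_entropy n (card J)))"
  proof -
    have "(\<Sum>x\<in>M \<times> T. g (snd x)) = (\<Sum>m\<in>M. \<Sum>y\<in>T. g y)" for g :: "nat set \<times> nat set \<Rightarrow> real"
      by (simp only: sum.cartesian_product case_prod_unfold)
    then show ?thesis by (simp add: case_prod_unfold)
  qed
  also have "\<dots> \<le> real (card M) * (\<Sum>(I, J)\<in>Q \<times> Q. exp (- 5 * subset_entropy n (card I)) * exp (- 5 * subset_entropy n (card J)))"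
    using finQ by (intro mult_left_mono sum_mono2) (auto simp: T_def)
  also have "\<dots> = real (card M) * ((\<Sum>I\<in>Q. exp (- 5 * subset_entropy n (card I))) * (\<Sum>J\<in>Q. exp (- 5 * subset_entropy n (card J))))"
    by (simp add: sum_product sum.cartesian_product)
  also have "\<dots> \<le> (17 * real n) * ((1 / (real n) ^ 3) * (1 / (real n) ^ 3))"
  proof (intro mult_mono)
    have "card M \<le> card {..16 * n}" by (rule card_mono) (auto simp: M_def)
    then show "real (card M) \<le> 17 * real n" using n3 by simp
  qed (use sum_subsets_entropy n3 in \<open>auto simp: Q_def intro!: sum_nonneg mult_nonneg_nonneg\<close>)
  also have "\<dots> \<le> 1 / (real n)\<^sup>2"
  proof -
    have "(3::real) ^ 3 \<le> real n ^ 3" using n3 by (intro power_mono) auto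
    then have "17 \<le> real n ^ 3" by simp
    then have "17 * real n ^ 3 \<le> real n ^ 3 * real n ^ 3" by (intro mult_right_mono) auto
    then show ?thesis using n3 by (simp add: field_simps eval_nat_numeral)
  qed
  finally show ?thesis .
qed

section \<open>The operator norm of the noise\<close>

lemma noise_symmetric: "symmetric_upto n (noise H)"
  by (simp add: symmetric_upto_def noise_def weighted_adjacency_sym)

text \<open>At an integer point the quadratic form splits into its light pairs, the heavy pairs of the
  adjacency matrix, and the heavy pairs of its mean; the last are bounded by trading one factor
  \<open>sqrt D\<close> for \<open>\<bar>z i * z j\<bar>\<close>.\<close>

lemma form_bounded_noise:
  assumes good: "light_good H" "degree_good H" "discrepancy_good H"
  shows "form_bounded n (noise H) (noise_norm_const d * sqrt D)"
proof -
  have "form_bounded n (noise H) (8 * noise_norm_const d * real n * sqrt D / (8 * real n))"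
  proof (rule form_bounded_if_integer_points[OF noise_symmetric])
    show "0 < n" using n3 by simp
    fix z :: "nat \<Rightarrow> int" assume z: "(\<Sum>i<n. (z i)\<^sup>2) \<le> 16 * int n"
    let ?zz = "\<lambda>i j. real_of_int (z i) * of_int (z j)"
    let ?hv = "\<lambda>f. \<Sum>i<n. \<Sum>j<n. if sqrt D < \<bar>?zz i j\<bar> then \<bar>?zz i j\<bar> * f i j else 0"
    let ?mean = "\<lambda>i j. p * weighted_adjacency V F (\<lambda>e. 1) i j"
    have light: "\<bar>\<Sum>i<n. \<Sum>j<n. light z i j * noise H i j\<bar> \<le> 276 * (real d)\<^sup>2 * real n * sqrt D"
      using good(1) z by (auto simp: light_good_def)
    have heavy: "?hv (adj H) \<le> heavy_pairs_const (discrepancy_const d) * real n * sqrt D"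
    proof (rule heavy_pairs_bound[OF _ _ _ _ _ _ _ z])
      show "0 \<le> adj H i j" for i j by (simp add: adj_def weighted_adjacency_nonneg)
      show "adj H i j = adj H j i" for i j unfolding adj_def by (rule weighted_adjacency_sym)
      show "i < n \<Longrightarrow> (\<Sum>j<n. adj H i j) \<le> discrepancy_const d * D" for i
        using good(2) by (simp add: degree_good_def)
      show "(\<Sum>i\<in>I. \<Sum>j\<in>J. adj H i j) \<le> exp 2 * (4 * real m / sqrt D) * (real (card I) * real (card J) * D / real n)
          + discrepancy_const d * real (card J) * (1 + ln (real n) - ln (real (card J))) / ln (exp 2 * (4 * real m / sqrt D))"
        if "I \<subseteq> {..<n}" "J \<subseteq> {..<n}" "I \<noteq> {}" "card I \<le> card J" "m \<le> 16 * n" "sqrt D \<le> 4 * real m" for I J m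
        using good(3) that unfolding discrepancy_good_def discrepancy_bound_def by blast
    qed (use n3 D_pos in \<open>auto simp: discrepancy_const_def\<close>)
    have mean0: "0 \<le> ?mean i j" for i j
      using p_bounds by (simp add: weighted_adjacency_nonneg)
    have mean: "?hv ?mean \<le> 256 * real n * sqrt D"
    proof -
      have D0: "0 < sqrt D" using D_pos by simp
      have mean_le: "?mean i j \<le> D / real n" if "i < n" "j < n" for i j
      proof -
        have "weighted_adjacency V F (\<lambda>e. 1) i j \<le> \<Lambda>"
          using codegree[OF that] \<Lambda>0 by (auto simp: weighted_adjacency_def conj_assoc)
        then have "?mean i j \<le> p * \<Lambda>" using p_bounds by (intro mult_left_mono) auto
        also have "\<dots> \<le> D / real n" using mean_degree n3 by (simp add: field_simps)
        finally show ?thesis .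
      qed
      have "?hv ?mean \<le> (\<Sum>i<n. \<Sum>j<n. sqrt D / real n * ((of_int (z i))\<^sup>2 * (of_int (z j))\<^sup>2))"
      proof (intro sum_mono)
        fix i j assume ij: "i \<in> {..<n}" "j \<in> {..<n}"
        show "(if sqrt D < \<bar>?zz i j\<bar> then \<bar>?zz i j\<bar> * ?mean i j else 0) \<le> sqrt D / real n * ((of_int (z i))\<^sup>2 * (of_int (z j))\<^sup>2)"
        proof (cases "sqrt D < \<bar>?zz i j\<bar>")
          case True
          have "\<bar>?zz i j\<bar> * ?mean i j \<le> \<bar>?zz i j\<bar> * (D / real n)"
            using mean_le ij by (intro mult_left_mono) auto
          also have "\<dots> = \<bar>?zz i j\<bar> * sqrt D * (sqrt D / real n)" using D_pos by simp
          also have "\<dots> \<le> \<bar>?zz i j\<bar> * \<bar>?zz i j\<bar> * (sqrt D / real n)"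
            using True D0 by (intro mult_right_mono mult_left_mono) auto
          also have "\<dots> = sqrt D / real n * ((of_int (z i))\<^sup>2 * (of_int (z j))\<^sup>2)"
            by (simp add: power2_eq_square algebra_simps)
          finally show ?thesis using True by simp
        qed (use D0 in simp)
      qed
      also have "\<dots> = sqrt D / real n * ((\<Sum>i<n. (of_int (z i))\<^sup>2) * (\<Sum>j<n. (of_int (z j))\<^sup>2))"
        unfolding sum_product unfolding sum_distrib_left ..
      also have "\<dots> = sqrt D / real n * (of_int (\<Sum>i<n. (z i)\<^sup>2))\<^sup>2" by (simp add: power2_eq_square)
      also have "\<dots> \<le> sqrt D / real n * (of_int (16 * int n))\<^sup>2"
        using z D0 by (intro mult_left_mono power_mono) (auto simp del: of_int_sum simp: sum_nonneg)
      also have "\<dots> = 256 * real n * sqrt D" using n3 by (simp add: power2_eq_square)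
      finally show ?thesis .
    qed
    have "bilin n (noise H) (\<lambda>i. of_int (z i)) (\<lambda>i. of_int (z i))
        = (\<Sum>i<n. \<Sum>j<n. light z i j * noise H i j + (if sqrt D < \<bar>?zz i j\<bar> then ?zz i j * noise H i j else 0))"
      unfolding bilin_def by (intro sum.cong refl) (auto simp: light_def)
    also have "\<dots> = (\<Sum>i<n. \<Sum>j<n. light z i j * noise H i j)
        + (\<Sum>i<n. \<Sum>j<n. if sqrt D < \<bar>?zz i j\<bar> then ?zz i j * noise H i j else 0)"
      by (simp only: sum.distrib)
    finally have split: "bilin n (noise H) (\<lambda>i. of_int (z i)) (\<lambda>i. of_int (z i)) = \<dots>" .
    have "\<bar>\<Sum>i<n. \<Sum>j<n. if sqrt D < \<bar>?zz i j\<bar> then ?zz i j * noise H i j else 0\<bar>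
        \<le> (\<Sum>i<n. \<Sum>j<n. \<bar>if sqrt D < \<bar>?zz i j\<bar> then ?zz i j * noise H i j else 0\<bar>)"
      by (rule order_trans[OF sum_abs]) (intro sum_mono sum_abs)
    also have "\<dots> \<le> (\<Sum>i<n. \<Sum>j<n. (if sqrt D < \<bar>?zz i j\<bar> then \<bar>?zz i j\<bar> * adj H i j else 0)
        + (if sqrt D < \<bar>?zz i j\<bar> then \<bar>?zz i j\<bar> * ?mean i j else 0))"
    proof (intro sum_mono)
      fix i j
      have "0 \<le> adj H i j" by (simp add: adj_def weighted_adjacency_nonneg)
      then have "\<bar>noise H i j\<bar> \<le> adj H i j + ?mean i j" using mean0[of i j] unfolding noise_eq by linarith
      then have "\<bar>?zz i j\<bar> * \<bar>noise H i j\<bar> \<le> \<bar>?zz i j\<bar> * (adj H i j + ?mean i j)" by (intro mult_left_mono) auto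
      then show "\<bar>if sqrt D < \<bar>?zz i j\<bar> then ?zz i j * noise H i j else 0\<bar>
        \<le> (if sqrt D < \<bar>?zz i j\<bar> then \<bar>?zz i j\<bar> * adj H i j else 0)
        + (if sqrt D < \<bar>?zz i j\<bar> then \<bar>?zz i j\<bar> * ?mean i j else 0)"
        by (simp add: abs_mult distrib_left)
    qed
    also have "\<dots> = ?hv (adj H) + ?hv ?mean" by (simp only: sum.distrib)
    finally have heavy_noise: "\<bar>\<Sum>i<n. \<Sum>j<n. if sqrt D < \<bar>?zz i j\<bar> then ?zz i j * noise H i j else 0\<bar>
        \<le> ?hv (adj H) + ?hv ?mean" .
    show "\<bar>bilin n (noise H) (\<lambda>i. of_int (z i)) (\<lambda>i. of_int (z i))\<bar> \<le> 8 * noise_norm_const d * real n * sqrt D"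
    proof -
      have "8 * noise_norm_const d * real n * sqrt D = 276 * (real d)\<^sup>2 * real n * sqrt D
          + (heavy_pairs_const (discrepancy_const d) * real n * sqrt D + 256 * real n * sqrt D)"
        by (simp add: noise_norm_const_def algebra_simps)
      then show ?thesis unfolding split using light heavy mean heavy_noise by linarith
    qed
  qed
  moreover have "8 * noise_norm_const d * real n * sqrt D / (8 * real n) = noise_norm_const d * sqrt D" using n3 by simp
  ultimately show ?thesis by simp
qed

text \<open>There is no logarithmic factor in this norm bound. The signal may exceed \<open>sqrt D\<close> by an
  arbitrarily slowly growing factor, so a bound with such a factor, as generic matrix
  concentration inequalities give it, would not suffice.\<close>

theorem prob_noise_norm_large:
  "measure_pmf.prob law {H. \<not> form_bounded n (noise H) (noise_norm_const d * sqrt D)} \<le> 4 / (real n)\<^sup>2"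
proof -
  have "{H. \<not> form_bounded n (noise H) (noise_norm_const d * sqrt D)}
      \<subseteq> {H. \<not> light_good H} \<union> {H. \<not> degree_good H} \<union> {H. \<not> discrepancy_good H}"
    using form_bounded_noise by blast
  then have "measure_pmf.prob law {H. \<not> form_bounded n (noise H) (noise_norm_const d * sqrt D)}
      \<le> measure_pmf.prob law ({H. \<not> light_good H} \<union> {H. \<not> degree_good H} \<union> {H. \<not> discrepancy_good H})"
    by (intro measure_pmf.finite_measure_mono) auto
  also have "\<dots> \<le> measure_pmf.prob law {H. \<not> light_good H} + measure_pmf.prob law {H. \<not> degree_good H}
      + measure_pmf.prob law {H. \<not> discrepancy_good H}"
    by (intro order_trans[OF measure_Un_le] add_right_mono measure_Un_le) auto
  also have "\<dots> \<le> 2 / (real n)\<^sup>2 + 1 / (real n)\<^sup>2 + 1 / (real n)\<^sup>2"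
    by (intro add_mono prob_not_light_good prob_not_degree_good prob_not_discrepancy_good)
  finally show ?thesis by (simp add: add_divide_distrib[symmetric])
qed

end



section \<open>Eigenvectors of a planted block\<close>

definition planted :: "nat set \<Rightarrow> real \<Rightarrow> (nat \<Rightarrow> nat \<Rightarrow> real) \<Rightarrow> nat \<Rightarrow> nat \<Rightarrow> real" where
  "planted S b W i j = (if i \<in> S \<and> j \<in> S \<and> i \<noteq> j then b else 0) + W i j"

definition top_eigenpair :: "nat \<Rightarrow> (nat \<Rightarrow> nat \<Rightarrow> real) \<Rightarrow> (nat \<Rightarrow> real) \<Rightarrow> real \<Rightarrow> bool" where
  "top_eigenpair n M x \<mu> \<longleftrightarrow> norm_upto n x = 1 \<and> (\<forall>i<n. mat_apply n M x i = \<mu> * x i) \<and>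
     (\<forall>y. bilin n M y y \<le> \<mu> * (norm_upto n y)\<^sup>2)"

lemma top_eigenpair_neg:
  assumes "top_eigenpair n M x \<mu>" shows "top_eigenpair n M (\<lambda>i. - x i) \<mu>"
proof -
  have "norm_upto n (\<lambda>i. - x i) = norm_upto n x" by (simp add: L2_set_def)
  moreover have "mat_apply n M (\<lambda>i. - x i) i = - mat_apply n M x i" for i
    by (simp add: mat_apply_def sum_negf)
  ultimately show ?thesis using assms by (simp add: top_eigenpair_def)
qed

lemma symmetric_planted: "symmetric_upto n W \<Longrightarrow> symmetric_upto n (planted S b W)"
  by (auto simp: symmetric_upto_def planted_def)

lemma mat_apply_planted:
  assumes "S \<subseteq> {..<n}"
  shows "mat_apply n (planted S b W) x i = (if i \<in> S then b * ((\<Sum>j\<in>S. x j) - x i) else 0) + mat_apply n W x i"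
proof -
  have fin: "finite S" using assms finite_subset by blast
  have "(\<Sum>j<n. (if i \<in> S \<and> j \<in> S \<and> i \<noteq> j then b else 0) * x j) = (if i \<in> S then b * ((\<Sum>j\<in>S. x j) - x i) else 0)"
  proof (cases "i \<in> S")
    case True
    have "(\<Sum>j<n. (if i \<in> S \<and> j \<in> S \<and> i \<noteq> j then b else 0) * x j) = (\<Sum>j\<in>S - {i}. b * x j)"
      using assms True by (intro sum.mono_neutral_cong_right) auto
    also have "\<dots> = b * ((\<Sum>j\<in>S. x j) - x i)"
      using fin True by (simp add: sum_distrib_left[symmetric] sum_diff1)
    finally show ?thesis using True by simp
  qed simp
  then show ?thesis by (simp add: mat_apply_def planted_def distrib_right sum.distrib)
qed

lemma bilin_planted:
  assumes "S \<subseteq> {..<n}"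
  shows "bilin n (planted S b W) x x = b * ((\<Sum>j\<in>S. x j)\<^sup>2 - (\<Sum>j\<in>S. (x j)\<^sup>2)) + bilin n W x x"
proof -
  have "(\<Sum>i<n. x i * (if i \<in> S then b * ((\<Sum>j\<in>S. x j) - x i) else 0)) = (\<Sum>i\<in>S. b * ((\<Sum>j\<in>S. x j) * x i - (x i)\<^sup>2))"
    using assms by (intro sum.mono_neutral_cong_right) (auto simp: power2_eq_square algebra_simps)
  also have "\<dots> = b * ((\<Sum>j\<in>S. x j) * (\<Sum>i\<in>S. x i) - (\<Sum>j\<in>S. (x j)\<^sup>2))"
    by (simp only: sum_distrib_left[symmetric] sum_subtractf)
  finally show ?thesis
    unfolding bilin_eq_inner inner_upto_def
    by (simp add: mat_apply_planted[OF assms] distrib_left sum.distrib power2_eq_square)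
qed

definition indicator_vector :: "nat set \<Rightarrow> nat \<Rightarrow> real" where "indicator_vector S i = of_bool (i \<in> S)"

lemma inner_indicator_vector: "S \<subseteq> {..<n} \<Longrightarrow> inner_upto n (indicator_vector S) x = (\<Sum>j\<in>S. x j)"
  unfolding inner_upto_def indicator_vector_def by (rule sum.mono_neutral_cong_right) auto

lemma norm_indicator_vector_sq: "S \<subseteq> {..<n} \<Longrightarrow> (norm_upto n (indicator_vector S))\<^sup>2 = real (card S)"
  unfolding norm_upto_sq_inner by (subst inner_indicator_vector) (auto simp: indicator_vector_def)

text \<open>The number \<open>\<gamma>\<close> is the largest eigenvalue of the planted block alone; noise is measured relative
  to it.\<close>

locale planted_set =
  fixes n :: nat and S :: "nat set" and k :: nat and b \<gamma> \<epsilon> :: real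
  assumes S: "S \<subseteq> {..<n}" and card_S: "card S = k" and b0: "0 < b" and \<gamma>: "\<gamma> = b * (real k - 1)"
    and \<epsilon>0: "0 < \<epsilon>" and \<epsilon>16: "\<epsilon> \<le> 1 / 16" and k_large: "1 \<le> \<epsilon> * real k"
begin

lemma k16: "16 \<le> real k"
  using k_large \<epsilon>16 \<epsilon>0 mult_right_mono[of \<epsilon> "1 / 16" "real k"] by simp

lemma \<gamma>_pos: "0 < \<gamma>" unfolding \<gamma> using b0 k16 by simp

lemma bk_le: "b * real k \<le> 2 * \<gamma>"
proof -
  have "b * real k \<le> b * (2 * (real k - 1))" using b0 k16 by (intro mult_left_mono) auto
  then show ?thesis by (simp add: \<gamma> algebra_simps)
qed

text \<open>Testing the Rayleigh quotient with the indicator of \<open>S\<close> bounds the top eigenvalue from below. At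
  the top eigenvector itself the block contributes at most \<open>b\<close> times the squared sum over \<open>S\<close>, so
  this sum must be nearly as large as Cauchy-Schwarz permits.\<close>

lemma top_eigenpair_alignment:
  assumes W: "form_bounded n W (\<epsilon> * \<gamma>)" and top: "top_eigenpair n (planted S b W) x \<mu>"
  shows "(1 - \<epsilon>) * \<gamma> \<le> \<mu>" and "\<mu> \<le> b * real k + \<epsilon> * \<gamma>"
    and "(1 - 3 * \<epsilon>) * real k \<le> (\<Sum>j\<in>S. x j)\<^sup>2" and "(\<Sum>j\<in>S. x j)\<^sup>2 \<le> real k"
proof -
  let ?s = "\<Sum>j\<in>S. x j"
  have nx: "norm_upto n x = 1" and eig: "\<And>i. i < n \<Longrightarrow> mat_apply n (planted S b W) x i = \<mu> * x i"
    and ray: "\<And>y. bilin n (planted S b W) y y \<le> \<mu> * (norm_upto n y)\<^sup>2"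
    using top by (auto simp: top_eigenpair_def)
  have nind: "(norm_upto n (indicator_vector S))\<^sup>2 = real k" using norm_indicator_vector_sq[OF S] card_S by simp
  have "b * ((real k)\<^sup>2 - real k) + bilin n W (indicator_vector S) (indicator_vector S) \<le> \<mu> * real k"
    using ray[of "indicator_vector S"] unfolding bilin_planted[OF S] nind by (simp add: indicator_vector_def card_S)
  moreover have "\<bar>bilin n W (indicator_vector S) (indicator_vector S)\<bar> \<le> \<epsilon> * \<gamma> * real k"
    using form_boundedD[OF W, of "indicator_vector S"] nind by simp
  moreover have "b * ((real k)\<^sup>2 - real k) = \<gamma> * real k" by (simp add: \<gamma> power2_eq_square algebra_simps)
  ultimately have "((1 - \<epsilon>) * \<gamma>) * real k \<le> \<mu> * real k" by (simp add: algebra_simps)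
  then show lower: "(1 - \<epsilon>) * \<gamma> \<le> \<mu>" using k16 by simp
  have "\<bar>?s\<bar> \<le> norm_upto n (indicator_vector S) * norm_upto n x"
    using inner_upto_le_norm[of n "indicator_vector S" x] by (simp add: inner_indicator_vector[OF S])
  then have "\<bar>?s\<bar>\<^sup>2 \<le> (norm_upto n (indicator_vector S))\<^sup>2" using nx by (intro power_mono) auto
  then show s_le: "?s\<^sup>2 \<le> real k" using nind by simp
  have "\<mu> = bilin n (planted S b W) x x"
  proof -
    have "bilin n (planted S b W) x x = inner_upto n x (\<lambda>i. \<mu> * x i)"
      unfolding bilin_eq_inner by (rule inner_upto_cong) (auto simp: eig)
    then show ?thesis using nx norm_upto_sq_inner[of x n] by (simp add: inner_upto_linear)
  qed
  also have "\<dots> = b * (?s\<^sup>2 - (\<Sum>j\<in>S. (x j)\<^sup>2)) + bilin n W x x" by (rule bilin_planted[OF S])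
  also have "\<dots> \<le> b * ?s\<^sup>2 + \<epsilon> * \<gamma>"
  proof (rule add_mono)
    show "b * (?s\<^sup>2 - (\<Sum>j\<in>S. (x j)\<^sup>2)) \<le> b * ?s\<^sup>2" using b0 by (simp add: sum_nonneg)
    show "bilin n W x x \<le> \<epsilon> * \<gamma>" using form_boundedD[OF W, of x] nx by simp
  qed
  finally have upper: "\<mu> \<le> b * ?s\<^sup>2 + \<epsilon> * \<gamma>" .
  also have "\<dots> \<le> b * real k + \<epsilon> * \<gamma>" using s_le b0 by simp
  finally show "\<mu> \<le> b * real k + \<epsilon> * \<gamma>" .
  have "b * ((1 - 2 * \<epsilon>) * (real k - 1)) \<le> b * ?s\<^sup>2"
    using lower upper by (simp add: \<gamma> algebra_simps)
  then have "(1 - 2 * \<epsilon>) * (real k - 1) \<le> ?s\<^sup>2" using b0 by simp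
  moreover have "(1 - 2 * \<epsilon>) * (real k - \<epsilon> * real k) \<le> (1 - 2 * \<epsilon>) * (real k - 1)"
    using k_large \<epsilon>16 by (intro mult_left_mono) auto
  moreover have "(1 - 3 * \<epsilon>) * real k \<le> (1 - 2 * \<epsilon>) * (real k - \<epsilon> * real k)"
    using \<epsilon>0 by (simp add: algebra_simps)
  ultimately show "(1 - 3 * \<epsilon>) * real k \<le> ?s\<^sup>2" by linarith
qed

text \<open>Both vectors are close to the normalized indicator of \<open>S\<close>, hence to each other. This excludes
  that two eigenvectors are nearly opposite.\<close>

lemma top_eigenpairs_inner_nonneg:
  assumes W: "form_bounded n W (\<epsilon> * \<gamma>)" "form_bounded n W' (\<epsilon> * \<gamma>)"
    and top: "top_eigenpair n (planted S b W) x \<mu>" "top_eigenpair n (planted S b W') x' \<mu>'"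
    and sgn: "0 \<le> (\<Sum>j\<in>S. x j)" "0 \<le> (\<Sum>j\<in>S. x' j)"
  shows "0 \<le> inner_upto n x x'"
proof -
  define s where "s = (\<Sum>j\<in>S. x j)"
  define s' where "s' = (\<Sum>j\<in>S. x' j)"
  have al: "(1 - 3 * \<epsilon>) * real k \<le> s\<^sup>2" "(1 - 3 * \<epsilon>) * real k \<le> s'\<^sup>2"
    unfolding s_def s'_def using top_eigenpair_alignment(3)[OF W(1) top(1)] top_eigenpair_alignment(3)[OF W(2) top(2)] .
  have k0: "0 < real k" using k16 by simp
  have nx: "inner_upto n x x = 1" "inner_upto n x' x' = 1"
    using top norm_upto_sq_inner[of x n] norm_upto_sq_inner[of x' n] by (auto simp: top_eigenpair_def)
  have ii: "inner_upto n (indicator_vector S) (indicator_vector S) = real k"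
    using norm_indicator_vector_sq[OF S] card_S by (simp add: norm_upto_sq_inner)
  have inds: "inner_upto n (indicator_vector S) x = s" "inner_upto n (indicator_vector S) x' = s'"
    by (simp_all add: inner_indicator_vector[OF S] s_def s'_def)
  have si: "inner_upto n x (indicator_vector S) = s" "inner_upto n x' (indicator_vector S) = s'"
    using inds by (simp_all add: inner_upto_commute)
  define y where "y = (\<lambda>i. x i - (s / real k) * indicator_vector S i)"
  define y' where "y' = (\<lambda>i. x' i - (s' / real k) * indicator_vector S i)"
  have ny: "(norm_upto n y)\<^sup>2 = 1 - s\<^sup>2 / real k" "(norm_upto n y')\<^sup>2 = 1 - s'\<^sup>2 / real k"
    unfolding norm_upto_sq_inner y_def y'_def inner_upto_linear ii inds si nx
    using k0 by (simp_all add: power2_eq_square)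
  have small: "(norm_upto n y)\<^sup>2 \<le> 3 * \<epsilon>" "(norm_upto n y')\<^sup>2 \<le> 3 * \<epsilon>"
    unfolding ny using al k0 by (simp_all add: field_simps)
  have "norm_upto n y * norm_upto n y' \<le> ((norm_upto n y)\<^sup>2 + (norm_upto n y')\<^sup>2) / 2"
    using sum_squares_bound[of "norm_upto n y" "norm_upto n y'"] by simp
  also have "\<dots> \<le> 3 * \<epsilon>" using small by simp
  finally have "\<bar>inner_upto n y y'\<bar> \<le> 3 * \<epsilon>" using inner_upto_le_norm[of n y y'] by linarith
  moreover have "inner_upto n y y' = inner_upto n x x' - s * s' / real k"
    unfolding y_def y'_def inner_upto_linear ii inds si using k0 by simp
  moreover have "(1 - 3 * \<epsilon>) \<le> s * s' / real k"
  proof -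
    have "((1 - 3 * \<epsilon>) * real k)\<^sup>2 \<le> s\<^sup>2 * s'\<^sup>2"
      unfolding power2_eq_square[of "(1 - 3 * \<epsilon>) * real k"] using al \<epsilon>16 k0 by (intro mult_mono) auto
    then have "((1 - 3 * \<epsilon>) * real k)\<^sup>2 \<le> (s * s')\<^sup>2" by (simp add: power_mult_distrib)
    then have "(1 - 3 * \<epsilon>) * real k \<le> s * s'"
      by (rule power2_le_imp_le) (use sgn in \<open>simp add: s_def s'_def\<close>)
    then show ?thesis using k0 by (simp add: field_simps)
  qed
  ultimately show ?thesis using \<epsilon>16 by linarith
qed

text \<open>A perturbation bound in which only the action of the difference on \<open>x'\<close> counts. Let \<open>r\<close> be the
  component of \<open>x'\<close> orthogonal to \<open>x\<close>. On one hand the Rayleigh quotient at \<open>r\<close> is at most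
  \<open>7 * \<epsilon> * \<gamma>\<close>, because \<open>r\<close> is nearly orthogonal to the indicator of \<open>S\<close>. On the other hand
  \<open>r\<close> satisfies the eigenvalue equation at \<open>\<mu>'\<close>, which is at least \<open>(1 - \<epsilon>) * \<gamma>\<close>, up to the error that the
  difference of the two matrices makes on \<open>x'\<close>.\<close>

lemma top_eigenpair_stability:
  assumes W: "form_bounded n W (\<epsilon> * \<gamma>)" "form_bounded n W' (\<epsilon> * \<gamma>)"
    and top: "top_eigenpair n (planted S b W) x \<mu>" "top_eigenpair n (planted S b W') x' \<mu>'"
    and sgn: "0 \<le> (\<Sum>j\<in>S. x j)" "0 \<le> (\<Sum>j\<in>S. x' j)"
  shows "norm_upto n (\<lambda>i. x i - x' i) \<le> 4 * norm_upto n (mat_apply n (\<lambda>i j. W i j - W' i j) x') / \<gamma>"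
proof -
  define s where "s = (\<Sum>j\<in>S. x j)"
  define a where "a = inner_upto n x' x"
  define r where "r = (\<lambda>i. x' i - a * x i)"
  let ?M = "planted S b W"
  let ?\<Delta> = "mat_apply n (\<lambda>i j. W i j - W' i j) x'"
  have nx: "inner_upto n x x = 1" "inner_upto n x' x' = 1"
    using top norm_upto_sq_inner[of x n] norm_upto_sq_inner[of x' n] by (auto simp: top_eigenpair_def)
  have eig: "\<And>i. i < n \<Longrightarrow> mat_apply n ?M x i = \<mu> * x i"
    "\<And>i. i < n \<Longrightarrow> mat_apply n (planted S b W') x' i = \<mu>' * x' i"
    using top by (auto simp: top_eigenpair_def)
  have \<mu>': "(1 - \<epsilon>) * \<gamma> \<le> \<mu>'" by (rule top_eigenpair_alignment(1)[OF W(2) top(2)])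
  have a0: "0 \<le> a" using top_eigenpairs_inner_nonneg[OF W top sgn] by (simp add: a_def inner_upto_commute)
  have rx: "inner_upto n r x = 0" "inner_upto n r x' = 1 - a\<^sup>2"
    using inner_upto_commute[of n x x']
    unfolding r_def inner_upto_linear nx by (simp_all add: a_def power2_eq_square)
  have rr: "(norm_upto n r)\<^sup>2 = 1 - a\<^sup>2"
    using rx unfolding norm_upto_sq_inner by (subst (2) r_def) (simp add: inner_upto_linear)
  have Mr: "mat_apply n ?M r i = \<mu>' * x' i + ?\<Delta> i - (a * \<mu>) * x i" if "i < n" for i
  proof -
    have "mat_apply n ?M x' i = mat_apply n (planted S b W') x' i + ?\<Delta> i"
      by (simp add: mat_apply_def planted_def sum.distrib[symmetric] algebra_simps)
    then show ?thesis using eig that unfolding r_def mat_apply_linear by simp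
  qed
  have "bilin n ?M r r = inner_upto n r (\<lambda>i. \<mu>' * x' i + ?\<Delta> i - (a * \<mu>) * x i)"
    unfolding bilin_eq_inner by (rule inner_upto_cong) (auto simp: Mr)
  also have "\<dots> = \<mu>' * (norm_upto n r)\<^sup>2 + inner_upto n r ?\<Delta>"
    unfolding inner_upto_linear rx rr by simp
  finally have 1: "\<mu>' * (norm_upto n r)\<^sup>2 = bilin n ?M r r - inner_upto n r ?\<Delta>" by simp
  have 2: "bilin n ?M r r \<le> 7 * \<epsilon> * \<gamma> * (norm_upto n r)\<^sup>2"
  proof -
    define y where "y = (\<lambda>i. indicator_vector S i - s * x i)"
    have ii: "inner_upto n (indicator_vector S) (indicator_vector S) = real k" "inner_upto n (indicator_vector S) x = s" "inner_upto n x (indicator_vector S) = s"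
      using norm_indicator_vector_sq[OF S] card_S by (simp_all add: norm_upto_sq_inner inner_indicator_vector[OF S] s_def inner_upto_commute[of n x])
    have "(norm_upto n y)\<^sup>2 = real k - s\<^sup>2"
      unfolding norm_upto_sq_inner y_def inner_upto_linear ii nx by (simp add: power2_eq_square)
    then have ny: "(norm_upto n y)\<^sup>2 \<le> 3 * \<epsilon> * real k"
      using top_eigenpair_alignment(3)[OF W(1) top(1)] by (simp add: s_def algebra_simps)
    have "(\<Sum>j\<in>S. r j) = inner_upto n y r"
      using rx(1) unfolding y_def inner_upto_linear inner_indicator_vector[OF S] by (simp add: inner_upto_commute)
    then have "\<bar>\<Sum>j\<in>S. r j\<bar> \<le> norm_upto n y * norm_upto n r" using inner_upto_le_norm[of n y r] by simp
    then have "\<bar>\<Sum>j\<in>S. r j\<bar>\<^sup>2 \<le> (norm_upto n y * norm_upto n r)\<^sup>2" by (intro power_mono) auto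
    also have "\<dots> \<le> 3 * \<epsilon> * real k * (norm_upto n r)\<^sup>2"
      unfolding power_mult_distrib using ny by (intro mult_right_mono) auto
    finally have "b * (\<Sum>j\<in>S. r j)\<^sup>2 \<le> b * (3 * \<epsilon> * real k * (norm_upto n r)\<^sup>2)"
      using b0 by (intro mult_left_mono) auto
    also have "\<dots> = (3 * \<epsilon> * (norm_upto n r)\<^sup>2) * (b * real k)" by simp
    also have "\<dots> \<le> (3 * \<epsilon> * (norm_upto n r)\<^sup>2) * (2 * \<gamma>)" using \<epsilon>0 by (intro mult_left_mono bk_le) auto
    finally have "b * (\<Sum>j\<in>S. r j)\<^sup>2 \<le> 6 * \<epsilon> * \<gamma> * (norm_upto n r)\<^sup>2" by (simp add: mult_ac)
    moreover have "0 \<le> b * (\<Sum>j\<in>S. (r j)\<^sup>2)" using b0 by (simp add: sum_nonneg)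
    moreover have "\<bar>bilin n W r r\<bar> \<le> \<epsilon> * \<gamma> * (norm_upto n r)\<^sup>2" by (rule form_boundedD[OF W(1)])
    ultimately show ?thesis unfolding bilin_planted[OF S] right_diff_distrib by linarith
  qed
  have 3: "- inner_upto n r ?\<Delta> \<le> norm_upto n r * norm_upto n ?\<Delta>"
    using inner_upto_le_norm[of n r ?\<Delta>] by linarith
  have "(1 - \<epsilon>) * \<gamma> * (norm_upto n r)\<^sup>2 \<le> \<mu>' * (norm_upto n r)\<^sup>2"
    using \<mu>' by (intro mult_right_mono) auto
  then have "(1 - 8 * \<epsilon>) * \<gamma> * (norm_upto n r)\<^sup>2 \<le> norm_upto n r * norm_upto n ?\<Delta>"
    using 1 2 3 by (simp add: algebra_simps)
  moreover have "(1 / 2) * \<gamma> * (norm_upto n r)\<^sup>2 \<le> (1 - 8 * \<epsilon>) * \<gamma> * (norm_upto n r)\<^sup>2"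
    using \<epsilon>16 \<gamma>_pos by (intro mult_right_mono) auto
  ultimately have le: "norm_upto n r * (norm_upto n r * \<gamma>) \<le> norm_upto n r * (2 * norm_upto n ?\<Delta>)"
    by (simp add: power2_eq_square algebra_simps)
  have nr: "norm_upto n r * \<gamma> \<le> 2 * norm_upto n ?\<Delta>"
  proof (cases "norm_upto n r = 0")
    case True
    then show ?thesis by (simp add: L2_set_nonneg)
  next
    case False
    then have "0 < norm_upto n r" using L2_set_nonneg[of r "{..<n}"] by linarith
    then show ?thesis using le by simp
  qed
  have "(norm_upto n (\<lambda>i. x i - x' i))\<^sup>2 = 2 - 2 * a"
    unfolding norm_upto_sq_inner inner_upto_linear nx using inner_upto_commute[of n x x'] by (simp add: a_def)
  also have "\<dots> \<le> 4 * (1 - a\<^sup>2)"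
  proof -
    have "a\<^sup>2 \<le> 1" using rr zero_le_power2[of "norm_upto n r"] by linarith
    then have "a \<le> 1" using a0 by (simp add: power_le_one_iff abs_square_le_1)
    then have "0 \<le> (1 - a) * (1 + 2 * a)" using a0 by (intro mult_nonneg_nonneg) auto
    then show ?thesis by (simp add: power2_eq_square algebra_simps)
  qed
  also have "\<dots> = (2 * norm_upto n r)\<^sup>2" by (simp add: rr power_mult_distrib)
  finally have "norm_upto n (\<lambda>i. x i - x' i) \<le> 2 * norm_upto n r"
    by (rule power2_le_imp_le) (simp add: L2_set_nonneg)
  also have "\<dots> \<le> 4 * norm_upto n ?\<Delta> / \<gamma>" using nr \<gamma>_pos by (simp add: field_simps)
  finally show ?thesis .
qed

end

text \<open>A top eigenvector \<open>x\<close> after the noise has been modified near the vertex \<open>i\<close>, with the bound that a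
  modification of only the hyperedges through \<open>i\<close> gives for its effect on \<open>x\<close>.\<close>

definition leave_one_out :: "nat \<Rightarrow> nat set \<Rightarrow> real \<Rightarrow> real \<Rightarrow> (nat \<Rightarrow> nat \<Rightarrow> real) \<Rightarrow> nat \<Rightarrow> (nat \<Rightarrow> real) \<Rightarrow> bool" where
  "leave_one_out n S b \<tau> W i x \<longleftrightarrow> (\<exists>W' \<mu>'.
     form_bounded n W' (4 * \<tau>) \<and> top_eigenpair n (planted S b W') x \<mu>' \<and> 0 \<le> (\<Sum>j\<in>S. x j) \<and>
     norm_upto n (mat_apply n (\<lambda>i j. W i j - W' i j) x)
       \<le> \<bar>mat_apply n W x i\<bar> + \<tau> * \<bar>x i\<bar> + \<tau> / sqrt (real (card S)))"

text \<open>The eigenvalue equation expresses \<open>u l\<close> by the \<open>l\<close>-th entry of \<open>W u\<close>, up to an explicit multiple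
  of the indicator of \<open>S\<close>. To bound this entry, \<open>u\<close> is compared with the leave-one-out vector \<open>x\<close>
  of \<open>l\<close>. By stability their distance \<open>\<delta>\<close> is at most a small multiple of \<open>\<kappa> + U + \<delta>\<close>, where \<open>U\<close> is
  the largest entry of \<open>u\<close> and \<open>\<kappa>\<close> the size of the entries of the normalized indicator, and the
  entry of \<open>W x\<close> is small by hypothesis. So all entries of \<open>W u\<close> are at most a small multiple of
  \<open>\<kappa> + U\<close>. The eigenvalue equation then first yields that \<open>U\<close> itself is at most \<open>3 * \<kappa>\<close>, and with
  this bound that the entries of \<open>u\<close> are at least \<open>7 / 10 * \<kappa>\<close> on \<open>S\<close> and at most \<open>2 / 10 * \<kappa>\<close>
  elsewhere, up to a common sign and in absolute value, respectively.\<close>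

lemma planted_entries_separate:
  assumes S: "S \<subseteq> {..<n}" and card_S: "card S = k" and b: "0 < b" and \<gamma>: "\<gamma> = b * (real k - 1)"
    and \<epsilon>: "0 < \<epsilon>" "\<epsilon> \<le> 1 / 100" and k_large: "1 \<le> \<epsilon> * real k"
    and sym: "symmetric_upto n W" and W: "form_bounded n W (\<epsilon> * \<gamma>)"
    and top: "top_eigenpair n (planted S b W) u \<mu>"
    and loo: "\<And>i. i < n \<Longrightarrow> \<exists>x. leave_one_out n S b (\<epsilon> * \<gamma>) W i x \<and>
       (\<forall>v. (\<forall>j<n. \<bar>x j\<bar> \<le> v) \<longrightarrow> \<bar>mat_apply n W x i\<bar> \<le> \<epsilon> * \<gamma> * (1 / sqrt (real k) + v))"
    and ij: "i \<in> S" "j \<in> {..<n} - S"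
  shows "\<bar>u j\<bar> < \<bar>u i\<bar>"
proof -
  \<comment> \<open>flipping the sign of the eigenvector does not matter for the claim\<close>
  define w where "w = (if 0 \<le> (\<Sum>j\<in>S. u j) then u else (\<lambda>i. - u i))"
  have topw: "top_eigenpair n (planted S b W) w \<mu>"
    using top top_eigenpair_neg[OF top] by (simp add: w_def)
  have sgnw: "0 \<le> (\<Sum>j\<in>S. w j)" by (simp add: w_def sum_negf)
  have absw: "\<bar>w l\<bar> = \<bar>u l\<bar>" for l by (simp add: w_def)
  interpret tight: planted_set n S k b \<gamma> \<epsilon>
    by unfold_locales (use S card_S b \<gamma> \<epsilon> k_large in auto)
  interpret loose: planted_set n S k b \<gamma> "4 * \<epsilon>"
    by unfold_locales (use S card_S b \<gamma> \<epsilon> k_large in auto)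
  define \<kappa> where "\<kappa> = 1 / sqrt (real k)"
  have \<gamma>0: "0 < \<gamma>" by (rule tight.\<gamma>_pos)
  have k16: "16 \<le> real k" by (rule tight.k16)
  then have \<kappa>0: "0 < \<kappa>" by (simp add: \<kappa>_def)
  have W4: "form_bounded n W (4 * \<epsilon> * \<gamma>)"
    unfolding form_bounded_def
  proof
    fix x
    have "\<bar>bilin n W x x\<bar> \<le> \<epsilon> * \<gamma> * (norm_upto n x)\<^sup>2" by (rule form_boundedD[OF W])
    also have "\<dots> \<le> 4 * \<epsilon> * \<gamma> * (norm_upto n x)\<^sup>2" using \<epsilon> \<gamma>0 by (intro mult_right_mono) auto
    finally show "\<bar>bilin n W x x\<bar> \<le> 4 * \<epsilon> * \<gamma> * (norm_upto n x)\<^sup>2" .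
  qed
  define U where "U = Max ((\<lambda>l. \<bar>w l\<bar>) ` {..<n})"
  have n0: "{..<n} \<noteq> {}" using ij by blast
  have U: "\<bar>w l\<bar> \<le> U" if "l < n" for l unfolding U_def using that by (intro Max_ge) auto
  have U0: "0 \<le> U" using U[of j] ij by (meson DiffD1 abs_ge_zero lessThan_iff order_trans)
  have Ww: "\<bar>mat_apply n W w l\<bar> \<le> 2 * \<epsilon> * \<gamma> * (\<kappa> + U)" if l: "l < n" for l
  proof -
    obtain x W' \<mu>' where W': "form_bounded n W' (4 * (\<epsilon> * \<gamma>))" and topx: "top_eigenpair n (planted S b W') x \<mu>'"
      and sgnx: "0 \<le> (\<Sum>j\<in>S. x j)"
      and \<Delta>: "norm_upto n (mat_apply n (\<lambda>i j. W i j - W' i j) x)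
         \<le> \<bar>mat_apply n W x l\<bar> + \<epsilon> * \<gamma> * \<bar>x l\<bar> + \<epsilon> * \<gamma> / sqrt (real (card S))"
      and g: "\<And>v. (\<forall>j<n. \<bar>x j\<bar> \<le> v) \<Longrightarrow> \<bar>mat_apply n W x l\<bar> \<le> \<epsilon> * \<gamma> * (1 / sqrt (real k) + v)"
      using loo[OF l] unfolding leave_one_out_def by blast
    define \<delta> where "\<delta> = norm_upto n (\<lambda>i. w i - x i)"
    have \<delta>0: "0 \<le> \<delta>" by (simp add: \<delta>_def L2_set_nonneg)
    have xle: "\<bar>x m\<bar> \<le> U + \<delta>" if "m < n" for m
      using U[OF that] abs_le_norm_upto[OF that, of "\<lambda>i. w i - x i"] unfolding \<delta>_def by linarith
    have g': "\<bar>mat_apply n W x l\<bar> \<le> \<epsilon> * \<gamma> * (\<kappa> + (U + \<delta>))"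
      unfolding \<kappa>_def by (rule g) (simp add: xle)
    have xl: "\<epsilon> * \<gamma> * \<bar>x l\<bar> \<le> \<epsilon> * \<gamma> * (U + \<delta>)" using xle[OF l] \<epsilon> \<gamma>0 by (intro mult_left_mono) auto
    have "norm_upto n (mat_apply n (\<lambda>i j. W i j - W' i j) x) \<le> 2 * (\<epsilon> * \<gamma>) * (\<kappa> + (U + \<delta>))"
    proof -
      have "\<epsilon> * \<gamma> / sqrt (real (card S)) = \<epsilon> * \<gamma> * \<kappa>" by (simp add: \<kappa>_def card_S)
      moreover have "2 * (\<epsilon> * \<gamma>) * (\<kappa> + (U + \<delta>)) = \<epsilon> * \<gamma> * (\<kappa> + (U + \<delta>)) + \<epsilon> * \<gamma> * (U + \<delta>) + \<epsilon> * \<gamma> * \<kappa>"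
        by (simp add: algebra_simps)
      ultimately show ?thesis using \<Delta> g' xl by linarith
    qed
    moreover have "\<delta> \<le> 4 * norm_upto n (mat_apply n (\<lambda>i j. W i j - W' i j) x) / \<gamma>"
      unfolding \<delta>_def
      by (rule loose.top_eigenpair_stability[OF W4 _ topw topx sgnw sgnx]) (use W' in \<open>simp add: mult.assoc\<close>)
    ultimately have "\<delta> \<le> 4 * (2 * (\<epsilon> * \<gamma>) * (\<kappa> + (U + \<delta>))) / \<gamma>"
      using \<gamma>0 by (meson divide_right_mono less_imp_le mult_left_mono order_trans zero_le_numeral)
    also have "\<dots> = 8 * \<epsilon> * (\<kappa> + (U + \<delta>))" using \<gamma>0 by simp
    also have "\<dots> = 8 * \<epsilon> * (\<kappa> + U) + 8 * \<epsilon> * \<delta>" by (simp add: algebra_simps)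
    finally have "\<delta> \<le> 8 * \<epsilon> * (\<kappa> + U) + 8 * \<epsilon> * \<delta>" .
    moreover have "8 * \<epsilon> * \<delta> \<le> (8 / 100) * \<delta>" using \<epsilon> \<delta>0 by (intro mult_right_mono) auto
    ultimately have "\<delta> \<le> 16 * \<epsilon> * (\<kappa> + U)" using \<delta>0 by (simp add: algebra_simps)
    also have "\<dots> \<le> 16 / 100 * (\<kappa> + U)" using \<epsilon> \<kappa>0 U0 by (intro mult_right_mono) auto
    finally have \<delta>: "2 * \<delta> \<le> \<kappa> + U" using \<kappa>0 U0 by simp
    have "\<bar>mat_apply n W (\<lambda>i. w i - x i) l\<bar> \<le> norm_upto n (mat_apply n W (\<lambda>i. w i - x i))"
      by (rule abs_le_norm_upto[OF l])
    also have "\<dots> \<le> \<epsilon> * \<gamma> * \<delta>" unfolding \<delta>_def by (rule form_bounded_mat_apply[OF sym W])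
    finally have "\<bar>mat_apply n W w l - mat_apply n W x l\<bar> \<le> \<epsilon> * \<gamma> * \<delta>" by (simp add: mat_apply_linear)
    then have "\<bar>mat_apply n W w l\<bar> \<le> \<epsilon> * \<gamma> * (\<kappa> + (U + \<delta>)) + \<epsilon> * \<gamma> * \<delta>" using g' by linarith
    also have "\<dots> = \<epsilon> * \<gamma> * (\<kappa> + U + 2 * \<delta>)" by (simp add: algebra_simps)
    also have "\<dots> \<le> \<epsilon> * \<gamma> * (\<kappa> + U + (\<kappa> + U))" using \<delta> \<epsilon> \<gamma>0 by (intro mult_left_mono) auto
    finally show ?thesis by (simp add: algebra_simps)
  qed
  define s where "s = (\<Sum>j\<in>S. w j)"
  note align = tight.top_eigenpair_alignment[OF W topw, folded s_def]
  have \<mu>_half: "\<gamma> / 2 \<le> \<mu>"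
  proof -
    have "(1 / 2) * \<gamma> \<le> (1 - \<epsilon>) * \<gamma>" using \<epsilon> \<gamma>0 by (intro mult_right_mono) auto
    then show ?thesis using align(1) by simp
  qed
  have \<mu>0: "0 < \<mu>" using \<mu>_half \<gamma>0 by linarith
  have eig: "(if l \<in> S then b * (s - w l) else 0) + mat_apply n W w l = \<mu> * w l" if "l < n" for l
    using topw that mat_apply_planted[OF S, of b W w l] by (auto simp: top_eigenpair_def s_def)
  have noise: "2 * \<epsilon> * \<gamma> * (\<kappa> + U) \<le> \<mu> * (4 * \<epsilon> * (\<kappa> + U))"
    using mult_right_mono[OF \<mu>_half, of "4 * \<epsilon> * (\<kappa> + U)"] \<epsilon> \<kappa>0 U0 by (simp add: algebra_simps)
  have out: "\<bar>w l\<bar> \<le> 4 * \<epsilon> * (\<kappa> + U)" if "l < n" "l \<notin> S" for l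
  proof -
    have "\<mu> * \<bar>w l\<bar> = \<bar>mat_apply n W w l\<bar>" using eig[OF that(1)] that(2) \<mu>0 by (simp add: abs_mult)
    also have "\<dots> \<le> \<mu> * (4 * \<epsilon> * (\<kappa> + U))" using Ww[OF that(1)] noise by linarith
    finally show ?thesis using \<mu>0 by simp
  qed
  \<comment> \<open>the common value on \<open>S\<close> if there were no noise term\<close>
  define t where "t = b * s / (\<mu> + b)"
  have inside: "\<bar>w l - t\<bar> \<le> 4 * \<epsilon> * (\<kappa> + U)" if "l \<in> S" for l
  proof -
    have l: "l < n" using that S by auto
    have "(\<mu> + b) * t = b * s" using \<mu>0 b by (simp add: t_def)
    then have "(\<mu> + b) * (w l - t) = mat_apply n W w l"
      using eig[OF l] that by (simp add: algebra_simps)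
    then have "(\<mu> + b) * \<bar>w l - t\<bar> = \<bar>mat_apply n W w l\<bar>" using \<mu>0 b by (metis abs_mult abs_of_pos add_pos_pos)
    also have "\<dots> \<le> \<mu> * (4 * \<epsilon> * (\<kappa> + U))" using Ww[OF l] noise by linarith
    also have "\<dots> \<le> (\<mu> + b) * (4 * \<epsilon> * (\<kappa> + U))" using b \<epsilon> \<kappa>0 U0 by (intro mult_right_mono) auto
    finally show ?thesis using \<mu>0 b by simp
  qed
  have s_le: "s \<le> sqrt (real k)" using align(4) by (rule real_le_rsqrt)
  have k\<kappa>: "real k * \<kappa> = sqrt (real k)" using k16 by (simp add: \<kappa>_def real_div_sqrt)
  have t_upper: "t \<le> 2 * \<kappa>"
  proof -
    have "b * real k \<le> 2 * (\<mu> + b)"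
    proof -
      have "\<gamma> * (1 / 2) \<le> \<mu>" using \<mu>_half by simp
      then show ?thesis using b unfolding \<gamma> by (simp add: algebra_simps)
    qed
    then have "b * real k * \<kappa> \<le> 2 * (\<mu> + b) * \<kappa>" using \<kappa>0 by (intro mult_right_mono) auto
    then have "b * sqrt (real k) \<le> 2 * \<kappa> * (\<mu> + b)" using k\<kappa> by (simp add: mult.assoc) (simp add: mult.commute mult.left_commute)
    moreover have "b * s \<le> b * sqrt (real k)" using s_le b by simp
    ultimately have "b * s \<le> 2 * \<kappa> * (\<mu> + b)" by linarith
    then show ?thesis unfolding t_def using \<mu>0 b by (simp add: divide_le_eq)
  qed
  have t_lower: "9 / 10 * \<kappa> \<le> t"
  proof -
    have "(97 / 100 * sqrt (real k))\<^sup>2 \<le> (1 - 3 * \<epsilon>) * real k"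
    proof -
      have "(97 / 100 * sqrt (real k))\<^sup>2 = (97 / 100)\<^sup>2 * real k" unfolding power_mult_distrib by simp
      also have "\<dots> \<le> (1 - 3 * \<epsilon>) * real k" using \<epsilon> by (intro mult_right_mono) (auto simp: power2_eq_square)
      finally show ?thesis .
    qed
    also have "\<dots> \<le> s\<^sup>2" by (rule align(3))
    finally have s_ge: "97 / 100 * sqrt (real k) \<le> s" by (rule power2_le_imp_le) (use sgnw in \<open>simp add: s_def\<close>)
    have "\<mu> + b \<le> 102 / 100 * (b * real k)"
    proof -
      have "b * 1 \<le> b * (\<epsilon> * real k)" using k_large b by (intro mult_left_mono) auto
      also have "\<dots> = \<epsilon> * (b * real k)" by simp
      also have "\<dots> \<le> 1 / 100 * (b * real k)" using \<epsilon> b by (intro mult_right_mono) auto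
      finally have "b \<le> 1 / 100 * (b * real k)" by simp
      moreover have "\<epsilon> * \<gamma> \<le> 1 / 100 * (b * real k)"
        using \<epsilon> b k16 \<gamma>0 unfolding \<gamma> by (intro mult_mono) auto
      ultimately show ?thesis using align(2) by linarith
    qed
    then have "9 / 10 * \<kappa> * (\<mu> + b) \<le> 9 / 10 * \<kappa> * (102 / 100 * (b * real k))"
      using \<kappa>0 by (intro mult_left_mono) auto
    also have "\<dots> = b * (918 / 1000 * (real k * \<kappa>))" by (simp add: algebra_simps)
    also have "\<dots> \<le> b * s"
    proof (rule mult_left_mono)
      have "0 \<le> sqrt (real k)" by simp
      then show "918 / 1000 * (real k * \<kappa>) \<le> s" unfolding k\<kappa> using s_ge by linarith
    qed (use b in simp)
    finally show ?thesis unfolding t_def using \<mu>0 b by (simp add: le_divide_eq)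
  qed
  \<comment> \<open>the entry-wise errors involve \<open>U\<close>, which they bound in turn\<close>
  have err: "4 * \<epsilon> * (\<kappa> + U) \<le> 4 / 100 * (\<kappa> + U)" using \<epsilon> \<kappa>0 U0 by (intro mult_right_mono) auto
  have "U \<le> 3 * \<kappa>"
  proof -
    have "\<bar>w l\<bar> \<le> 2 * \<kappa> + 4 / 100 * (\<kappa> + U)" if "l < n" for l
      using out[OF that] inside[of l] t_upper t_lower err \<kappa>0 by (cases "l \<in> S") linarith+
    then have "U \<le> 2 * \<kappa> + 4 / 100 * (\<kappa> + U)" unfolding U_def[symmetric] using n0
      by (subst U_def) (auto intro!: Max.boundedI)
    then show ?thesis using \<kappa>0 by (simp add: field_simps)
  qed
  then have err': "4 * \<epsilon> * (\<kappa> + U) \<le> 16 / 100 * \<kappa>" using err by (simp add: field_simps)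
  have "\<bar>w j\<bar> < \<bar>w i\<bar>"
    using out[of j] inside[of i] t_lower err' ij \<kappa>0 by auto
  then show ?thesis unfolding absw .
qed

section \<open>Hyperedges through one vertex\<close>

text \<open>Besides the row and the column of \<open>i\<close>, the hyperedges through \<open>i\<close> also affect entries away from
  \<open>i\<close>; these form the adjacency matrix of the link of \<open>i\<close>. In a graph the link part vanishes; for
  hypergraphs it is the extra term to be controlled.\<close>

locale vertex_star =
  fixes F :: "'e set" and V :: "'e \<Rightarrow> nat set" and h :: "'e \<Rightarrow> real" and n i :: nat and \<omega> :: real
  assumes fin: "finite F" and i: "i < n"
    and full: "form_bounded n (weighted_adjacency V F h) \<omega>"
begin

abbreviation "full_mat \<equiv> weighted_adjacency V F h"
abbreviation "rest_mat \<equiv> weighted_adjacency V {e \<in> F. i \<notin> V e} h"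
abbreviation "star_mat \<equiv> weighted_adjacency V {e \<in> F. i \<in> V e} h"
abbreviation "link_mat \<equiv> weighted_adjacency (\<lambda>e. V e - {i}) {e \<in> F. i \<in> V e} h"

lemma star_eq: "full_mat a c - rest_mat a c = star_mat a c"
proof -
  have "{e \<in> F. a \<in> V e \<and> c \<in> V e} = {e. (e \<in> F \<and> i \<notin> V e) \<and> a \<in> V e \<and> c \<in> V e} \<union> {e. (e \<in> F \<and> i \<in> V e) \<and> a \<in> V e \<and> c \<in> V e}"
    by auto
  then have "(\<Sum>e | e \<in> F \<and> a \<in> V e \<and> c \<in> V e. h e)
      = (\<Sum>e | (e \<in> F \<and> i \<notin> V e) \<and> a \<in> V e \<and> c \<in> V e. h e) + (\<Sum>e | (e \<in> F \<and> i \<in> V e) \<and> a \<in> V e \<and> c \<in> V e. h e)"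
    using fin by (simp only:) (intro sum.union_disjoint; auto)
  then show ?thesis by (simp add: weighted_adjacency_def)
qed

lemma star_row: "star_mat i c = full_mat i c"
  by (auto simp: weighted_adjacency_def intro!: sum.cong)

lemma star_entry:
  assumes "a \<noteq> i" shows "star_mat a c = (if c = i then full_mat a i else link_mat a c)"
  using assms by (auto simp: weighted_adjacency_def intro!: sum.cong)

lemma link_row: "link_mat i c = 0" "link_mat a i = 0"
  by (auto simp: weighted_adjacency_def)

lemma full_sym: "symmetric_upto n full_mat"
  by (simp add: symmetric_upto_def weighted_adjacency_sym)

lemma star_apply_i: "mat_apply n star_mat x i = mat_apply n full_mat x i"
  by (simp add: mat_apply_def star_row)

lemma star_apply:
  assumes "a \<noteq> i"
  shows "mat_apply n star_mat x a = full_mat a i * x i + mat_apply n link_mat x a"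
proof -
  have "mat_apply n star_mat x a = (\<Sum>c<n. (if c = i then full_mat a i * x i else 0) + link_mat a c * x c)"
    unfolding mat_apply_def by (intro sum.cong) (auto simp: star_entry[OF assms] link_row)
  then show ?thesis using i by (simp add: sum.distrib mat_apply_def)
qed

lemma star_apply_decomp:
  "mat_apply n star_mat x a = (if a = i then mat_apply n full_mat x i else 0)
     + (x i * (if a = i then 0 else full_mat a i) + mat_apply n link_mat x a)"
proof (cases "a = i")
  case True
  have "mat_apply n link_mat x i = 0" by (simp add: mat_apply_def link_row)
  then show ?thesis using True by (simp add: star_apply_i)
qed (simp add: star_apply)

lemma column_norm: "norm_upto n (\<lambda>a. if a = i then 0 else full_mat a i) \<le> \<omega>"
proof -
  define ei where "ei = (\<lambda>a. if a = i then 1 else 0 :: real)"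
  have "norm_upto n (\<lambda>a. if a = i then 0 else full_mat a i) = norm_upto n (mat_apply n full_mat ei)"
    using i by (intro L2_set_cong refl) (auto simp: mat_apply_def ei_def if_distrib[of "(*) _"] weighted_adjacency_def cong: if_cong)
  also have "\<dots> \<le> \<omega> * norm_upto n ei" by (rule form_bounded_mat_apply[OF full_sym full])
  also have "norm_upto n ei = 1"
    using i by (simp add: L2_set_def ei_def if_distrib[of "\<lambda>x. x\<^sup>2"] cong: if_cong)
  finally show ?thesis by simp
qed

lemma norm_star_apply_le:
  "norm_upto n (mat_apply n star_mat x) \<le> \<bar>mat_apply n full_mat x i\<bar> + \<omega> * \<bar>x i\<bar> + norm_upto n (mat_apply n link_mat x)"
proof -
  let ?f = "\<lambda>a. if a = i then mat_apply n full_mat x i else 0"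
  let ?g = "\<lambda>a. x i * (if a = i then 0 else full_mat a i)"
  have "norm_upto n (mat_apply n star_mat x) = norm_upto n (\<lambda>a. ?f a + (?g a + mat_apply n link_mat x a))"
    by (rule L2_set_cong[OF refl], rule star_apply_decomp)
  also have "\<dots> \<le> norm_upto n ?f + (norm_upto n ?g + norm_upto n (mat_apply n link_mat x))"
    by (rule order_trans[OF L2_set_triangle_ineq]) (intro add_left_mono L2_set_triangle_ineq)
  also have "norm_upto n ?f = \<bar>mat_apply n full_mat x i\<bar>"
    using i by (simp add: L2_set_def if_distrib[of "\<lambda>x. x\<^sup>2"] cong: if_cong)
  also have "norm_upto n ?g \<le> \<omega> * \<bar>x i\<bar>"
    unfolding norm_upto_scale by (subst mult.commute) (rule mult_right_mono[OF column_norm abs_ge_zero])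
  finally show ?thesis by simp
qed

lemma form_bounded_rest:
  assumes link: "form_bounded n link_mat \<omega>"
  shows "form_bounded n rest_mat (4 * \<omega>)"
  unfolding form_bounded_def
proof
  fix x
  have link_sym: "symmetric_upto n link_mat" by (simp add: symmetric_upto_def weighted_adjacency_sym)
  have \<omega>0: "0 \<le> \<omega>" using form_bounded_nonneg[OF full] i by simp
  have "\<bar>mat_apply n full_mat x i\<bar> \<le> norm_upto n (mat_apply n full_mat x)" by (rule abs_le_norm_upto[OF i])
  also have "\<dots> \<le> \<omega> * norm_upto n x" by (rule form_bounded_mat_apply[OF full_sym full])
  finally have 1: "\<bar>mat_apply n full_mat x i\<bar> \<le> \<omega> * norm_upto n x" .
  have 2: "norm_upto n (mat_apply n link_mat x) \<le> \<omega> * norm_upto n x" by (rule form_bounded_mat_apply[OF link_sym link])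
  have 3: "\<omega> * \<bar>x i\<bar> \<le> \<omega> * norm_upto n x" using \<omega>0 abs_le_norm_upto[OF i, of x] by (intro mult_left_mono)
  have "norm_upto n (mat_apply n star_mat x) \<le> 3 * (\<omega> * norm_upto n x)"
    using norm_star_apply_le[of x] 1 2 3 by linarith
  then have "norm_upto n x * norm_upto n (mat_apply n star_mat x) \<le> norm_upto n x * (3 * (\<omega> * norm_upto n x))"
    by (intro mult_left_mono) (auto simp: L2_set_nonneg)
  moreover have "\<bar>bilin n star_mat x x\<bar> \<le> norm_upto n x * norm_upto n (mat_apply n star_mat x)"
    unfolding bilin_eq_inner by (rule inner_upto_le_norm)
  ultimately have star: "\<bar>bilin n star_mat x x\<bar> \<le> 3 * \<omega> * (norm_upto n x)\<^sup>2"
    by (simp add: power2_eq_square algebra_simps)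
  have "bilin n full_mat x x = bilin n rest_mat x x + bilin n star_mat x x"
    unfolding bilin_def star_eq[symmetric] by (simp add: sum.distrib[symmetric] algebra_simps)
  moreover have "\<bar>bilin n full_mat x x\<bar> \<le> \<omega> * (norm_upto n x)\<^sup>2" by (rule form_boundedD[OF full])
  ultimately have "\<bar>bilin n rest_mat x x\<bar> \<le> \<omega> * (norm_upto n x)\<^sup>2 + 3 * \<omega> * (norm_upto n x)\<^sup>2"
    using star by linarith
  then show "\<bar>bilin n rest_mat x x\<bar> \<le> 4 * \<omega> * (norm_upto n x)\<^sup>2" by (simp add: algebra_simps)
qed

end



section \<open>The hypergraph planted clique model\<close>

lemma card_supersets:
  assumes X: "finite X" and Y: "Y \<subseteq> X"
  shows "card {e. e \<subseteq> X \<and> card e = d \<and> Y \<subseteq> e} = (if card Y \<le> d then (card X - card Y) choose (d - card Y) else 0)"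
proof (cases "card Y \<le> d")
  case True
  have finY: "finite Y" using X Y finite_subset by blast
  have "bij_betw (\<lambda>T. T \<union> Y) {T. T \<subseteq> X - Y \<and> card T = d - card Y} {e. e \<subseteq> X \<and> card e = d \<and> Y \<subseteq> e}"
  proof (rule bij_betw_byWitness[where f' = "\<lambda>e. e - Y"])
    show "(\<lambda>T. T \<union> Y) ` {T. T \<subseteq> X - Y \<and> card T = d - card Y} \<subseteq> {e. e \<subseteq> X \<and> card e = d \<and> Y \<subseteq> e}"
    proof clarsimp
      fix T assume T: "T \<subseteq> X - Y" "card T = d - card Y"
      have "finite T" using X T(1) finite_subset by blast
      moreover have "T \<inter> Y = {}" using T(1) by blast
      ultimately have "card (T \<union> Y) = card T + card Y" using finY by (simp add: card_Un_disjoint)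
      then show "T \<subseteq> X \<and> Y \<subseteq> X \<and> card (T \<union> Y) = d" using T Y True by auto
    qed
    show "(\<lambda>e. e - Y) ` {e. e \<subseteq> X \<and> card e = d \<and> Y \<subseteq> e} \<subseteq> {T. T \<subseteq> X - Y \<and> card T = d - card Y}"
      using finY by (auto simp: card_Diff_subset)
  qed auto
  then have "card {e. e \<subseteq> X \<and> card e = d \<and> Y \<subseteq> e} = card {T. T \<subseteq> X - Y \<and> card T = d - card Y}"
    by (simp add: bij_betw_same_card)
  also have "\<dots> = card (X - Y) choose (d - card Y)" using X by (subst n_subsets) auto
  also have "card (X - Y) = card X - card Y" using Y finY by (simp add: card_Diff_subset)
  finally show ?thesis using True by simp
next
  case False
  have "{e. e \<subseteq> X \<and> card e = d \<and> Y \<subseteq> e} = {}"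
  proof -
    have "card Y \<le> card e" if "e \<subseteq> X" "Y \<subseteq> e" for e
      using card_mono[OF finite_subset[OF that(1) X] that(2)] .
    then show ?thesis using False by auto
  qed
  then show ?thesis using False by (simp only: card.empty if_False)
qed

lemma binomial_le_power: "(n choose r) \<le> n ^ r"
proof (cases "r \<le> n")
  case True
  then show ?thesis by (rule binomial_le_pow)
qed (simp add: binomial_eq_0)

lemma card_supersets_le:
  assumes Y: "Y \<subseteq> {..<n}" and G: "\<And>e. e \<in> G \<Longrightarrow> e \<in> subsets_of_size n d \<and> Y \<subseteq> e"
  shows "card G \<le> n ^ (d - card Y)"
proof -
  have "card G \<le> card {e. e \<subseteq> {..<n} \<and> card e = d \<and> Y \<subseteq> e}"
  proof (rule card_mono)
    show "finite {e. e \<subseteq> {..<n} \<and> card e = d \<and> Y \<subseteq> e}"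
      by (rule finite_subset[of _ "Pow {..<n}"]) auto
    show "G \<subseteq> {e. e \<subseteq> {..<n} \<and> card e = d \<and> Y \<subseteq> e}"
      using G by (auto simp: subsets_of_size_def)
  qed
  also have "\<dots> \<le> (n - card Y) choose (d - card Y)" using card_supersets[OF _ Y, of d] by simp
  also have "\<dots> \<le> (n - card Y) ^ (d - card Y)" by (rule binomial_le_power)
  also have "\<dots> \<le> n ^ (d - card Y)" by (intro power_mono) auto
  finally show ?thesis .
qed

lemma finite_subsets_of_size: "finite (subsets_of_size n d)"
  by (rule finite_subset[of _ "Pow {..<n}"]) (auto simp: subsets_of_size_def)

lemma finite_subset_of_size: "e \<in> subsets_of_size n d \<Longrightarrow> finite e"
  by (auto simp: subsets_of_size_def intro: finite_subset)

lemma adjacency_index: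
  assumes "i < n" "j < n"
  shows "adjacency n d H $$ (i, j) = weighted_adjacency (\<lambda>e. e) (subsets_of_size n d) (\<lambda>e. of_bool (H e)) i j"
  using assms by (simp add: adjacency_def weighted_adjacency_def)

definition hyperedge_law :: "real \<Rightarrow> nat set \<Rightarrow> nat set \<Rightarrow> bool pmf" where
  "hyperedge_law p S e = (if e \<subseteq> S then return_pmf True else bernoulli_pmf p)"

lemma HPC_alt:
  "HPC n d k p = bind_pmf (pmf_of_set (subsets_of_size n k)) (\<lambda>S.
     map_pmf (\<lambda>H. (adjacency n d H, S)) (Pi_pmf (subsets_of_size n d) False (hyperedge_law p S)))"
  unfolding HPC_def map_pmf_def hyperedge_law_def[abs_def] by simp

lemma null_mean_index:
  assumes ij: "i < n" "j < n" and d: "1 \<le> d" and p: "0 \<le> p" "p \<le> 1"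
  shows "null_mean n d p $$ (i, j) = p * weighted_adjacency (\<lambda>e. e) (subsets_of_size n d) (\<lambda>e. 1) i j"
proof -
  let ?E = "subsets_of_size n d"
  let ?law = "Pi_pmf ?E False (hyperedge_law p {})"
  have "subsets_of_size n 0 = {{}}" by (auto simp: subsets_of_size_def card_eq_0_iff dest: finite_subset[OF _ finite_lessThan])
  then have "HPC n d 0 p = map_pmf (\<lambda>H. (adjacency n d H, {})) ?law"
    unfolding HPC_alt by (simp add: pmf_of_set_singleton bind_return_pmf)
  then have "null_mean n d p $$ (i, j) = measure_pmf.expectation ?law (\<lambda>H. adjacency n d H $$ (i, j))"
    using ij by (simp add: null_mean_def)
  also have "\<dots> = (if i = j then 0 else measure_pmf.expectation ?law (\<lambda>H. \<Sum>e | e \<in> ?E \<and> i \<in> e \<and> j \<in> e. of_bool (H e)))"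
    using ij by (simp add: adjacency_index weighted_adjacency_def)
  also have "measure_pmf.expectation ?law (\<lambda>H. \<Sum>e | e \<in> ?E \<and> i \<in> e \<and> j \<in> e. of_bool (H e) :: real)
      = (\<Sum>e | e \<in> ?E \<and> i \<in> e \<and> j \<in> e. measure_pmf.expectation ?law (\<lambda>H. of_bool (H e)))"
  proof (rule Bochner_Integration.integral_sum)
    fix e
    show "integrable (measure_pmf ?law) (\<lambda>H. of_bool (H e) :: real)"
      by (rule measure_pmf.integrable_const_bound[where B = 1]) auto
  qed
  also have "\<dots> = (\<Sum>e | e \<in> ?E \<and> i \<in> e \<and> j \<in> e. p)"
  proof (intro sum.cong refl)
    fix e assume e: "e \<in> {e. e \<in> ?E \<and> i \<in> e \<and> j \<in> e}"
    have "measure_pmf.expectation ?law (\<lambda>H. of_bool (H e) :: real) = measure_pmf.expectation (map_pmf (\<lambda>H. H e) ?law) of_bool"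
      by simp
    also have "map_pmf (\<lambda>H. H e) ?law = bernoulli_pmf p"
      using e d by (subst Pi_pmf_component[OF finite_subsets_of_size])
        (auto simp: hyperedge_law_def subsets_of_size_def)
    also have "measure_pmf.expectation (bernoulli_pmf p) of_bool = (p :: real)" using p by simp
    finally show "measure_pmf.expectation ?law (\<lambda>H. of_bool (H e)) = p" .
  qed
  finally show ?thesis by (simp add: weighted_adjacency_def)
qed

text \<open>The largest eigenvalue is the maximum of the Rayleigh quotient, because that maximum is itself
  an eigenvalue.\<close>

lemma top_unit_eigenvector_top_eigenpair:
  assumes M: "M \<in> carrier_mat n n" and f: "\<And>i j. i < n \<Longrightarrow> j < n \<Longrightarrow> M $$ (i, j) = f i j"
    and sym: "symmetric_upto n f" and n: "0 < n" and top: "top_unit_eigenvector M u"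
  shows "\<exists>\<mu>. top_eigenpair n f (\<lambda>i. vec_index u i) \<mu>"
proof -
  obtain l where unit: "sqrt (scalar_prod u u) = 1" and ev: "eigenvector M u l"
    and l_max: "\<And>l'. eigenvalue M l' \<Longrightarrow> l' \<le> l"
    using top by (auto simp: top_unit_eigenvector_def)
  have u: "u \<in> carrier_vec n" and Mu: "mult_mat_vec M u = l \<cdot>\<^sub>v u" using ev M by (auto simp: eigenvector_def)
  have mult: "vec_index (mult_mat_vec M v) i = mat_apply n f (\<lambda>i. vec_index v i) i" if "i < n" "v \<in> carrier_vec n" for v i
  proof -
    have "vec_index (mult_mat_vec M v) i = (\<Sum>j\<in>{0..<n}. M $$ (i, j) * vec_index v j)"
      using that M by (auto simp: scalar_prod_def intro!: sum.cong)
    also have "\<dots> = mat_apply n f (\<lambda>i. vec_index v i) i"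
      using that by (simp add: mat_apply_def f atLeast0LessThan)
    finally show ?thesis .
  qed
  obtain x \<mu> where x: "norm_upto n x = 1" "\<And>i. i < n \<Longrightarrow> mat_apply n f x i = \<mu> * x i"
    and ray: "\<And>y. bilin n f y y \<le> \<mu> * (norm_upto n y)\<^sup>2"
    using top_eigenvector_exists[OF sym n] by blast
  have "eigenvector M (Matrix.vec n x) \<mu>"
    unfolding eigenvector_def
  proof (intro conjI)
    show "Matrix.vec n x \<in> carrier_vec (dim_row M)" using M by simp
    show "Matrix.vec n x \<noteq> 0\<^sub>v (dim_row M)"
    proof
      assume "Matrix.vec n x = 0\<^sub>v (dim_row M)"
      then have "\<forall>i<n. x i = 0" using M by (metis carrier_matD(1) index_vec index_zero_vec(1))
      then have "norm_upto n x = 0" by (simp add: L2_set_def)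
      then show False using x by simp
    qed
    show "mult_mat_vec M (Matrix.vec n x) = \<mu> \<cdot>\<^sub>v Matrix.vec n x"
    proof (rule eq_vecI)
      fix i assume "i < dim_vec (\<mu> \<cdot>\<^sub>v Matrix.vec n x)"
      then have i: "i < n" by simp
      have "vec_index (mult_mat_vec M (Matrix.vec n x)) i = mat_apply n f (\<lambda>i. vec_index (Matrix.vec n x) i) i" by (rule mult[OF i]) simp
      also have "\<dots> = mat_apply n f x i" by (simp add: mat_apply_def)
      finally show "vec_index (mult_mat_vec M (Matrix.vec n x)) i = vec_index (\<mu> \<cdot>\<^sub>v Matrix.vec n x) i" using x(2)[OF i] i by simp
    qed (use M in simp)
  qed
  then have "\<mu> \<le> l" by (intro l_max) (auto simp: eigenvalue_def)
  moreover have "norm_upto n (\<lambda>i. vec_index u i) = 1"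
    using unit u by (simp add: L2_set_def scalar_prod_def power2_eq_square atLeast0LessThan carrier_vecD)
  moreover have "mat_apply n f (\<lambda>i. vec_index u i) i = l * vec_index u i" if "i < n" for i
    using mult[OF that u] Mu u that by simp
  moreover have "bilin n f y y \<le> l * (norm_upto n y)\<^sup>2" for y
    using ray[of y] mult_right_mono[OF \<open>\<mu> \<le> l\<close>, of "(norm_upto n y)\<^sup>2"] by simp
  ultimately show ?thesis unfolding top_eigenpair_def by blast
qed

locale planted_model =
  fixes n d k :: nat and p :: real and S :: "nat set"
  assumes S: "S \<in> subsets_of_size n k" and d3: "3 \<le> d" and n3: "3 \<le> n" and p: "0 < p" "p < 1"
begin

lemma S_sub: "S \<subseteq> {..<n}" and card_S: "card S = k" and fin_S: "finite S"
  using S by (auto simp: subsets_of_size_def intro: finite_subset)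

abbreviation "edges \<equiv> subsets_of_size n d"

text \<open>Hyperedges inside the planted set are deterministic; the others carry all the noise.\<close>

definition free where "free = {e \<in> edges. \<not> e \<subseteq> S}"

text \<open>A pair of planted vertices lies in \<open>(k - 2) choose (d - 2)\<close> planted hyperedges, each of which
  exceeds its mean under the null model by \<open>1 - p\<close>.\<close>

definition signal :: real where "signal = (1 - p) * real ((k - 2) choose (d - 2))"

definition noise :: "(nat set \<Rightarrow> bool) \<Rightarrow> nat \<Rightarrow> nat \<Rightarrow> real" where
  "noise H = weighted_adjacency (\<lambda>e. e) free (\<lambda>e. of_bool (H e) - p)"

definition link_noise :: "nat \<Rightarrow> (nat set \<Rightarrow> bool) \<Rightarrow> nat \<Rightarrow> nat \<Rightarrow> real" where
  "link_noise i H = weighted_adjacency (\<lambda>e. e - {i}) {e \<in> free. i \<in> e} (\<lambda>e. of_bool (H e) - p)"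

definition rest_noise :: "nat \<Rightarrow> (nat set \<Rightarrow> bool) \<Rightarrow> nat \<Rightarrow> nat \<Rightarrow> real" where
  "rest_noise i H = weighted_adjacency (\<lambda>e. e) {e \<in> free. i \<notin> e} (\<lambda>e. of_bool (H e) - p)"

sublocale bernoulli_hyperedges edges free "hyperedge_law p S" p
  by unfold_locales (use p in \<open>auto simp: finite_subsets_of_size free_def hyperedge_law_def\<close>)

lemma planted_hyperedges_present:
  assumes "H \<in> set_pmf law" "e \<in> edges" "e \<subseteq> S" shows "H e"
proof -
  have "H e \<in> set_pmf (map_pmf (\<lambda>H. H e) law)" using assms(1) by auto
  also have "map_pmf (\<lambda>H. H e) law = return_pmf True"
    using assms by (subst Pi_pmf_component[OF finite_subsets_of_size]) (simp add: hyperedge_law_def)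
  finally show ?thesis by simp
qed

lemma centered_adjacency_eq:
  assumes H: "H \<in> set_pmf law" and ij: "i < n" "j < n"
  shows "(adjacency n d H - null_mean n d p) $$ (i, j) = planted S signal (noise H) i j"
proof -
  let ?W = "\<lambda>F h. weighted_adjacency (\<lambda>e. e) F h i j"
  have dims: "adjacency n d H \<in> carrier_mat n n" "null_mean n d p \<in> carrier_mat n n"
    by (simp_all add: adjacency_def null_mean_def)
  have "(adjacency n d H - null_mean n d p) $$ (i, j)
      = ?W edges (\<lambda>e. of_bool (H e)) - p * ?W edges (\<lambda>e. 1)"
    using dims ij d3 p by (simp add: adjacency_index null_mean_index)
  also have "\<dots> = ?W edges (\<lambda>e. of_bool (H e) - p)"
    unfolding weighted_adjacency_diff by (subst (2) weighted_adjacency_const) simp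
  also have "\<dots> = planted S signal (noise H) i j"
  proof (cases "i = j")
    case True
    then show ?thesis by (simp add: planted_def noise_def weighted_adjacency_def)
  next
    case False
    let ?P = "{e. e \<subseteq> S \<and> card e = d \<and> {i, j} \<subseteq> e}"
    have split: "{e. e \<in> edges \<and> i \<in> e \<and> j \<in> e} = ?P \<union> {e. e \<in> free \<and> i \<in> e \<and> j \<in> e}"
      using S_sub by (auto simp: free_def subsets_of_size_def)
    have "(\<Sum>e | e \<in> edges \<and> i \<in> e \<and> j \<in> e. of_bool (H e) - p)
        = (\<Sum>e\<in>?P. of_bool (H e) - p) + (\<Sum>e | e \<in> free \<and> i \<in> e \<and> j \<in> e. of_bool (H e) - p)"
      unfolding split
    proof (rule sum.union_disjoint)
      show "finite ?P" using fin_S by simp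
      show "finite {e \<in> free. i \<in> e \<and> j \<in> e}" using finite_F by simp
    qed (auto simp: free_def)
    also have "(\<Sum>e\<in>?P. of_bool (H e) - p) = (\<Sum>e\<in>?P. 1 - p)"
      using S_sub by (intro sum.cong refl) (auto simp: subsets_of_size_def intro!: planted_hyperedges_present[OF H])
    also have "\<dots> = (if i \<in> S \<and> j \<in> S then signal else 0)"
    proof (cases "i \<in> S \<and> j \<in> S")
      case True
      have "card ?P = (k - 2) choose (d - 2)"
        using card_supersets[OF fin_S, of "{i, j}" d] True False d3 by (simp add: card_S numeral_2_eq_2)
      then show ?thesis using True by (simp add: signal_def)
    next
      case False
      then have "?P = {}" by auto
      then have "(\<Sum>e\<in>?P. 1 - p) = 0" by (simp only: sum.empty)
      then show ?thesis using False by (simp only: if_False)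
    qed
    finally show ?thesis using False by (simp add: planted_def noise_def weighted_adjacency_def)
  qed
  finally show ?thesis .
qed

lemma noise_symmetric: "symmetric_upto n (noise H)"
  and rest_noise_symmetric: "symmetric_upto n (rest_noise i H)"
  by (simp_all add: symmetric_upto_def noise_def rest_noise_def weighted_adjacency_sym)

text \<open>A pair of vertices lies in at most \<open>n ^ (d - 2)\<close> hyperedges.\<close>

lemma prob_noise_large:
  assumes D: "p * real n ^ (d - 1) \<le> D" "ln (real n) \<le> D"
  shows "measure_pmf.prob law {H. \<not> form_bounded n (noise H) (noise_norm_const d * sqrt D)} \<le> 4 / (real n)\<^sup>2"
proof -
  have R: "random_hypergraph edges free (hyperedge_law p S) p (\<lambda>e. e) n d D (real n ^ (d - 2))"
  proof (intro random_hypergraph.intro random_hypergraph_axioms.intro)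
    show "bernoulli_hyperedges edges free (hyperedge_law p S) p" by unfold_locales
  next
    fix i j assume ij: "i < n" "j < n" "i \<noteq> j"
    have "card {e \<in> free. i \<in> e \<and> j \<in> e} \<le> n ^ (d - card {i, j})"
      using ij by (intro card_supersets_le) (auto simp: free_def)
    then show "real (card {e \<in> free. i \<in> e \<and> j \<in> e}) \<le> real n ^ (d - 2)"
      using ij by (simp add: of_nat_power[symmetric] numeral_2_eq_2 del: of_nat_power)
  next
    have "d - 1 = Suc (d - 2)" using d3 by simp
    then show "p * real n ^ (d - 2) * real n \<le> D" using D(1) by (simp add: mult_ac)
  qed (use D n3 d3 in \<open>auto simp: free_def subsets_of_size_def\<close>)
  show ?thesis
    using random_hypergraph.prob_noise_norm_large[OF R]
    unfolding random_hypergraph.noise_def[OF R] noise_def .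
qed

text \<open>The link of a vertex is a hypergraph of uniformity \<open>d - 1\<close>, with codegrees at most \<open>n ^ (d - 3)\<close>.
  Its mean degree can be below \<open>ln n\<close>, in which case the choice \<open>D = ln n\<close> applies.\<close>

lemma prob_link_noise_large:
  assumes i: "i < n" and D: "p * real n ^ (d - 2) \<le> D" "ln (real n) \<le> D"
  shows "measure_pmf.prob law {H. \<not> form_bounded n (link_noise i H) (noise_norm_const d * sqrt D)} \<le> 4 / (real n)\<^sup>2"
proof -
  let ?F = "{e \<in> free. i \<in> e}"
  have base: "bernoulli_hyperedges edges ?F (hyperedge_law p S) p" by (rule sub_family) auto
  have sub: "e - {i} \<subseteq> {..<n}" and card: "card (e - {i}) \<le> d" if "e \<in> ?F" for e
  proof -
    have e: "e \<subseteq> {..<n}" "card e = d" using that by (auto simp: free_def subsets_of_size_def)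
    then show "e - {i} \<subseteq> {..<n}" by auto
    show "card (e - {i}) \<le> d" using card_Diff1_le[of e i] unfolding e(2) .
  qed
  have codeg: "real (card {e \<in> ?F. a \<in> e - {i} \<and> c \<in> e - {i}}) \<le> real n ^ (d - 3)"
    if ac: "a < n" "c < n" "a \<noteq> c" for a c
  proof (cases "a = i \<or> c = i")
    case False
    have "card {e \<in> ?F. a \<in> e - {i} \<and> c \<in> e - {i}} \<le> n ^ (d - card {i, a, c})"
      using ac i by (intro card_supersets_le) (auto simp: free_def)
    moreover have "card {i, a, c} = 3" using ac False by auto
    ultimately show ?thesis by (simp add: of_nat_power[symmetric] del: of_nat_power)
  qed auto
  have mean: "p * real n ^ (d - 3) * real n \<le> D"
  proof -
    have "d - 2 = Suc (d - 3)" using d3 by simp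
    then show ?thesis using D(1) by (simp add: mult_ac)
  qed
  have R: "random_hypergraph edges ?F (hyperedge_law p S) p (\<lambda>e. e - {i}) n d D (real n ^ (d - 3))"
    by (intro random_hypergraph.intro random_hypergraph_axioms.intro base sub card codeg mean D(2) n3)
       (use d3 in auto)
  show ?thesis
    using random_hypergraph.prob_noise_norm_large[OF R]
    unfolding random_hypergraph.noise_def[OF R] link_noise_def .
qed

section \<open>Leave-one-out eigenvectors\<close>

text \<open>The choice operator makes the vector a function of the hyperedges that avoid \<open>i\<close>, hence
  independent of the hyperedges through \<open>i\<close>.\<close>

definition loo_vector :: "nat \<Rightarrow> (nat set \<Rightarrow> bool) \<Rightarrow> nat \<Rightarrow> real" where
  "loo_vector i H = (SOME x. \<exists>\<mu>. top_eigenpair n (planted S signal (rest_noise i H)) x \<mu> \<and> 0 \<le> (\<Sum>j\<in>S. x j))"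

lemma loo_vector:
  "\<exists>\<mu>. top_eigenpair n (planted S signal (rest_noise i H)) (loo_vector i H) \<mu> \<and> 0 \<le> (\<Sum>j\<in>S. loo_vector i H j)"
proof -
  let ?M = "planted S signal (rest_noise i H)"
  let ?P = "\<lambda>x. \<exists>\<mu>. top_eigenpair n ?M x \<mu> \<and> 0 \<le> (\<Sum>j\<in>S. x j)"
  obtain x \<mu> where "norm_upto n x = 1" "\<And>i. i < n \<Longrightarrow> mat_apply n ?M x i = \<mu> * x i"
    "\<And>y. bilin n ?M y y \<le> \<mu> * (norm_upto n y)\<^sup>2"
    using top_eigenvector_exists[OF symmetric_planted[OF rest_noise_symmetric], of S signal i H] n3 by auto
  then have "top_eigenpair n ?M x \<mu>" by (simp add: top_eigenpair_def)
  then have "\<exists>x. ?P x"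
    using top_eigenpair_neg[of n ?M x \<mu>] by (cases "0 \<le> (\<Sum>j\<in>S. x j)") (auto simp: sum_negf)
  then have "?P (SOME x. ?P x)" by (rule someI_ex)
  then show ?thesis unfolding loo_vector_def .
qed

lemma loo_vector_cong:
  assumes "\<And>e. e \<in> free \<Longrightarrow> i \<notin> e \<Longrightarrow> H e = H' e" shows "loo_vector i H = loo_vector i H'"
proof -
  have "rest_noise i H = rest_noise i H'"
    unfolding rest_noise_def weighted_adjacency_def using assms by (intro ext if_cong sum.cong refl) auto
  then show ?thesis by (simp add: loo_vector_def)
qed

definition sup_norm :: "(nat \<Rightarrow> real) \<Rightarrow> real" where "sup_norm x = Max ((\<lambda>j. \<bar>x j\<bar>) ` {..<n})"

lemma sup_norm_ge: "j < n \<Longrightarrow> \<bar>x j\<bar> \<le> sup_norm x"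
  unfolding sup_norm_def by (intro Max_ge) auto

lemma sup_norm_le: "(\<And>j. j < n \<Longrightarrow> \<bar>x j\<bar> \<le> v) \<Longrightarrow> sup_norm x \<le> v"
  unfolding sup_norm_def using n3 by (subst Max_le_iff) (auto simp: lessThan_empty_iff)

lemma mat_apply_noise_row:
  assumes i: "i < n"
  shows "mat_apply n (noise H) x i = (\<Sum>e | e \<in> free \<and> i \<in> e. (\<Sum>j\<in>e - {i}. x j) * (of_bool (H e) - p))"
proof -
  have "mat_apply n (noise H) x i = (\<Sum>a<n. \<Sum>j<n. (if a = i then x j else 0) * noise H a j)"
  proof -
    have "(\<Sum>a<n. \<Sum>j<n. (if a = i then x j else 0) * noise H a j) = (\<Sum>a<n. if a = i then mat_apply n (noise H) x i else 0)"
      by (intro sum.cong) (auto simp: mat_apply_def mult.commute)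
    then show ?thesis using i by simp
  qed
  also have "\<dots> = (\<Sum>e\<in>free. (of_bool (H e) - p) * pair_weight (\<lambda>a j. if a = i then x j else 0) e)"
    unfolding noise_def
    by (rule sum_weighted_adjacency[OF finite_F]) (auto simp: free_def subsets_of_size_def)
  also have "\<dots> = (\<Sum>e\<in>free. if i \<in> e then (\<Sum>j\<in>e - {i}. x j) * (of_bool (H e) - p) else 0)"
  proof (intro sum.cong refl)
    fix e assume "e \<in> free"
    then have fin: "finite e" by (auto simp: free_def finite_subset_of_size)
    have "pair_weight (\<lambda>a j. if a = i then x j else 0) e = (\<Sum>a\<in>e. if a = i then (\<Sum>j\<in>e - {i}. x j) else 0)"
      unfolding pair_weight_def by (intro sum.cong) auto
    also have "\<dots> = (if i \<in> e then (\<Sum>j\<in>e - {i}. x j) else 0)" using fin by simp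
    finally show "(of_bool (H e) - p) * pair_weight (\<lambda>a j. if a = i then x j else 0) e
      = (if i \<in> e then (\<Sum>j\<in>e - {i}. x j) * (of_bool (H e) - p) else 0)"
      by (simp add: mult.commute)
  qed
  also have "\<dots> = (\<Sum>e | e \<in> free \<and> i \<in> e. (\<Sum>j\<in>e - {i}. x j) * (of_bool (H e) - p))"
    using finite_F by (simp add: sum.inter_filter)
  finally show ?thesis .
qed

text \<open>For a fixed vector, a row of the noise is a sum over independent hyperedges whose coefficients are
  sums of at most \<open>d\<close> entries of the vector, so Bernstein's inequality applies with the largest
  entry as the bound for the coefficients.\<close>

lemma prob_fixed_row_large:
  assumes i: "i < n" and x: "norm_upto n x = 1"
    and t: "4 * (sqrt (real d * p * real n ^ (d - 2) * ln (real n)) + real d * sup_norm x * ln (real n)) \<le> t"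
  shows "measure_pmf.prob law {H. t \<le> \<bar>mat_apply n (noise H) x i\<bar>} \<le> 2 / real n ^ 3"
proof -
  let ?F = "{e \<in> free. i \<in> e}"
  have B: "bernoulli_hyperedges edges ?F (hyperedge_law p S) p"
    by (rule sub_family) blast
  let ?y = "\<lambda>e. \<Sum>j\<in>e - {i}. x j"
  have e_props: "finite e" "card (e - {i}) \<le> d" "e \<subseteq> {..<n}" if "e \<in> ?F" for e
  proof -
    have e: "e \<subseteq> {..<n}" "card e = d" using that by (auto simp: free_def subsets_of_size_def)
    show "e \<subseteq> {..<n}" by (rule e)
    then show "finite e" by (rule finite_subset) simp
    show "card (e - {i}) \<le> d" using card_Diff1_le[of e i] unfolding e(2) .
  qed
  have sup0: "0 < sup_norm x"
  proof (rule ccontr)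
    assume "\<not> 0 < sup_norm x"
    then have "x j = 0" if "j < n" for j using sup_norm_ge[OF that, of x] by simp
    then have "norm_upto n x = 0" by (simp add: L2_set_def)
    then show False using x by simp
  qed
  have ln0: "0 < ln (real n)" using n3 by simp
  have "measure_pmf.prob law {H. t \<le> \<bar>\<Sum>e\<in>?F. ?y e * (of_bool (H e) - p)\<bar>} \<le> 2 * exp (- 3 * ln (real n))"
  proof (rule bernoulli_hyperedges.bernstein[OF B])
    fix e assume e: "e \<in> ?F"
    have "\<bar>?y e\<bar> \<le> (\<Sum>j\<in>e - {i}. sup_norm x)"
      using e_props[OF e] by (intro order_trans[OF sum_abs] sum_mono sup_norm_ge) auto
    also have "\<dots> \<le> real d * sup_norm x" using e_props[OF e] sup0 by (simp add: mult_right_mono)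
    finally show "\<bar>?y e\<bar> \<le> real d * sup_norm x" .
  next
    have "(\<Sum>e\<in>?F. (?y e)\<^sup>2) \<le> (\<Sum>e\<in>?F. real d * (\<Sum>j\<in>e - {i}. (x j)\<^sup>2))"
    proof (rule sum_mono)
      fix e assume e: "e \<in> ?F"
      have "(?y e)\<^sup>2 = (\<Sum>j\<in>e - {i}. 1 * x j)\<^sup>2" by simp
      also have "\<dots> \<le> (\<Sum>j\<in>e - {i}. 1\<^sup>2) * (\<Sum>j\<in>e - {i}. (x j)\<^sup>2)" by (rule Cauchy_Schwarz_ineq_sum)
      also have "\<dots> = real (card (e - {i})) * (\<Sum>j\<in>e - {i}. (x j)\<^sup>2)" by simp
      also have "\<dots> \<le> real d * (\<Sum>j\<in>e - {i}. (x j)\<^sup>2)"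
        using e_props[OF e] by (intro mult_right_mono sum_nonneg) auto
      finally show "(?y e)\<^sup>2 \<le> real d * (\<Sum>j\<in>e - {i}. (x j)\<^sup>2)" .
    qed
    also have "\<dots> = real d * (\<Sum>e\<in>?F. \<Sum>j\<in>e - {i}. (x j)\<^sup>2)" by (rule sum_distrib_left[symmetric])
    also have "(\<Sum>e\<in>?F. \<Sum>j\<in>e - {i}. (x j)\<^sup>2) = (\<Sum>e\<in>?F. \<Sum>j<n. if j \<in> e - {i} then (x j)\<^sup>2 else 0)"
    proof (rule sum.cong[OF refl])
      fix e assume "e \<in> ?F"
      then show "(\<Sum>j\<in>e - {i}. (x j)\<^sup>2) = (\<Sum>j<n. if j \<in> e - {i} then (x j)\<^sup>2 else 0)"
        using e_props[of e] by (intro sum.mono_neutral_cong_left) auto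
    qed
    also have "(\<Sum>e\<in>?F. \<Sum>j<n. if j \<in> e - {i} then (x j)\<^sup>2 else 0) = (\<Sum>j<n. \<Sum>e\<in>?F. if j \<in> e - {i} then (x j)\<^sup>2 else 0)"
      by (rule sum.swap)
    also have "\<dots> \<le> (\<Sum>j<n. real n ^ (d - 2) * (x j)\<^sup>2)"
    proof (rule sum_mono)
      fix j assume j: "j \<in> {..<n}"
      have "(\<Sum>e\<in>?F. if j \<in> e - {i} then (x j)\<^sup>2 else 0) = (\<Sum>e\<in>{e \<in> ?F. j \<in> e - {i}}. (x j)\<^sup>2)"
        using bernoulli_hyperedges.finite_F[OF B] by (rule sum.inter_filter[symmetric])
      also have "\<dots> = real (card {e \<in> ?F. j \<in> e - {i}}) * (x j)\<^sup>2" by simp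
      also have "\<dots> \<le> real n ^ (d - 2) * (x j)\<^sup>2"
      proof (intro mult_right_mono)
        show "real (card {e \<in> ?F. j \<in> e - {i}}) \<le> real n ^ (d - 2)"
        proof (cases "j = i")
          case False
          have "card {e \<in> ?F. j \<in> e - {i}} \<le> n ^ (d - card {i, j})"
            using i j by (intro card_supersets_le) (auto simp: free_def)
          then show ?thesis using False by (simp add: of_nat_power[symmetric] numeral_2_eq_2 del: of_nat_power)
        qed simp
      qed simp
      finally show "(\<Sum>e\<in>?F. if j \<in> e - {i} then (x j)\<^sup>2 else 0) \<le> real n ^ (d - 2) * (x j)\<^sup>2" .
    qed
    also have "(\<Sum>j<n. real n ^ (d - 2) * (x j)\<^sup>2) = real n ^ (d - 2)"
      using x norm_upto_sq[of x n] by (simp add: sum_distrib_left[symmetric])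
    finally have "(\<Sum>e\<in>?F. (?y e)\<^sup>2) \<le> real d * real n ^ (d - 2)" by (simp add: mult_left_mono)
    then have "p * (\<Sum>e\<in>?F. (?y e)\<^sup>2) \<le> p * (real d * real n ^ (d - 2))"
      using p by (intro mult_left_mono) auto
    then show "p * (\<Sum>e\<in>?F. (?y e)\<^sup>2) \<le> real d * p * real n ^ (d - 2)" by (simp add: mult_ac)
  qed (use p n3 d3 sup0 ln0 t in auto)
  also have "exp (- 3 * ln (real n)) = 1 / real n ^ 3" by (rule exp_minus_3ln[OF n3])
  finally show ?thesis unfolding mat_apply_noise_row[OF i] by simp
qed

text \<open>The threshold depends on the random vector through its largest entry. Conditionally on the
  hyperedges that avoid \<open>i\<close> the vector is fixed, and the previous lemma applies.\<close>

lemma prob_loo_row_large: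
  assumes i: "i < n"
    and t: "4 * sqrt (real d * p * real n ^ (d - 2) * ln (real n)) \<le> t" and c: "4 * real d * ln (real n) \<le> c"
  shows "measure_pmf.prob law {H. t + c * sup_norm (loo_vector i H) \<le> \<bar>mat_apply n (noise H) (loo_vector i H) i\<bar>} \<le> 2 / real n ^ 3"
proof -
  let ?B = "{e \<in> edges. i \<in> e}"
  define R where "R h H \<longleftrightarrow> t + c * sup_norm (loo_vector i h) \<le> \<bar>mat_apply n (noise H) (loo_vector i h) i\<bar>" for h H
  have "measure_pmf.prob law {H. R (\<lambda>e. if e \<in> ?B then False else H e) H} \<le> 2 / real n ^ 3"
  proof (rule prob_Pi_pmf_condition[OF finite_A])
    fix h H H' assume eq: "\<And>e. e \<in> ?B \<Longrightarrow> H e = H' e" and "R h H"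
    moreover have "mat_apply n (noise H) x i = mat_apply n (noise H') x i" for x
      unfolding mat_apply_noise_row[OF i] using eq by (intro sum.cong) (auto simp: free_def)
    ultimately show "R h H'" by (simp add: R_def)
  next
    fix h
    let ?x = "loo_vector i h"
    have nx: "norm_upto n ?x = 1" using loo_vector[of i h] by (auto simp: top_eigenpair_def)
    have sup0: "0 \<le> sup_norm ?x" using sup_norm_ge[OF i, of ?x] by linarith
    have "4 * real d * ln (real n) * sup_norm ?x \<le> c * sup_norm ?x" using c sup0 by (rule mult_right_mono)
    then have "4 * (sqrt (real d * p * real n ^ (d - 2) * ln (real n)) + real d * sup_norm ?x * ln (real n)) \<le> t + c * sup_norm ?x"
      using t by (simp add: algebra_simps)
    then show "measure_pmf.prob law {H. R h H} \<le> 2 / real n ^ 3"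
      unfolding R_def by (rule prob_fixed_row_large[OF i nx])
  qed auto
  moreover have "loo_vector i (\<lambda>e. if e \<in> ?B then False else H e) = loo_vector i H" for H
    by (rule loo_vector_cong) (auto simp: free_def)
  ultimately show ?thesis by (simp add: R_def)
qed

section \<open>Exact recovery for a fixed planted set\<close>

lemma largest_entries_eq_planted:
  assumes T: "largest_entries n k u T"
    and sep: "\<And>i j. i \<in> S \<Longrightarrow> j \<in> {..<n} - S \<Longrightarrow> \<bar>vec_index u j\<bar> < \<bar>vec_index u i\<bar>"
  shows "T = S"
proof (rule ccontr)
  assume ne: "T \<noteq> S"
  have T_sub: "T \<subseteq> {..<n}" and card_T: "card T = k" using T by (auto simp: largest_entries_def subsets_of_size_def)
  then have fin_T: "finite T" using finite_subset by blast
  have "\<not> S \<subseteq> T" "\<not> T \<subseteq> S"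
    using card_subset_eq[OF fin_T, of S] card_subset_eq[OF fin_S, of T] ne card_T card_S by auto
  then obtain i j where i: "i \<in> S" "i \<notin> T" and j: "j \<in> T" "j \<notin> S" by blast
  have "\<bar>vec_index u i\<bar> \<le> \<bar>vec_index u j\<bar>" using T i j S_sub by (auto simp: largest_entries_def)
  moreover have "\<bar>vec_index u j\<bar> < \<bar>vec_index u i\<bar>" using sep i j T_sub by blast
  ultimately show False by linarith
qed

lemma recovery_on_good_event:
  fixes \<epsilon> :: real
  defines "\<gamma> \<equiv> signal * (real k - 1)"
  assumes \<epsilon>: "0 < \<epsilon>" "\<epsilon> \<le> 1 / 100" and k_large: "1 \<le> \<epsilon> * real k" and signal: "0 < signal"
    and H: "H \<in> set_pmf law"
    and G1: "form_bounded n (noise H) (\<epsilon> * \<gamma>)"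
    and G2: "\<And>i. i < n \<Longrightarrow> form_bounded n (link_noise i H) (\<epsilon> * \<gamma> / sqrt (real k))"
    and G3: "\<And>i. i < n \<Longrightarrow> \<bar>mat_apply n (noise H) (loo_vector i H) i\<bar>
       < \<epsilon> * \<gamma> / sqrt (real k) + \<epsilon> * \<gamma> * sup_norm (loo_vector i H)"
    and top: "top_unit_eigenvector (adjacency n d H - null_mean n d p) u" and T: "largest_entries n k u T"
  shows "T = S"
proof (rule largest_entries_eq_planted[OF T])
  fix i j assume ij: "i \<in> S" "j \<in> {..<n} - S"
  have k1: "1 \<le> sqrt (real k)"
  proof -
    have "\<epsilon> * real k \<le> 1 * real k" using \<epsilon> by (intro mult_right_mono) auto
    then show ?thesis using k_large by simp
  qed
  have \<gamma>0: "0 \<le> \<gamma>"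
  proof -
    have "1 \<le> k" using k1 by (cases k) auto
    then show ?thesis using signal by (simp add: \<gamma>_def)
  qed
  have link_le: "\<epsilon> * \<gamma> / sqrt (real k) \<le> \<epsilon> * \<gamma>"
  proof -
    have "\<epsilon> * \<gamma> / sqrt (real k) \<le> \<epsilon> * \<gamma> / 1"
      using k1 \<epsilon> \<gamma>0 by (intro divide_left_mono mult_nonneg_nonneg) auto
    then show ?thesis by simp
  qed
  have M: "adjacency n d H - null_mean n d p \<in> carrier_mat n n"
    by (rule minus_carrier_mat) (simp add: null_mean_def)
  obtain \<mu> where top': "top_eigenpair n (planted S signal (noise H)) (\<lambda>i. vec_index u i) \<mu>"
    using top_unit_eigenvector_top_eigenpair[OF M centered_adjacency_eq[OF H] symmetric_planted[OF noise_symmetric] _ top] n3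
    by auto
  show "\<bar>vec_index u j\<bar> < \<bar>vec_index u i\<bar>"
  proof (rule planted_entries_separate[OF S_sub card_S signal \<gamma>_def[THEN meta_eq_to_obj_eq] \<epsilon> k_large noise_symmetric G1 top' _ ij])
    fix l assume l: "l < n"
    let ?x = "loo_vector l H"
    interpret St: vertex_star free "\<lambda>e. e" "\<lambda>e. of_bool (H e) - p" n l "\<epsilon> * \<gamma>"
      by unfold_locales (use finite_F l G1 in \<open>auto simp: noise_def\<close>)
    obtain \<mu>' where topx: "top_eigenpair n (planted S signal (rest_noise l H)) ?x \<mu>'" and sgn: "0 \<le> (\<Sum>j\<in>S. ?x j)"
      using loo_vector by blast
    have nx: "norm_upto n ?x = 1" using topx by (simp add: top_eigenpair_def)
    have link: "form_bounded n St.link_mat (\<epsilon> * \<gamma> / sqrt (real k))" using G2[OF l] by (simp add: link_noise_def)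
    have rest: "form_bounded n (rest_noise l H) (4 * (\<epsilon> * \<gamma>))"
      unfolding rest_noise_def by (rule St.form_bounded_rest[OF form_bounded_mono[OF link link_le]])
    have "(\<lambda>i j. noise H i j - rest_noise l H i j) = St.star_mat"
      unfolding noise_def rest_noise_def by (intro ext St.star_eq)
    moreover have "norm_upto n (mat_apply n St.link_mat ?x) \<le> \<epsilon> * \<gamma> / sqrt (real k) * norm_upto n ?x"
      by (rule form_bounded_mat_apply[OF _ link]) (simp add: symmetric_upto_def weighted_adjacency_sym)
    ultimately have "norm_upto n (mat_apply n (\<lambda>i j. noise H i j - rest_noise l H i j) ?x)
        \<le> \<bar>mat_apply n (noise H) ?x l\<bar> + \<epsilon> * \<gamma> * \<bar>?x l\<bar> + \<epsilon> * \<gamma> / sqrt (real (card S))"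
      using St.norm_star_apply_le[of ?x] nx by (simp add: noise_def card_S)
    then have loo: "leave_one_out n S signal (\<epsilon> * \<gamma>) (noise H) l ?x"
      unfolding leave_one_out_def using rest topx sgn by blast
    have "\<bar>mat_apply n (noise H) ?x l\<bar> \<le> \<epsilon> * \<gamma> * (1 / sqrt (real k) + v)" if "\<forall>j<n. \<bar>?x j\<bar> \<le> v" for v
    proof -
      have "\<epsilon> * \<gamma> * sup_norm ?x \<le> \<epsilon> * \<gamma> * v"
        using that \<epsilon> \<gamma>0 by (intro mult_left_mono sup_norm_le) auto
      then show ?thesis using G3[OF l] by (simp add: distrib_left)
    qed
    then show "\<exists>x. leave_one_out n S signal (\<epsilon> * \<gamma>) (noise H) l x \<and>
       (\<forall>v. (\<forall>j<n. \<bar>x j\<bar> \<le> v) \<longrightarrow> \<bar>mat_apply n (noise H) x l\<bar> \<le> \<epsilon> * \<gamma> * (1 / sqrt (real k) + v))"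
      using loo by blast
  qed
qed

text \<open>The good event asks for the norm of the noise, the norms of the \<open>n\<close> links, and the rows of the
  noise at the \<open>n\<close> leave-one-out vectors to be small compared to the signal. The rule
  \<open>T\<close> may pick any set of largest entries of any top eigenvector, which covers every way of
  breaking ties.\<close>

lemma prob_recovery_failure:
  fixes \<epsilon> :: real
  defines "\<gamma> \<equiv> signal * (real k - 1)" and "C \<equiv> noise_norm_const d"
  assumes \<epsilon>: "0 < \<epsilon>" "\<epsilon> \<le> 1 / 100" and k_large: "1 \<le> \<epsilon> * real k" and signal: "0 < signal"
    and a: "C * sqrt (max (p * real n ^ (d - 1)) (ln (real n))) \<le> \<epsilon> * \<gamma>"
    and b: "C * sqrt (max (p * real n ^ (d - 2)) (ln (real n))) \<le> \<epsilon> * \<gamma> / sqrt (real k)"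
    and c: "4 * sqrt (real d * p * real n ^ (d - 2) * ln (real n)) \<le> \<epsilon> * \<gamma> / sqrt (real k)"
    and e: "4 * real d * ln (real n) \<le> \<epsilon> * \<gamma>"
    and T: "\<And>H. H \<in> set_pmf law \<Longrightarrow>
       \<exists>u. top_unit_eigenvector (adjacency n d H - null_mean n d p) u \<and> largest_entries n k u (T H)"
  shows "measure_pmf.prob law {H. T H \<noteq> S} \<le> 10 / real n"
proof -
  let ?B1 = "{H. \<not> form_bounded n (noise H) (\<epsilon> * \<gamma>)}"
  let ?B2 = "\<lambda>i. {H. \<not> form_bounded n (link_noise i H) (\<epsilon> * \<gamma> / sqrt (real k))}"
  let ?B3 = "\<lambda>i. {H. \<epsilon> * \<gamma> / sqrt (real k) + \<epsilon> * \<gamma> * sup_norm (loo_vector i H) \<le> \<bar>mat_apply n (noise H) (loo_vector i H) i\<bar>}"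
  have p1: "measure_pmf.prob law ?B1 \<le> 4 / (real n)\<^sup>2"
  proof -
    have "measure_pmf.prob law ?B1 \<le> measure_pmf.prob law {H. \<not> form_bounded n (noise H) (C * sqrt (max (p * real n ^ (d - 1)) (ln (real n))))}"
      using a form_bounded_mono by (intro measure_pmf.finite_measure_mono) auto
    also have "\<dots> \<le> 4 / (real n)\<^sup>2" unfolding C_def by (rule prob_noise_large) auto
    finally show ?thesis .
  qed
  have p2: "measure_pmf.prob law (?B2 i) \<le> 4 / (real n)\<^sup>2" if "i < n" for i
  proof -
    have "measure_pmf.prob law (?B2 i) \<le> measure_pmf.prob law {H. \<not> form_bounded n (link_noise i H) (C * sqrt (max (p * real n ^ (d - 2)) (ln (real n))))}"
      using b form_bounded_mono by (intro measure_pmf.finite_measure_mono) auto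
    also have "\<dots> \<le> 4 / (real n)\<^sup>2" unfolding C_def by (rule prob_link_noise_large[OF that]) auto
    finally show ?thesis .
  qed
  have p3: "measure_pmf.prob law (?B3 i) \<le> 2 / real n ^ 3" if "i < n" for i
    by (rule prob_loo_row_large[OF that c e])
  have "{H. T H \<noteq> S} \<inter> set_pmf law \<subseteq> ?B1 \<union> ((\<Union>i\<in>{..<n}. ?B2 i) \<union> (\<Union>i\<in>{..<n}. ?B3 i))"
  proof
    fix H assume H: "H \<in> {H. T H \<noteq> S} \<inter> set_pmf law"
    show "H \<in> ?B1 \<union> ((\<Union>i\<in>{..<n}. ?B2 i) \<union> (\<Union>i\<in>{..<n}. ?B3 i))"
    proof (rule ccontr)
      assume good: "H \<notin> ?B1 \<union> ((\<Union>i\<in>{..<n}. ?B2 i) \<union> (\<Union>i\<in>{..<n}. ?B3 i))"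
      obtain u where u: "top_unit_eigenvector (adjacency n d H - null_mean n d p) u" "largest_entries n k u (T H)"
        using T[of H] H by blast
      have "T H = S"
        by (rule recovery_on_good_event[OF \<epsilon> k_large signal _ _ _ _ u, folded \<gamma>_def])
           (use good H in \<open>auto simp: not_le\<close>)
      then show False using H by simp
    qed
  qed
  then have "measure_pmf.prob law {H. T H \<noteq> S} \<le> measure_pmf.prob law (?B1 \<union> ((\<Union>i\<in>{..<n}. ?B2 i) \<union> (\<Union>i\<in>{..<n}. ?B3 i)))"
    by (subst measure_Int_set_pmf[symmetric]) (intro measure_pmf.finite_measure_mono; simp)
  also have "\<dots> \<le> measure_pmf.prob law ?B1 + (measure_pmf.prob law (\<Union>i\<in>{..<n}. ?B2 i) + measure_pmf.prob law (\<Union>i\<in>{..<n}. ?B3 i))"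
    by (intro order_trans[OF measure_Un_le] add_left_mono measure_Un_le) auto
  also have "\<dots> \<le> 4 / (real n)\<^sup>2 + ((\<Sum>i<n. 4 / (real n)\<^sup>2) + (\<Sum>i<n. 2 / real n ^ 3))"
    by (intro add_mono p1 order_trans[OF measure_UNION_le] sum_mono p2 p3) auto
  also have "\<dots> = 4 / (real n)\<^sup>2 + 4 / real n + 2 / (real n)\<^sup>2"
    using n3 by (simp add: power2_eq_square power3_eq_cube)
  also have "\<dots> \<le> 10 / real n"
  proof -
    have "1 / (real n)\<^sup>2 \<le> 1 / real n"
      using n3 by (intro divide_left_mono) (auto simp: power2_eq_square)
    then show ?thesis by simp
  qed
  finally show ?thesis .
qed

end



section \<open>Signal strength in the asymptotic regime\<close>

lemma planted_signal_ge_power: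
  fixes q \<delta> :: real and k d :: nat
  assumes d: "3 \<le> d" and k: "2 * d \<le> k" and q: "\<delta> \<le> 1 - q" and \<delta>: "0 < \<delta>"
  shows "\<delta> / (2 * real d) ^ (d - 1) * real k ^ (d - 1) \<le> (1 - q) * real ((k - 2) choose (d - 2)) * (real k - 1)"
    and "0 < (1 - q) * real ((k - 2) choose (d - 2))"
proof -
  define x where "x = real k / (2 * real d)"
  have x0: "0 \<le> x" by (simp add: x_def)
  have "x \<le> real (k - 2) / real (d - 2)"
  proof -
    have "real k / (2 * real d) = (real k / 2) / real d" by simp
    also have "\<dots> \<le> real (k - 2) / real (d - 2)"
      using d k by (intro frac_le) auto
    finally show ?thesis by (simp add: x_def)
  qed
  then have "x ^ (d - 2) \<le> (real (k - 2) / real (d - 2)) ^ (d - 2)" using x0 by (intro power_mono)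
  also have "\<dots> \<le> real ((k - 2) choose (d - 2))"
    using d k by (intro binomial_ge_n_over_k_pow_k) auto
  finally have choose: "x ^ (d - 2) \<le> real ((k - 2) choose (d - 2))" .
  have "x \<le> real k / 2" unfolding x_def using d by (intro divide_left_mono) auto
  then have last: "x \<le> real k - 1" using d k by simp
  have "\<delta> / (2 * real d) ^ (d - 1) * real k ^ (d - 1) = \<delta> * x ^ (d - 1)"
    by (simp add: x_def power_divide)
  also have "x ^ (d - 1) = x ^ (d - 2) * x"
  proof -
    have "d - 1 = Suc (d - 2)" using d by simp
    then show ?thesis by (simp add: mult.commute)
  qed
  also have "\<delta> * (x ^ (d - 2) * x) \<le> (1 - q) * (real ((k - 2) choose (d - 2)) * (real k - 1))"
    using q \<delta> choose last x0 by (intro mult_mono) (auto intro!: mult_nonneg_nonneg)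
  finally show "\<delta> / (2 * real d) ^ (d - 1) * real k ^ (d - 1) \<le> (1 - q) * real ((k - 2) choose (d - 2)) * (real k - 1)"
    by (simp add: mult.assoc)
  have "0 < (k - 2) choose (d - 2)" using d k by (intro zero_less_binomial) auto
  then show "0 < (1 - q) * real ((k - 2) choose (d - 2))" using q \<delta> by simp
qed

text \<open>Write \<open>r = d - 1\<close>, and let \<open>D = p * n ^ r\<close> be the order of the degrees and \<open>X\<close> its root of order
  \<open>2 * r\<close>. The hypothesis on \<open>k\<close> makes \<open>k / X\<close> tend to infinity, and the signal \<open>\<gamma>\<close> is of the order of the
  power \<open>r\<close> of \<open>k\<close>. So \<open>\<gamma>\<close> dominates the power \<open>r\<close> of \<open>X\<close>, which is \<open>sqrt D\<close>, and \<open>\<gamma> / sqrt k\<close>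
  dominates the power \<open>r - 1 / 2\<close> of \<open>X\<close>, called \<open>Y\<close>. The square of \<open>Y\<close> is \<open>D / X\<close>, and \<open>X\<close> is at most
  \<open>sqrt n\<close>, so it exceeds \<open>D / n\<close> by a power of \<open>n\<close>. Finally \<open>Y\<close> is the power
  \<open>e = (2 * d - 3) / (4 * (d - 1))\<close> of \<open>D\<close>, and \<open>D\<close> is at least of the order of the power \<open>c\<close> of
  \<open>ln n\<close>; the lower bound on \<open>c\<close> says precisely that \<open>c * e\<close> is at least \<open>1\<close>, so that \<open>Y\<close> also
  dominates \<open>ln n\<close>.\<close>

lemma eventually_signal_dominates:
  fixes d :: nat and c M :: real and p :: "nat \<Rightarrow> real" and k :: "nat \<Rightarrow> nat"
  assumes d: "d \<ge> 3"
    and c: "c \<ge> 4 * (real d - 1) / (2 * real d - 3)"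
    and p_pos: "\<And>n. n \<ge> 1 \<Longrightarrow> p n > 0"
    and p_lower: "seq_gtrsim p (\<lambda>n. real n powr (- (real d - 1)) * ln (real n) powr c)"
    and p_upper: "(SUP n\<in>{1..}. ereal (p n)) < 1"
    and k: "\<And>n. n \<ge> 1 \<Longrightarrow> 1 \<le> k n \<and> k n \<le> n"
    and k_large: "seq_gg (\<lambda>n. real (k n))
           (\<lambda>n. (p n / (1 - p n)) powr (1 / (2 * (real d - 1))) * sqrt (real n))"
    and M: "0 < M"
  defines "\<gamma> \<equiv> \<lambda>n. (1 - p n) * real ((k n - 2) choose (d - 2)) * (real (k n) - 1)"
  shows "\<forall>\<^sub>F n in sequentially. p n < 1 \<and> 0 < (1 - p n) * real ((k n - 2) choose (d - 2)) \<and> M \<le> real (k n) \<and>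
    M * sqrt (p n * real n ^ (d - 1)) \<le> \<gamma> n \<and> M * ln (real n) \<le> \<gamma> n / sqrt (real (k n)) \<and>
    M * sqrt (p n * real n ^ (d - 2) * ln (real n)) \<le> \<gamma> n / sqrt (real (k n))"
proof -
  define r where "r = real (d - 1)"
  define s where "s = 1 / (2 * r)"
  define e where "e = s * (r - 1 / 2)"
  have r: "real d - 1 = r" "2 \<le> r" using d by (simp_all add: r_def of_nat_diff)
  have s0: "0 < s" using r by (simp add: s_def)
  have sr: "s * r = 1 / 2" using r by (simp add: s_def)
  have e0: "0 < e" using r s0 by (simp add: e_def)
  have e2: "2 * e = 1 - s" using sr by (simp add: e_def algebra_simps)
  have ce: "1 \<le> c * e"
  proof -
    have "c \<ge> 4 * r / (2 * r - 1)" using c unfolding r(1)[symmetric] by (simp add: algebra_simps)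
    then have le: "4 * r / (2 * r - 1) * e \<le> c * e" using e0 by (intro mult_right_mono) auto
    have "e = (2 * r - 1) / (4 * r)" using r by (simp add: e_def s_def field_simps)
    then have "4 * r / (2 * r - 1) * e = 1" using r by simp
    then show ?thesis using le by (simp only:)
  qed
  have c0: "0 < c" using ce e0 zero_less_mult_pos2[of c e] by linarith
  obtain q where q: "(SUP n\<in>{1..}. ereal (p n)) < ereal q" "ereal q < 1"
    using ereal_dense2[OF p_upper] by blast
  define \<delta> where "\<delta> = 1 - q"
  have \<delta>0: "0 < \<delta>" using q(2) by (simp add: \<delta>_def)
  have p_le: "p n \<le> q" if "1 \<le> n" for n
  proof -
    have "ereal (p n) \<le> (SUP n\<in>{1..}. ereal (p n))" using that by (intro SUP_upper) auto
    then have "ereal (p n) \<le> ereal q" using q(1) by (meson less_imp_le order_trans)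
    then show ?thesis by simp
  qed
  obtain B0 where B0: "limsup (\<lambda>n. ereal (real n powr (- (real d - 1)) * ln (real n) powr c / p n)) < ereal B0"
    using ereal_dense2[OF p_lower[unfolded seq_gtrsim_def]] by blast
  define B where "B = max B0 1"
  have B1: "1 \<le> B" by (simp add: B_def)
  define D where "D n = p n * real n ^ (d - 1)" for n
  define X where "X n = D n powr s" for n
  define Y where "Y n = D n powr e" for n
  have D_pos: "0 < D n" if "1 \<le> n" for n using p_pos[OF that] that by (simp add: D_def)
  have X_eq: "X n = p n powr s * sqrt (real n)" if "1 \<le> n" for n
  proof -
    have "X n = p n powr s * (real n ^ (d - 1)) powr s"
      using p_pos[OF that] that by (simp add: X_def D_def powr_mult)
    also have "(real n ^ (d - 1)) powr s = real n powr (s * r)"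
      using that by (simp add: r_def powr_realpow[symmetric] powr_powr mult.commute)
    also have "\<dots> = sqrt (real n)" unfolding sr by (simp add: powr_half_sqrt)
    finally show ?thesis .
  qed
  have "\<forall>\<^sub>F n in sequentially. ereal (real n powr (- (real d - 1)) * ln (real n) powr c / p n) < ereal B0"
    by (rule Limsup_lessD[OF B0])
  then have D_lower: "\<forall>\<^sub>F n in sequentially. ln (real n) powr c / B \<le> D n"
    using eventually_ge_at_top[of 1]
  proof eventually_elim
    case (elim n)
    have "real n powr (- r) * ln (real n) powr c / p n \<le> B" using elim by (simp add: r(1) B_def)
    then have "real n powr (- r) * ln (real n) powr c \<le> B * p n" using p_pos[OF elim(2)] by (simp add: divide_le_eq)
    then have "real n powr r * (real n powr (- r) * ln (real n) powr c) \<le> real n powr r * (B * p n)"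
      by (intro mult_left_mono) auto
    moreover have "real n powr r * (real n powr (- r) * ln (real n) powr c) = ln (real n) powr c"
      using elim(2) by (simp add: mult.assoc[symmetric] powr_add[symmetric])
    moreover have "real n powr r = real n ^ (d - 1)" using elim(2) by (simp add: r_def powr_realpow)
    ultimately have "ln (real n) powr c \<le> real n ^ (d - 1) * (B * p n)" by (simp only:)
    also have "\<dots> = B * D n" by (simp add: D_def)
    finally have "ln (real n) powr c \<le> B * D n" .
    then show ?case using B1 by (simp add: divide_le_eq mult.commute)
  qed
  define c2 where "c2 = \<delta> / (2 * real d) ^ (d - 1)"
  have c20: "0 < c2" using \<delta>0 d by (simp add: c2_def)
  define M' where "M' = M * B powr e"
  have Be: "1 \<le> B powr e" using B1 e0 by (simp add: ge_one_powr_ge_zero)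
  have "M * 1 \<le> M'" unfolding M'_def using M Be by (intro mult_left_mono) auto
  then have M': "0 < M'" "M \<le> M'" using M by simp_all
  \<comment> \<open>both exponents of \<open>k / X\<close> in use are at least \<open>1\<close>, so the factor \<open>1 / \<eta>\<close> is gained in either case\<close>
  define \<eta> where "\<eta> = min 1 (c2 / M')"
  have \<eta>: "0 < \<eta>" "\<eta> \<le> 1" "M' \<le> c2 * (1 / \<eta>)"
  proof -
    show "0 < \<eta>" "\<eta> \<le> 1" using c20 M' by (simp_all add: \<eta>_def)
    have "\<eta> \<le> c2 / M'" by (simp add: \<eta>_def)
    then have "M' * \<eta> \<le> c2" using M' by (simp add: field_simps)
    then show "M' \<le> c2 * (1 / \<eta>)" using \<open>0 < \<eta>\<close> by (simp add: field_simps)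
  qed
  have "\<forall>\<^sub>F n in sequentially. (p n / (1 - p n)) powr (1 / (2 * (real d - 1))) * sqrt (real n) / real (k n) < \<eta>"
    using order_tendstoD(2)[OF k_large[unfolded seq_gg_def] \<eta>(1)] .
  then have k_ge: "\<forall>\<^sub>F n in sequentially. X n / \<eta> \<le> real (k n)"
    using eventually_ge_at_top[of 1]
  proof eventually_elim
    case (elim n)
    have p: "0 < p n" "p n \<le> q" using p_pos p_le elim(2) by auto
    have "X n = p n powr s * sqrt (real n)" by (rule X_eq[OF elim(2)])
    also have "p n powr s * sqrt (real n) \<le> (p n / (1 - p n)) powr s * sqrt (real n)"
    proof (intro mult_right_mono powr_mono2)
      show "p n \<le> p n / (1 - p n)"
        using p \<delta>0 by (simp add: \<delta>_def le_divide_eq mult_le_cancel_left1)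
    qed (use p s0 in auto)
    also have "\<dots> \<le> \<eta> * real (k n)"
      using elim k[OF elim(2)] by (simp add: r(1) s_def divide_less_eq)
    finally show ?case using \<eta> by (simp add: divide_le_eq mult.commute)
  qed
  have X_large: "\<forall>\<^sub>F n in sequentially. max M (2 * real d) \<le> X n"
  proof -
    have "filterlim (\<lambda>n::nat. ln (real n) powr (c * s)) at_top sequentially"
      by (rule filterlim_compose[OF real_powr_at_top filterlim_compose[OF ln_at_top filterlim_real_sequentially]])
         (use c0 s0 in simp)
    then have "\<forall>\<^sub>F n in sequentially. max M (2 * real d) * B powr s \<le> ln (real n) powr (c * s)"
      by (simp add: filterlim_at_top)
    with D_lower eventually_ge_at_top[of 1] show ?thesis
    proof eventually_elim
      case (elim n)
      have "max M (2 * real d) \<le> ln (real n) powr (c * s) / B powr s" using elim(3) B1 by (simp add: le_divide_eq)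
      also have "\<dots> = (ln (real n) powr c / B) powr s" using B1 by (simp add: powr_divide powr_powr)
      also have "\<dots> \<le> X n" unfolding X_def using elim(1) s0 B1 by (intro powr_mono2) auto
      finally show ?case .
    qed
  qed
  have Y_log: "\<forall>\<^sub>F n in sequentially. ln (real n) \<le> B powr e * Y n"
    using D_lower eventually_ge_at_top[of 3]
  proof eventually_elim
    case (elim n)
    have "exp 1 \<le> real n" using exp_le elim(2) by linarith
    then have ln1: "1 \<le> ln (real n)" using elim(2) by (simp add: ln_ge_iff)
    then have "ln (real n) powr 1 \<le> ln (real n) powr (c * e)" using ce by (intro powr_mono)
    then have "ln (real n) \<le> ln (real n) powr (c * e)" using ln1 by simp
    also have "\<dots> = B powr e * (ln (real n) powr c / B) powr e" using B1 by (simp add: powr_divide powr_powr)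
    also have "\<dots> \<le> B powr e * Y n"
      unfolding Y_def using elim(1) e0 B1 by (intro mult_left_mono powr_mono2) auto
    finally show ?case .
  qed
  have Y_var: "\<forall>\<^sub>F n in sequentially. sqrt (p n * real n ^ (d - 2) * ln (real n)) \<le> Y n"
  proof -
    have "\<forall>\<^sub>F n :: nat in sequentially. ln (real n) \<le> sqrt (real n)" by real_asymp
    then show ?thesis using eventually_ge_at_top[of 3]
    proof eventually_elim
      case (elim n)
      have n1: "1 \<le> n" using elim by simp
      have p: "0 < p n" "p n \<le> 1" using p_pos p_le q(2) n1 by (auto intro: order_trans[OF p_le])
      have "X n = p n powr s * sqrt (real n)" by (rule X_eq[OF n1])
      also have "p n powr s * sqrt (real n) \<le> 1 * sqrt (real n)"
        using p s0 by (intro mult_right_mono) (auto simp: powr_le1)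
      finally have X_le: "X n \<le> sqrt (real n)" by simp
      have "p n * real n ^ (d - 2) * ln (real n) \<le> p n * real n ^ (d - 2) * sqrt (real n)"
        using elim(1) p by (intro mult_left_mono) auto
      also have "\<dots> = D n / sqrt (real n)"
      proof -
        have "d - 1 = Suc (d - 2)" using d by simp
        then have "D n / sqrt (real n) = p n * real n ^ (d - 2) * (real n / sqrt (real n))" by (simp add: D_def)
        then show ?thesis by (simp only: real_div_sqrt of_nat_0_le_iff)
      qed
      also have "\<dots> \<le> D n / X n"
        using X_le D_pos[OF n1] n1 by (intro divide_left_mono) (auto simp: X_def)
      also have "\<dots> = (Y n)\<^sup>2"
      proof -
        have "(Y n)\<^sup>2 = D n powr (2 * e)" using D_pos[OF n1] by (simp add: Y_def power2_eq_square powr_add[symmetric])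
        then show ?thesis using D_pos[OF n1] by (simp add: e2 powr_diff X_def)
      qed
      finally show ?case by (intro real_le_lsqrt) (auto simp: Y_def)
    qed
  qed
  show ?thesis
    using k_ge X_large Y_log Y_var eventually_ge_at_top[of 3]
  proof eventually_elim
    case (elim n)
    have n1: "1 \<le> n" using elim by simp
    have X0: "0 < X n" using elim(2) M by simp
    have Y0: "0 \<le> Y n" by (simp add: Y_def)
    have "X n * 1 \<le> X n * (1 / \<eta>)" using X0 \<eta> by (intro mult_left_mono) auto
    then have "X n \<le> real (k n)" using elim(1) by simp
    then have "M \<le> real (k n) \<and> 2 * real d \<le> real (k n)" using elim(2) by auto
    then have kM: "M \<le> real (k n)" and kd: "2 * d \<le> k n" by linarith+
    have k0: "0 < real (k n)" using kM M by linarith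
    have p: "0 < p n" "p n \<le> q" using p_pos p_le n1 by auto
    have q1: "\<delta> \<le> 1 - p n" using p by (simp add: \<delta>_def)
    have sig: "0 < (1 - p n) * real ((k n - 2) choose (d - 2))"
      by (rule planted_signal_ge_power(2)[OF d kd q1 \<delta>0])
    have \<gamma>_ge: "c2 * real (k n) powr r \<le> \<gamma> n"
      using planted_signal_ge_power(1)[OF d kd q1 \<delta>0] k0
      by (simp add: c2_def \<gamma>_def r_def powr_realpow)
    have pow: "M' * X n powr a \<le> c2 * real (k n) powr a" if a: "1 \<le> a" for a
    proof -
      have "M' * X n powr a \<le> c2 * (1 / \<eta>) * X n powr a" using \<eta> by (intro mult_right_mono) auto
      also have "\<dots> \<le> c2 * (1 / \<eta>) powr a * X n powr a"
        using powr_mono[OF a, of "1 / \<eta>"] \<eta> c20 by (intro mult_right_mono mult_left_mono) auto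
      also have "\<dots> = c2 * (X n / \<eta>) powr a" using X0 \<eta> by (simp add: powr_divide)
      also have "\<dots> \<le> c2 * real (k n) powr a"
        using elim(1) X0 \<eta> a c20 by (intro mult_left_mono powr_mono2) auto
      finally show ?thesis .
    qed
    have XY: "X n powr r = sqrt (D n)" "X n powr (r - 1 / 2) = Y n"
      using D_pos[OF n1] by (simp_all add: X_def Y_def powr_powr sr e_def powr_half_sqrt)
    have "M * sqrt (D n) \<le> M' * sqrt (D n)" using M' D_pos[OF n1] by (intro mult_right_mono) auto
    also have "\<dots> \<le> \<gamma> n" using pow[of r] \<gamma>_ge r by (simp add: XY)
    finally have 1: "M * sqrt (p n * real n ^ (d - 1)) \<le> \<gamma> n" by (simp add: D_def)
    have 2: "M' * Y n \<le> \<gamma> n / sqrt (real (k n))"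
    proof -
      have "M' * Y n \<le> c2 * real (k n) powr (r - 1 / 2)" using pow[of "r - 1 / 2"] r by (simp add: XY)
      also have "\<dots> = c2 * real (k n) powr r / sqrt (real (k n))"
        using k0 by (simp add: powr_diff powr_half_sqrt)
      also have "\<dots> \<le> \<gamma> n / sqrt (real (k n))" using \<gamma>_ge by (intro divide_right_mono) auto
      finally show ?thesis .
    qed
    have "M * ln (real n) \<le> M * (B powr e * Y n)" using elim(3) M by (intro mult_left_mono) auto
    then have 3: "M * ln (real n) \<le> \<gamma> n / sqrt (real (k n))" using 2 by (simp add: M'_def mult.assoc)
    have "M * sqrt (p n * real n ^ (d - 2) * ln (real n)) \<le> M' * Y n"
      using elim(4) M M' Y0 p n1 elim(5) by (intro mult_mono) auto
    then have 4: "M * sqrt (p n * real n ^ (d - 2) * ln (real n)) \<le> \<gamma> n / sqrt (real (k n))" using 2 by linarith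
    have "p n < 1" using q1 \<delta>0 by linarith
    then show ?case using sig kM 1 3 4 by blast
  qed
qed

section \<open>Exact recovery\<close>

lemma sqrt_max_le:
  assumes "0 \<le> C" "C * sqrt a \<le> t" "C * sqrt b \<le> t" shows "C * sqrt (max a b) \<le> t"
  using assms by (simp add: max_def)

theorem corollary3p4:
  fixes d :: nat and c :: real and p :: "nat \<Rightarrow> real" and k :: "nat \<Rightarrow> nat"
    and u :: "nat \<Rightarrow> real mat \<times> nat set \<Rightarrow> real vec"
    and Shat :: "nat \<Rightarrow> real mat \<times> nat set \<Rightarrow> nat set"
  assumes "d \<ge> 3"
    and "c \<ge> 4 * (real d - 1) / (2 * real d - 3)"
    and "\<And>n. n \<ge> 1 \<Longrightarrow> p n > 0"
    and "seq_gtrsim p (\<lambda>n. real n powr (- (real d - 1)) * ln (real n) powr c)"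
    and "(SUP n\<in>{1..}. ereal (p n)) < 1"
    and "\<And>n. n \<ge> 1 \<Longrightarrow> 1 \<le> k n \<and> k n \<le> n"
    and "seq_gg (\<lambda>n. real (k n))
           (\<lambda>n. (p n / (1 - p n)) powr (1 / (2 * (real d - 1))) * sqrt (real n))"
    and "\<And>n A S. n \<ge> 1 \<Longrightarrow> (A, S) \<in> set_pmf (HPC n d (k n) (p n)) \<Longrightarrow>
           top_unit_eigenvector (A - null_mean n d (p n)) (u n (A, S))"
    and "\<And>n A S. n \<ge> 1 \<Longrightarrow> (A, S) \<in> set_pmf (HPC n d (k n) (p n)) \<Longrightarrow>
           largest_entries n (k n) (u n (A, S)) (Shat n (A, S))"
  shows "(\<lambda>n. measure_pmf.prob (HPC n d (k n) (p n)) {(A, S). Shat n (A, S) = S})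
           \<longlonglongrightarrow> 1"
proof -
  define C where "C = noise_norm_const d"
  have C0: "0 \<le> C"
    by (simp add: C_def noise_norm_const_nonneg)
  define M where "M = 100 * (C + 4 * real d + 1)"
  have M: "0 < M" "100 * C \<le> M" "400 * real d \<le> M" "100 \<le> M" using C0 by (simp_all add: M_def)
  have dominates: "\<forall>\<^sub>F n in sequentially. p n < 1 \<and> 0 < (1 - p n) * real ((k n - 2) choose (d - 2)) \<and> M \<le> real (k n) \<and>
      M * sqrt (p n * real n ^ (d - 1)) \<le> (1 - p n) * real ((k n - 2) choose (d - 2)) * (real (k n) - 1) \<and>
      M * ln (real n) \<le> (1 - p n) * real ((k n - 2) choose (d - 2)) * (real (k n) - 1) / sqrt (real (k n)) \<and>
      M * sqrt (p n * real n ^ (d - 2) * ln (real n))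
        \<le> (1 - p n) * real ((k n - 2) choose (d - 2)) * (real (k n) - 1) / sqrt (real (k n))"
  proof (rule eventually_signal_dominates[where c = c])
    show "0 < p n" if "1 \<le> n" for n using that by (rule assms(3))
    show "1 \<le> k n \<and> k n \<le> n" if "1 \<le> n" for n using that by (rule assms(6))
  qed (rule assms(1) assms(2) assms(4) assms(5) assms(7) M(1))+
  have lower: "\<forall>\<^sub>F n in sequentially. 1 - 10 / real n
      \<le> measure_pmf.prob (HPC n d (k n) (p n)) {(A, S). Shat n (A, S) = S}"
    using dominates eventually_ge_at_top[of 3]
  proof eventually_elim
    case (elim n)
    let ?HPC = "HPC n d (k n) (p n)"
    let ?\<gamma> = "(1 - p n) * real ((k n - 2) choose (d - 2)) * (real (k n) - 1)"
    have n1: "1 \<le> n" using elim by simp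
    have kn: "1 \<le> k n" "k n \<le> n" using assms(6)[OF n1] by auto
    have sup_pmf: "set_pmf (pmf_of_set (subsets_of_size n (k n))) = subsets_of_size n (k n)"
    proof (rule set_pmf_of_set)
      have "{..<k n} \<in> subsets_of_size n (k n)" using kn by (auto simp: subsets_of_size_def)
      then show "subsets_of_size n (k n) \<noteq> {}" by blast
    qed (rule finite_subsets_of_size)
    have ln1: "1 \<le> ln (real n)"
    proof -
      have "exp 1 \<le> real n" using exp_le elim(2) by linarith
      then show ?thesis using n1 by (simp add: ln_ge_iff)
    qed
    have sqrt_ln: "sqrt (ln (real n)) \<le> ln (real n)"
      using ln1 by (intro real_le_lsqrt) (auto simp: power2_eq_square)
    have g: "M * sqrt (p n * real n ^ (d - 1)) \<le> ?\<gamma>" "M * ln (real n) \<le> ?\<gamma> / sqrt (real (k n))"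
      "M * sqrt (p n * real n ^ (d - 2) * ln (real n)) \<le> ?\<gamma> / sqrt (real (k n))"
      using elim(1) by auto
    have \<gamma>_ge: "?\<gamma> / sqrt (real (k n)) \<le> ?\<gamma>"
    proof -
      have "0 \<le> ?\<gamma>" using elim(1) kn by (intro mult_nonneg_nonneg) auto
      then have "?\<gamma> / sqrt (real (k n)) \<le> ?\<gamma> / 1" using kn by (intro divide_left_mono) auto
      then show ?thesis by simp
    qed
    have scale: "a * x \<le> 1 / 100 * t" if "100 * a \<le> M" "0 \<le> x" "M * x \<le> t" for a x t :: real
      using mult_right_mono[OF that(1,2)] that(3) by simp
    have "measure_pmf.prob ?HPC (- {(A, S). Shat n (A, S) = S}) \<le> 10 / real n"
      unfolding HPC_alt
    proof (rule prob_bind_pmf_le)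
      fix S assume "S \<in> set_pmf (pmf_of_set (subsets_of_size n (k n)))"
      then have S: "S \<in> subsets_of_size n (k n)" using sup_pmf by simp
      interpret planted_model n d "k n" "p n" S
        by unfold_locales (use S assms(1) assms(3)[OF n1] elim in auto)
      have mem: "(adjacency n d H, S) \<in> set_pmf ?HPC" if "H \<in> set_pmf law" for H
        unfolding HPC_alt using that S sup_pmf by auto
      have "measure_pmf.prob law {H. Shat n (adjacency n d H, S) \<noteq> S} \<le> 10 / real n"
      proof (rule prob_recovery_failure[where \<epsilon> = "1 / 100"])
        show "0 < signal" using elim(1) by (simp add: signal_def)
        show "1 \<le> 1 / 100 * real (k n)" using elim(1) M by linarith
        show "noise_norm_const d * sqrt (max (p n * real n ^ (d - 1)) (ln (real n)))
            \<le> 1 / 100 * (signal * (real (k n) - 1))"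
          unfolding C_def[symmetric] signal_def
        proof (intro sqrt_max_le C0 scale M(2))
          have "M * sqrt (ln (real n)) \<le> M * ln (real n)" using sqrt_ln M by (intro mult_left_mono) auto
          then show "M * sqrt (ln (real n)) \<le> ?\<gamma>" using g(2) \<gamma>_ge by linarith
        qed (use g(1) assms(3)[OF n1] ln1 in auto)
        have div: "1 / 100 * (signal * (real (k n) - 1)) / sqrt (real (k n)) = 1 / 100 * (?\<gamma> / sqrt (real (k n)))"
          by (simp add: signal_def)
        show "noise_norm_const d * sqrt (max (p n * real n ^ (d - 2)) (ln (real n)))
            \<le> 1 / 100 * (signal * (real (k n) - 1)) / sqrt (real (k n))"
          unfolding C_def[symmetric] div
        proof (intro sqrt_max_le C0 scale M(2))
          have "M * sqrt (ln (real n)) \<le> M * ln (real n)" using sqrt_ln M by (intro mult_left_mono) auto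
          then show "M * sqrt (ln (real n)) \<le> ?\<gamma> / sqrt (real (k n))" using g(2) by linarith
          have "p n * real n ^ (d - 2) * 1 \<le> p n * real n ^ (d - 2) * ln (real n)"
            using assms(3)[OF n1] ln1 by (intro mult_left_mono) auto
          then have "M * sqrt (p n * real n ^ (d - 2)) \<le> M * sqrt (p n * real n ^ (d - 2) * ln (real n))"
            using M by (intro mult_left_mono) auto
          then show "M * sqrt (p n * real n ^ (d - 2)) \<le> ?\<gamma> / sqrt (real (k n))" using g(3) by linarith
        qed (use assms(3)[OF n1] ln1 in auto)
        show "4 * sqrt (real d * p n * real n ^ (d - 2) * ln (real n))
            \<le> 1 / 100 * (signal * (real (k n) - 1)) / sqrt (real (k n))"
        proof -
          have "sqrt (real d) \<le> real d" using assms(1) by (intro real_le_lsqrt) (auto simp: power2_eq_square)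
          then have "(4 * sqrt (real d)) * sqrt (p n * real n ^ (d - 2) * ln (real n)) \<le> 1 / 100 * (?\<gamma> / sqrt (real (k n)))"
            using M(3) g(3) assms(3)[OF n1] ln1 by (intro scale) auto
          then show ?thesis unfolding div by (simp add: real_sqrt_mult mult_ac)
        qed
        have "4 * real d * ln (real n) \<le> 1 / 100 * ?\<gamma>"
          using M(3) g(2) \<gamma>_ge ln1 by (intro scale) auto
        then show "4 * real d * ln (real n) \<le> 1 / 100 * (signal * (real (k n) - 1))"
          by (simp add: signal_def)
        show "\<exists>v. top_unit_eigenvector (adjacency n d H - null_mean n d (p n)) v \<and>
            largest_entries n (k n) v (Shat n (adjacency n d H, S))" if "H \<in> set_pmf law" for H
          using assms(8)[OF n1 mem[OF that]] assms(9)[OF n1 mem[OF that]] by blast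
      qed auto
      then show "measure_pmf.prob (map_pmf (\<lambda>H. (adjacency n d H, S)) law) (- {(A, S). Shat n (A, S) = S}) \<le> 10 / real n"
        by (simp add: measure_map_pmf vimage_def)
    qed
    then show ?case using measure_pmf.prob_compl[of "{(A, S). Shat n (A, S) = S}" ?HPC]
      by (simp add: Compl_eq_Diff_UNIV)
  qed
  show ?thesis
  proof (rule tendsto_sandwich[OF lower])
    show "\<forall>\<^sub>F n in sequentially. measure_pmf.prob (HPC n d (k n) (p n)) {(A, S). Shat n (A, S) = S} \<le> 1"
      by (simp add: measure_pmf.prob_le_1)
    show "(\<lambda>n. 1 - 10 / real n) \<longlonglongrightarrow> 1" by real_asymp
  qed simp
qed

end
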